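(* Let $\mathcal{A}$ be a small $2$-category and let $P:\mathcal{A}\to\mathcal{C}at$, $W:\mathcal{A}^{op}\to\mathcal{C}at$ be $2$-functors. Then $$\underset{(x,A)\in\mathcal{E}l_P^{op}}{\sigma\mathrm{colim}^{\mathscr{C}_P}}WA\;=\;p\!\!\int^{A}PA\times WA\;=\;p\!\!\int^{A}WA\times PA\;=\;\underset{(y,A)\in\mathcal{E}l_W^{op}}{\sigma\mathrm{colim}^{\mathscr{C}_W}}PA ,$$ in the sense that the universal properties in $\mathcal{C}at$ defining these objects are equivalent. Here the first term is the conical $\sigma$-colimit of $\mathcal{E}l_P^{op}\xrightarrow{\Diamond_P^{op}}\mathcal{A}^{op}\xrightarrow{W}\mathcal{C}at$ with respect to $\mathscr{C}_P$, the last is the conical $\sigma$-colimit of $\mathcal{E}l_W^{op}\xrightarrow{\Diamond_W^{op}}\mathcal{A}\xrightarrow{P}\mathcal{C}at$ with respect to $\mathscr{C}_W$, the second term is a pseudocoend indexed by $\mathcal{A}^{op}$, and the third a pseudocoend indexed by $\mathcal{A}$.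
   Context: $2$-categories and $2$-functors are strict; $\mathcal{A}^{op}$ reverses $1$-cells but not $2$-cells. For a $2$-functor $Q:\mathcal{K}\to\mathcal{C}at$, $\mathcal{E}l_Q$ has objects $(x,A)$ with $A\in\mathcal{K}$, $x\in QA$; morphisms $(x,A)\to(y,B)$ are pairs $(f,\varphi)$ with $f:A\to B$ in $\mathcal{K}$, $\varphi:Qf(x)\to y$; $2$-cells $(f,\varphi)\Rightarrow(g,\psi)$ are $2$-cells $\theta:f\Rightarrow g$ with $\psi(Q\theta)_x=\varphi$; composition $(g,\psi)(f,\varphi)=(gf,\psi\,Qg(\varphi))$. $\Diamond_Q:\mathcal{E}l_Q\to\mathcal{K}$ is the projection. $\mathscr{C}_Q$ consists of the arrows $(f,\varphi)$ with $\varphi$ invertible, also regarded as a $1$-subcategory of $\mathcal{E}l_Q^{op}$. This is applied to $Q=P$, $\mathcal{K}=\mathcal{A}$ and to $Q=W$, $\mathcal{K}=\mathcal{A}^{op}$. Conical $\sigma$-colimit of $F:\mathcal{I}\to\mathcal{B}$ with respect to a wide $1$-subcategory $\Sigma$ of $\mathcal{I}$ (a subcategory of the underlying category containing all objects): an object $L$ with a universal $\sigma$-cone. A $\sigma$-cone with vertex $E$ is given by arrows $\theta_i:Fi\to E$ and $2$-cells $\theta_u:\theta_jFu\Rightarrow\theta_i$ ($u:i\to j$) with $\theta_{id}=id$, $\theta_{vu}=\theta_u\circ\theta_vFu$, $\theta_v\circ\theta_jF\gamma=\theta_u$ for $\gamma:u\Rightarrow v$, and $\theta_u$ invertible for $u\in\Sigma$;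 morphisms are modifications. Universality: $\mathcal{B}(L,E)\to Cones_\sigma(F,E)$ is an isomorphism of categories for all $E$. Pseudocoend $p\!\int^AT(A,A)$ of $T:\mathcal{A}^{op}\times\mathcal{A}\to\mathcal{B}$: the universal pseudo-dicone. A pseudo-dicone with vertex $E$ consists of arrows $\lambda_A:T(A,A)\to E$ and invertible $2$-cells $\lambda_f:\lambda_BT(B,f)\Rightarrow\lambda_AT(f,A)$ for $f:A\to B$, with $\lambda_{id_A}=id$, $\lambda_{gf}=\lambda_fT(g,A)\circ\lambda_gT(C,f)$ for $A\xrightarrow{f}B\xrightarrow{g}C$, and $\lambda_AT(\gamma,A)\circ\lambda_f=\lambda_g\circ\lambda_BT(B,\gamma)$ for $\gamma:f\Rightarrow g$. A morphism $\lambda\to\lambda'$ is a family of $2$-cells $\rho_A:\lambda_A\Rightarrow\lambda'_A$ with $\lambda'_f\circ\rho_BT(B,f)=\rho_AT(f,A)\circ\lambda_f$. Universality: $\mathcal{B}(L,E)\to Dicones_p(T,E)$ is an isomorphism of categories for all $E$. In the third term $T(A,B)=WA\times PB$; in the second, $\mathcal{A}$ is replaced by $\mathcal{A}^{op}$ and the roles of $P$ and $W$ are exchanged. *)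

theory Defs
  imports "HOL-Library.FuncSet" "HOL-Library.Infinite_Typeclass"
begin

section \<open>Categories and functors\<close>

record ('o, 'a) cat =
  Ob :: "'o set"
  Ar :: "'a set"
  Dm :: "'a \<Rightarrow> 'o"
  Cd :: "'a \<Rightarrow> 'o"
  Idt :: "'o \<Rightarrow> 'a"
  Cmp :: "'a \<Rightarrow> 'a \<Rightarrow> 'a"

definition hom :: "('o, 'a) cat \<Rightarrow> 'o \<Rightarrow> 'o \<Rightarrow> 'a set" where
  "hom C x y = {f \<in> Ar C. Dm C f = x \<and> Cd C f = y}"

definition category :: "('o, 'a) cat \<Rightarrow> bool" where
  "category C \<longleftrightarrow>
     (\<forall>f \<in> Ar C. Dm C f \<in> Ob C \<and> Cd C f \<in> Ob C) \<and>
     (\<forall>x \<in> Ob C. Idt C x \<in> hom C x x) \<and>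
     (\<forall>f \<in> Ar C. \<forall>g \<in> Ar C. Dm C g = Cd C f \<longrightarrow> Cmp C g f \<in> hom C (Dm C f) (Cd C g)) \<and>
     (\<forall>f \<in> Ar C. Cmp C f (Idt C (Dm C f)) = f \<and> Cmp C (Idt C (Cd C f)) f = f) \<and>
     (\<forall>f \<in> Ar C. \<forall>g \<in> Ar C. \<forall>h \<in> Ar C. Dm C g = Cd C f \<longrightarrow> Dm C h = Cd C g \<longrightarrow>
        Cmp C h (Cmp C g f) = Cmp C (Cmp C h g) f)"

text \<open>The structure maps of a record are total functions.  For the objects of the 2-category of
  categories their values off the intended domain are fixed, so that two such categories with the
  same objects, arrows and structure are equal.\<close>

definition ext_category :: "('o, 'a) cat \<Rightarrow> bool" where
  "ext_category C \<longleftrightarrow> category C \<and>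
     Dm C \<in> extensional (Ar C) \<and> Cd C \<in> extensional (Ar C) \<and> Idt C \<in> extensional (Ob C) \<and>
     (\<forall>g f. \<not> (f \<in> Ar C \<and> g \<in> Ar C \<and> Dm C g = Cd C f) \<longrightarrow> Cmp C g f = undefined)"

definition invertible :: "('o, 'a) cat \<Rightarrow> 'a \<Rightarrow> bool" where
  "invertible C f \<longleftrightarrow> f \<in> Ar C \<and>
     (\<exists>g \<in> hom C (Cd C f) (Dm C f). Cmp C g f = Idt C (Dm C f) \<and> Cmp C f g = Idt C (Cd C f))"

definition is_functor ::
  "('o, 'a) cat \<Rightarrow> ('p, 'b) cat \<Rightarrow> ('o \<Rightarrow> 'p) \<Rightarrow> ('a \<Rightarrow> 'b) \<Rightarrow> bool" where
  "is_functor C D fo fa \<longleftrightarrow>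
     (\<forall>x \<in> Ob C. fo x \<in> Ob D \<and> fa (Idt C x) = Idt D (fo x)) \<and>
     (\<forall>f \<in> Ar C. fa f \<in> hom D (fo (Dm C f)) (fo (Cd C f))) \<and>
     (\<forall>f \<in> Ar C. \<forall>g \<in> Ar C. Dm C g = Cd C f \<longrightarrow> fa (Cmp C g f) = Cmp D (fa g) (fa f))"

definition is_iso_functor ::
  "('o, 'a) cat \<Rightarrow> ('p, 'b) cat \<Rightarrow> ('o \<Rightarrow> 'p) \<Rightarrow> ('a \<Rightarrow> 'b) \<Rightarrow> bool" where
  "is_iso_functor C D fo fa \<longleftrightarrow> is_functor C D fo fa \<and>
     (\<exists>go ga. is_functor D C go ga \<and>
        (\<forall>x \<in> Ob C. go (fo x) = x) \<and> (\<forall>f \<in> Ar C. ga (fa f) = f) \<and>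
        (\<forall>y \<in> Ob D. fo (go y) = y) \<and> (\<forall>g \<in> Ar D. fa (ga g) = g))"


section \<open>Strict 2-categories and 2-functors\<close>

text \<open>\<open>One\<close> is the underlying category of a 2-category; the objects of \<open>Two\<close> are the 1-cells, its
  arrows the 2-cells, and its composition is the vertical one.  \<open>HCmp \<beta> \<alpha>\<close> is the horizontal
  composite with \<open>\<alpha>\<close> applied first.\<close>

record ('k, 'f, 'c) cat2 =
  One :: "('k, 'f) cat"
  Two :: "('f, 'c) cat"
  HCmp :: "'c \<Rightarrow> 'c \<Rightarrow> 'c"

abbreviation dm0 :: "('k, 'f, 'c) cat2 \<Rightarrow> 'c \<Rightarrow> 'k" where
  "dm0 K \<alpha> \<equiv> Dm (One K) (Dm (Two K) \<alpha>)"

abbreviation cd0 :: "('k, 'f, 'c) cat2 \<Rightarrow> 'c \<Rightarrow> 'k" where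
  "cd0 K \<alpha> \<equiv> Cd (One K) (Dm (Two K) \<alpha>)"

definition two_category :: "('k, 'f, 'c) cat2 \<Rightarrow> bool" where
  "two_category K \<longleftrightarrow>
     category (One K) \<and> category (Two K) \<and> Ob (Two K) = Ar (One K) \<and>
     (\<forall>\<alpha> \<in> Ar (Two K). Dm (One K) (Cd (Two K) \<alpha>) = dm0 K \<alpha> \<and> Cd (One K) (Cd (Two K) \<alpha>) = cd0 K \<alpha>) \<and>
     (\<forall>\<alpha> \<in> Ar (Two K). \<forall>\<beta> \<in> Ar (Two K). dm0 K \<beta> = cd0 K \<alpha> \<longrightarrow>
        HCmp K \<beta> \<alpha> \<in> hom (Two K) (Cmp (One K) (Dm (Two K) \<beta>) (Dm (Two K) \<alpha>))
                                 (Cmp (One K) (Cd (Two K) \<beta>) (Cd (Two K) \<alpha>))) \<and>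
     (\<forall>\<alpha> \<in> Ar (Two K). HCmp K \<alpha> (Idt (Two K) (Idt (One K) (dm0 K \<alpha>))) = \<alpha> \<and>
                      HCmp K (Idt (Two K) (Idt (One K) (cd0 K \<alpha>))) \<alpha> = \<alpha>) \<and>
     (\<forall>\<alpha> \<in> Ar (Two K). \<forall>\<beta> \<in> Ar (Two K). \<forall>\<gamma> \<in> Ar (Two K).
        dm0 K \<beta> = cd0 K \<alpha> \<longrightarrow> dm0 K \<gamma> = cd0 K \<beta> \<longrightarrow>
        HCmp K \<gamma> (HCmp K \<beta> \<alpha>) = HCmp K (HCmp K \<gamma> \<beta>) \<alpha>) \<and>
     (\<forall>f \<in> Ar (One K). \<forall>g \<in> Ar (One K). Dm (One K) g = Cd (One K) f \<longrightarrow>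
        HCmp K (Idt (Two K) g) (Idt (Two K) f) = Idt (Two K) (Cmp (One K) g f)) \<and>
     (\<forall>\<alpha> \<in> Ar (Two K). \<forall>\<alpha>' \<in> Ar (Two K). \<forall>\<beta> \<in> Ar (Two K). \<forall>\<beta>' \<in> Ar (Two K).
        Dm (Two K) \<alpha>' = Cd (Two K) \<alpha> \<longrightarrow> Dm (Two K) \<beta>' = Cd (Two K) \<beta> \<longrightarrow> dm0 K \<beta> = cd0 K \<alpha> \<longrightarrow>
        HCmp K (Cmp (Two K) \<beta>' \<beta>) (Cmp (Two K) \<alpha>' \<alpha>) =
        Cmp (Two K) (HCmp K \<beta>' \<alpha>') (HCmp K \<beta> \<alpha>))"

text \<open>Whiskering: \<open>lwhisk B g \<alpha>\<close> is \<open>g\<alpha>\<close> and \<open>rwhisk B \<alpha> f\<close> is \<open>\<alpha>f\<close>.\<close>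

definition lwhisk :: "('k, 'f, 'c) cat2 \<Rightarrow> 'f \<Rightarrow> 'c \<Rightarrow> 'c" where
  "lwhisk B g \<alpha> = HCmp B (Idt (Two B) g) \<alpha>"

definition rwhisk :: "('k, 'f, 'c) cat2 \<Rightarrow> 'c \<Rightarrow> 'f \<Rightarrow> 'c" where
  "rwhisk B \<alpha> f = HCmp B \<alpha> (Idt (Two B) f)"

definition op1 :: "('o, 'a) cat \<Rightarrow> ('o, 'a) cat" where
  "op1 C = \<lparr>Ob = Ob C, Ar = Ar C, Dm = Cd C, Cd = Dm C, Idt = Idt C, Cmp = (\<lambda>g f. Cmp C f g)\<rparr>"

text \<open>1-cells are reversed, 2-cells are not.\<close>

definition op2 :: "('k, 'f, 'c) cat2 \<Rightarrow> ('k, 'f, 'c) cat2" where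
  "op2 K = \<lparr>One = op1 (One K), Two = Two K, HCmp = (\<lambda>\<beta> \<alpha>. HCmp K \<alpha> \<beta>)\<rparr>"

text \<open>The same data describe a 2-functor \<open>K \<rightarrow> L\<close> and its opposite \<open>op2 K \<rightarrow> op2 L\<close>.\<close>

record ('k, 'f, 'c, 'l, 'g, 'd) fun2 =
  F0 :: "'k \<Rightarrow> 'l"
  F1 :: "'f \<Rightarrow> 'g"
  F2 :: "'c \<Rightarrow> 'd"

definition two_functor ::
  "('k, 'f, 'c) cat2 \<Rightarrow> ('l, 'g, 'd) cat2 \<Rightarrow> ('k, 'f, 'c, 'l, 'g, 'd) fun2 \<Rightarrow> bool" where
  "two_functor K L F \<longleftrightarrow>
     is_functor (One K) (One L) (F0 F) (F1 F) \<and>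
     is_functor (Two K) (Two L) (F1 F) (F2 F) \<and>
     (\<forall>\<alpha> \<in> Ar (Two K). \<forall>\<beta> \<in> Ar (Two K). dm0 K \<beta> = cd0 K \<alpha> \<longrightarrow>
        F2 F (HCmp K \<beta> \<alpha>) = HCmp L (F2 F \<beta>) (F2 F \<alpha>))"

definition comp_fun2 ::
  "('l, 'g, 'd, 'm, 'h, 'e) fun2 \<Rightarrow> ('k, 'f, 'c, 'l, 'g, 'd) fun2 \<Rightarrow> ('k, 'f, 'c, 'm, 'h, 'e) fun2"
  where
  "comp_fun2 G F = \<lparr>F0 = F0 G \<circ> F0 F, F1 = F1 G \<circ> F1 F, F2 = F2 G \<circ> F2 F\<rparr>"

definition Hom :: "('k, 'f, 'c) cat2 \<Rightarrow> 'k \<Rightarrow> 'k \<Rightarrow> ('f, 'c) cat" where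
  "Hom B L E = \<lparr>Ob = hom (One B) L E,
                Ar = {\<alpha> \<in> Ar (Two B). Dm (Two B) \<alpha> \<in> hom (One B) L E \<and> Cd (Two B) \<alpha> \<in> hom (One B) L E},
                Dm = Dm (Two B), Cd = Cd (Two B), Idt = Idt (Two B), Cmp = Cmp (Two B)\<rparr>"


section \<open>The 2-category of categories\<close>

text \<open>The universe of small sets is modelled by a type \<open>'u\<close>: objects are the categories whose
  objects and arrows are elements of \<open>'u\<close>.\<close>

type_synonym 'u small_cat = "('u, 'u) cat"

record 'u fnc =
  FSrc :: "'u small_cat"
  FTgt :: "'u small_cat"
  FO :: "'u \<Rightarrow> 'u"
  FA :: "'u \<Rightarrow> 'u"

record 'u ntr =
  NSrc :: "'u fnc"
  NTgt :: "'u fnc"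
  NC :: "'u \<Rightarrow> 'u"

type_synonym ('k, 'f, 'c, 'u) cat_functor = "('k, 'f, 'c, 'u small_cat, 'u fnc, 'u ntr) fun2"

definition small_functor :: "'u fnc \<Rightarrow> bool" where
  "small_functor F \<longleftrightarrow> ext_category (FSrc F) \<and> ext_category (FTgt F) \<and>
     FO F \<in> extensional (Ob (FSrc F)) \<and> FA F \<in> extensional (Ar (FSrc F)) \<and>
     is_functor (FSrc F) (FTgt F) (FO F) (FA F)"

definition small_transformation :: "'u ntr \<Rightarrow> bool" where
  "small_transformation \<alpha> \<longleftrightarrow> small_functor (NSrc \<alpha>) \<and> small_functor (NTgt \<alpha>) \<and>
     FSrc (NTgt \<alpha>) = FSrc (NSrc \<alpha>) \<and> FTgt (NTgt \<alpha>) = FTgt (NSrc \<alpha>) \<and>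
     NC \<alpha> \<in> extensional (Ob (FSrc (NSrc \<alpha>))) \<and>
     (\<forall>x \<in> Ob (FSrc (NSrc \<alpha>)). NC \<alpha> x \<in> hom (FTgt (NSrc \<alpha>)) (FO (NSrc \<alpha>) x) (FO (NTgt \<alpha>) x)) \<and>
     (\<forall>f \<in> Ar (FSrc (NSrc \<alpha>)).
        Cmp (FTgt (NSrc \<alpha>)) (NC \<alpha> (Cd (FSrc (NSrc \<alpha>)) f)) (FA (NSrc \<alpha>) f) =
        Cmp (FTgt (NSrc \<alpha>)) (FA (NTgt \<alpha>) f) (NC \<alpha> (Dm (FSrc (NSrc \<alpha>)) f)))"

definition Cat :: "('u small_cat, 'u fnc, 'u ntr) cat2" where
  "Cat = \<lparr>
     One = \<lparr>Ob = {C. ext_category C}, Ar = {F. small_functor F}, Dm = FSrc, Cd = FTgt,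
            Idt = (\<lambda>C. \<lparr>FSrc = C, FTgt = C, FO = (\<lambda>x \<in> Ob C. x), FA = (\<lambda>f \<in> Ar C. f)\<rparr>),
            Cmp = (\<lambda>G F. \<lparr>FSrc = FSrc F, FTgt = FTgt G,
                          FO = (\<lambda>x \<in> Ob (FSrc F). FO G (FO F x)),
                          FA = (\<lambda>f \<in> Ar (FSrc F). FA G (FA F f))\<rparr>)\<rparr>,
     Two = \<lparr>Ob = {F. small_functor F}, Ar = {\<alpha>. small_transformation \<alpha>}, Dm = NSrc, Cd = NTgt,
            Idt = (\<lambda>F. \<lparr>NSrc = F, NTgt = F, NC = (\<lambda>x \<in> Ob (FSrc F). Idt (FTgt F) (FO F x))\<rparr>),
            Cmp = (\<lambda>\<beta> \<alpha>. \<lparr>NSrc = NSrc \<alpha>, NTgt = NTgt \<beta>,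
                          NC = (\<lambda>x \<in> Ob (FSrc (NSrc \<alpha>)). Cmp (FTgt (NSrc \<alpha>)) (NC \<beta> x) (NC \<alpha> x))\<rparr>)\<rparr>,
     HCmp = (\<lambda>\<beta> \<alpha>.
       \<lparr>NSrc = \<lparr>FSrc = FSrc (NSrc \<alpha>), FTgt = FTgt (NSrc \<beta>),
                FO = (\<lambda>x \<in> Ob (FSrc (NSrc \<alpha>)). FO (NSrc \<beta>) (FO (NSrc \<alpha>) x)),
                FA = (\<lambda>f \<in> Ar (FSrc (NSrc \<alpha>)). FA (NSrc \<beta>) (FA (NSrc \<alpha>) f))\<rparr>,
        NTgt = \<lparr>FSrc = FSrc (NSrc \<alpha>), FTgt = FTgt (NSrc \<beta>),
                FO = (\<lambda>x \<in> Ob (FSrc (NSrc \<alpha>)). FO (NTgt \<beta>) (FO (NTgt \<alpha>) x)),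
                FA = (\<lambda>f \<in> Ar (FSrc (NSrc \<alpha>)). FA (NTgt \<beta>) (FA (NTgt \<alpha>) f))\<rparr>,
        NC = (\<lambda>x \<in> Ob (FSrc (NSrc \<alpha>)).
                Cmp (FTgt (NSrc \<beta>)) (NC \<beta> (FO (NTgt \<alpha>) x)) (FA (NSrc \<beta>) (NC \<alpha> x)))\<rparr>)\<rparr>"

text \<open>Products in \<open>Cat\<close>: since \<open>'u\<close> is infinite it contains a copy of \<open>'u \<times> 'u\<close>, along which the
  product category is transported.\<close>

definition pr :: "'u::infinite \<times> 'u \<Rightarrow> 'u" where
  "pr = (SOME p. inj p)"

definition p1 :: "'u::infinite \<Rightarrow> 'u" where "p1 z = fst (inv pr z)"

definition p2 :: "'u::infinite \<Rightarrow> 'u" where "p2 z = snd (inv pr z)"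

lemma inj_pr: "inj (pr :: 'u::infinite \<times> 'u \<Rightarrow> 'u)"
proof -
  have "(card_of (UNIV \<times> UNIV :: ('u \<times> 'u) set), card_of (UNIV :: 'u set)) \<in> ordIso"
    by (rule card_of_Times_same_infinite) (rule infinite_UNIV)
  then have "\<exists>p :: 'u \<times> 'u \<Rightarrow> 'u. inj p"
    by (metis UNIV_Times_UNIV bij_betw_def card_of_ordIso)
  then show ?thesis
    unfolding pr_def by (rule someI_ex)
qed

lemma p_pr [simp]: "p1 (pr (x, y)) = x" "p2 (pr (x, y)) = y"
  by (simp_all add: p1_def p2_def inj_pr)

definition prod_cat :: "'u::infinite small_cat \<Rightarrow> 'u small_cat \<Rightarrow> 'u small_cat" where
  "prod_cat C D = \<lparr>
     Ob = pr ` (Ob C \<times> Ob D),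
     Ar = pr ` (Ar C \<times> Ar D),
     Dm = (\<lambda>f \<in> pr ` (Ar C \<times> Ar D). pr (Dm C (p1 f), Dm D (p2 f))),
     Cd = (\<lambda>f \<in> pr ` (Ar C \<times> Ar D). pr (Cd C (p1 f), Cd D (p2 f))),
     Idt = (\<lambda>x \<in> pr ` (Ob C \<times> Ob D). pr (Idt C (p1 x), Idt D (p2 x))),
     Cmp = (\<lambda>g f. if f \<in> pr ` (Ar C \<times> Ar D) \<and> g \<in> pr ` (Ar C \<times> Ar D) \<and>
                     Dm C (p1 g) = Cd C (p1 f) \<and> Dm D (p2 g) = Cd D (p2 f)
                  then pr (Cmp C (p1 g) (p1 f), Cmp D (p2 g) (p2 f)) else undefined)\<rparr>"

definition prod_fnc :: "'u::infinite fnc \<Rightarrow> 'u fnc \<Rightarrow> 'u fnc" where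
  "prod_fnc F G = \<lparr>
     FSrc = prod_cat (FSrc F) (FSrc G),
     FTgt = prod_cat (FTgt F) (FTgt G),
     FO = (\<lambda>x \<in> pr ` (Ob (FSrc F) \<times> Ob (FSrc G)). pr (FO F (p1 x), FO G (p2 x))),
     FA = (\<lambda>f \<in> pr ` (Ar (FSrc F) \<times> Ar (FSrc G)). pr (FA F (p1 f), FA G (p2 f)))\<rparr>"

definition prod_ntr :: "'u::infinite ntr \<Rightarrow> 'u ntr \<Rightarrow> 'u ntr" where
  "prod_ntr \<alpha> \<beta> = \<lparr>
     NSrc = prod_fnc (NSrc \<alpha>) (NSrc \<beta>),
     NTgt = prod_fnc (NTgt \<alpha>) (NTgt \<beta>),
     NC = (\<lambda>x \<in> pr ` (Ob (FSrc (NSrc \<alpha>)) \<times> Ob (FSrc (NSrc \<beta>))). pr (NC \<alpha> (p1 x), NC \<beta> (p2 x)))\<rparr>"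

text \<open>For \<open>X : K\<^sup>o\<^sup>p \<rightarrow> Cat\<close> and \<open>Y : K \<rightarrow> Cat\<close> this is \<open>T : K\<^sup>o\<^sup>p \<times> K \<rightarrow> Cat\<close>, \<open>T(A,B) = XA \<times> YB\<close>.\<close>

definition prod_fun2 ::
  "('k, 'f, 'c, 'u::infinite) cat_functor \<Rightarrow> ('k, 'f, 'c, 'u) cat_functor \<Rightarrow>
   ('k \<times> 'k, 'f \<times> 'f, 'c \<times> 'c, 'u) cat_functor" where
  "prod_fun2 X Y = \<lparr>
     F0 = (\<lambda>(A, B). prod_cat (F0 X A) (F0 Y B)),
     F1 = (\<lambda>(f, g). prod_fnc (F1 X f) (F1 Y g)),
     F2 = (\<lambda>(\<gamma>, \<delta>). prod_ntr (F2 X \<gamma>) (F2 Y \<delta>))\<rparr>"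


section \<open>The 2-category of elements\<close>

text \<open>A morphism \<open>(f, \<phi>) : (x, A) \<rightarrow> (y, B)\<close> is stored with its domain and codomain, as
  \<open>((x, A), (f, \<phi>), (y, B))\<close>; a 2-cell is stored with its source and target.\<close>

type_synonym ('k, 'u) el0 = "'u \<times> 'k"
type_synonym ('k, 'f, 'u) el1 = "('k, 'u) el0 \<times> ('f \<times> 'u) \<times> ('k, 'u) el0"
type_synonym ('k, 'f, 'c, 'u) el2 = "('k, 'f, 'u) el1 \<times> 'c \<times> ('k, 'f, 'u) el1"

definition El_ob :: "('k, 'f, 'c) cat2 \<Rightarrow> ('k, 'f, 'c, 'u) cat_functor \<Rightarrow> ('k, 'u) el0 set" where
  "El_ob K Q = {(x, A). A \<in> Ob (One K) \<and> x \<in> Ob (F0 Q A)}"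

definition El_ar :: "('k, 'f, 'c) cat2 \<Rightarrow> ('k, 'f, 'c, 'u) cat_functor \<Rightarrow> ('k, 'f, 'u) el1 set" where
  "El_ar K Q = {((x, A), (f, \<phi>), (y, B)).
     (x, A) \<in> El_ob K Q \<and> (y, B) \<in> El_ob K Q \<and> f \<in> hom (One K) A B \<and>
     \<phi> \<in> hom (F0 Q B) (FO (F1 Q f) x) y}"

definition El_cell :: "('k, 'f, 'c) cat2 \<Rightarrow> ('k, 'f, 'c, 'u) cat_functor \<Rightarrow> ('k, 'f, 'c, 'u) el2 set"
  where
  "El_cell K Q = {(((x, A), (f, \<phi>), (y, B)), \<theta>, ((x', A'), (g, \<psi>), (y', B'))).
     ((x, A), (f, \<phi>), (y, B)) \<in> El_ar K Q \<and> ((x', A'), (g, \<psi>), (y', B')) \<in> El_ar K Q \<and>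
     (x', A') = (x, A) \<and> (y', B') = (y, B) \<and>
     \<theta> \<in> hom (Two K) f g \<and> Cmp (F0 Q B) \<psi> (NC (F2 Q \<theta>) x) = \<phi>}"

definition El_id :: "('k, 'f, 'c) cat2 \<Rightarrow> ('k, 'f, 'c, 'u) cat_functor \<Rightarrow> ('k, 'u) el0 \<Rightarrow> ('k, 'f, 'u) el1"
  where
  "El_id K Q = (\<lambda>(x, A). ((x, A), (Idt (One K) A, Idt (F0 Q A) x), (x, A)))"

definition El_comp ::
  "('k, 'f, 'c) cat2 \<Rightarrow> ('k, 'f, 'c, 'u) cat_functor \<Rightarrow>
   ('k, 'f, 'u) el1 \<Rightarrow> ('k, 'f, 'u) el1 \<Rightarrow> ('k, 'f, 'u) el1" where
  "El_comp K Q = (\<lambda>(b, (g, \<psi>), (z, C)) (a, (f, \<phi>), b').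
     (a, (Cmp (One K) g f, Cmp (F0 Q C) \<psi> (FA (F1 Q g) \<phi>)), (z, C)))"

definition El ::
  "('k, 'f, 'c) cat2 \<Rightarrow> ('k, 'f, 'c, 'u) cat_functor \<Rightarrow>
   (('k, 'u) el0, ('k, 'f, 'u) el1, ('k, 'f, 'c, 'u) el2) cat2" where
  "El K Q = \<lparr>
     One = \<lparr>Ob = El_ob K Q, Ar = El_ar K Q, Dm = (\<lambda>(a, p, b). a), Cd = (\<lambda>(a, p, b). b),
            Idt = El_id K Q, Cmp = El_comp K Q\<rparr>,
     Two = \<lparr>Ob = El_ar K Q, Ar = El_cell K Q, Dm = (\<lambda>(u, \<theta>, v). u), Cd = (\<lambda>(u, \<theta>, v). v),
            Idt = (\<lambda>(a, (f, \<phi>), b). ((a, (f, \<phi>), b), Idt (Two K) f, (a, (f, \<phi>), b))),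
            Cmp = (\<lambda>(v, \<theta>', w) (u, \<theta>, v'). (u, Cmp (Two K) \<theta>' \<theta>, w))\<rparr>,
     HCmp = (\<lambda>(u', \<theta>', v') (u, \<theta>, v). (El_comp K Q u' u, HCmp K \<theta>' \<theta>, El_comp K Q v' v))\<rparr>"

definition El_proj ::
  "(('k, 'u) el0, ('k, 'f, 'u) el1, ('k, 'f, 'c, 'u) el2, 'k, 'f, 'c) fun2" where
  "El_proj = \<lparr>F0 = (\<lambda>(x, A). A), F1 = (\<lambda>(a, (f, \<phi>), b). f), F2 = (\<lambda>(u, \<theta>, v). \<theta>)\<rparr>"

definition El_cart :: "('k, 'f, 'c) cat2 \<Rightarrow> ('k, 'f, 'c, 'u) cat_functor \<Rightarrow> ('k, 'f, 'u) el1 set" where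
  "El_cart K Q = {((x, A), (f, \<phi>), (y, B)).
     ((x, A), (f, \<phi>), (y, B)) \<in> El_ar K Q \<and> invertible (F0 Q B) \<phi>}"


section \<open>Universal properties\<close>

text \<open>The data of a 2-functor from a 2-category to (large) categories: the values, the action of
  1-cells on objects, and the (horizontal) action of 2-cells on arrows.  The arrow part of the
  functor given by a 1-cell \<open>u\<close> is the action of the identity 2-cell of \<open>u\<close>.  A 2-functor
  \<open>E \<mapsto> Val U E\<close>, assigning to \<open>E\<close> a category of cones with vertex \<open>E\<close>, encodes a universal property.\<close>

record ('k, 'f, 'c, 'x, 'y) cone_functor =
  Val :: "'k \<Rightarrow> ('x, 'y) cat"
  Act1 :: "'f \<Rightarrow> 'x \<Rightarrow> 'x"
  Act2 :: "'c \<Rightarrow> 'y \<Rightarrow> 'y"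

definition universal ::
  "('k, 'f, 'c) cat2 \<Rightarrow> ('k, 'f, 'c, 'x, 'y) cone_functor \<Rightarrow> 'k \<Rightarrow> 'x \<Rightarrow> bool" where
  "universal B U L \<xi> \<longleftrightarrow> L \<in> Ob (One B) \<and> \<xi> \<in> Ob (Val U L) \<and>
     (\<forall>E \<in> Ob (One B). is_iso_functor (Hom B L E) (Val U E)
        (\<lambda>u. Act1 U u \<xi>) (\<lambda>\<alpha>. Act2 U \<alpha> (Idt (Val U L) \<xi>)))"

definition natural_isomorphism ::
  "('k, 'f, 'c) cat2 \<Rightarrow> ('k, 'f, 'c, 'x, 'y) cone_functor \<Rightarrow> ('k, 'f, 'c, 'z, 'w) cone_functor \<Rightarrow>
   ('k \<Rightarrow> 'x \<Rightarrow> 'z) \<Rightarrow> ('k \<Rightarrow> 'y \<Rightarrow> 'w) \<Rightarrow> bool" where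
  "natural_isomorphism B U V \<Phi>o \<Phi>a \<longleftrightarrow>
     (\<forall>E \<in> Ob (One B). is_iso_functor (Val U E) (Val V E) (\<Phi>o E) (\<Phi>a E)) \<and>
     (\<forall>u \<in> Ar (One B). \<forall>\<xi> \<in> Ob (Val U (Dm (One B) u)).
        \<Phi>o (Cd (One B) u) (Act1 U u \<xi>) = Act1 V u (\<Phi>o (Dm (One B) u) \<xi>)) \<and>
     (\<forall>\<alpha> \<in> Ar (Two B). \<forall>\<rho> \<in> Ar (Val U (dm0 B \<alpha>)).
        \<Phi>a (cd0 B \<alpha>) (Act2 U \<alpha> \<rho>) = Act2 V \<alpha> (\<Phi>a (dm0 B \<alpha>) \<rho>))"

text \<open>Two universal properties are equivalent if their cones correspond, 2-naturally in the vertex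
  and isomorphically as categories, and a cone with vertex \<open>L\<close> is universal for one precisely if
  the corresponding cone with the same vertex is universal for the other.\<close>

definition equivalent_universal_properties ::
  "('k, 'f, 'c) cat2 \<Rightarrow> ('k, 'f, 'c, 'x, 'y) cone_functor \<Rightarrow> ('k, 'f, 'c, 'z, 'w) cone_functor \<Rightarrow> bool"
  where
  "equivalent_universal_properties B U V \<longleftrightarrow>
     (\<exists>\<Phi>o \<Phi>a. natural_isomorphism B U V \<Phi>o \<Phi>a \<and>
        (\<forall>L \<in> Ob (One B). \<forall>\<xi> \<in> Ob (Val U L). universal B U L \<xi> \<longleftrightarrow> universal B V L (\<Phi>o L \<xi>)))"


section \<open>Conical sigma-colimits and pseudocoends\<close>

text \<open>A (di)cone has a 1-cell \<open>leg c i\<close> for each object and a 2-cell \<open>cel c u\<close> for each 1-cell of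
  the indexing 2-category; a morphism of (di)cones is a family of 2-cells between the legs.\<close>

record ('i, 'v, 'f, 'c) cone =
  leg :: "'i \<Rightarrow> 'f"
  cel :: "'v \<Rightarrow> 'c"

record ('i, 'v, 'f, 'c) modif =
  MSrc :: "('i, 'v, 'f, 'c) cone"
  MTgt :: "('i, 'v, 'f, 'c) cone"
  MC :: "'i \<Rightarrow> 'c"

text \<open>The category of cones \<open>S E\<close> with vertex \<open>E\<close>, with families \<open>\<rho> : c \<Rightarrow> d\<close> subject to \<open>R c d \<rho>\<close>
  as arrows, and postcomposition with cells of \<open>B\<close> as action.\<close>

definition cones ::
  "('k, 'f, 'c) cat2 \<Rightarrow> ('i, 'v) cat \<Rightarrow> ('k \<Rightarrow> ('i, 'v, 'f, 'c) cone set) \<Rightarrow>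
   (('i, 'v, 'f, 'c) cone \<Rightarrow> ('i, 'v, 'f, 'c) cone \<Rightarrow> ('i \<Rightarrow> 'c) \<Rightarrow> bool) \<Rightarrow>
   ('k, 'f, 'c, ('i, 'v, 'f, 'c) cone, ('i, 'v, 'f, 'c) modif) cone_functor" where
  "cones B J S R =
     (let act = (\<lambda>u c. \<lparr>leg = (\<lambda>i \<in> Ob J. Cmp (One B) u (leg c i)),
                       cel = (\<lambda>v \<in> Ar J. lwhisk B u (cel c v))\<rparr>)
      in \<lparr>Val = (\<lambda>E.
            \<lparr>Ob = S E,
             Ar = {m. MSrc m \<in> S E \<and> MTgt m \<in> S E \<and> MC m \<in> extensional (Ob J) \<and>
                      (\<forall>i \<in> Ob J. MC m i \<in> hom (Two B) (leg (MSrc m) i) (leg (MTgt m) i)) \<and>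
                      R (MSrc m) (MTgt m) (MC m)},
             Dm = MSrc, Cd = MTgt,
             Idt = (\<lambda>c. \<lparr>MSrc = c, MTgt = c, MC = (\<lambda>i \<in> Ob J. Idt (Two B) (leg c i))\<rparr>),
             Cmp = (\<lambda>n m. \<lparr>MSrc = MSrc m, MTgt = MTgt n,
                           MC = (\<lambda>i \<in> Ob J. Cmp (Two B) (MC n i) (MC m i))\<rparr>)\<rparr>),
          Act1 = act,
          Act2 = (\<lambda>\<alpha> m. \<lparr>MSrc = act (Dm (Two B) \<alpha>) (MSrc m), MTgt = act (Cd (Two B) \<alpha>) (MTgt m),
                         MC = (\<lambda>i \<in> Ob J. HCmp B \<alpha> (MC m i))\<rparr>)\<rparr>)"

definition sigma_cone ::
  "('k, 'f, 'c) cat2 \<Rightarrow> ('i, 'v, 'w) cat2 \<Rightarrow> 'v set \<Rightarrow> ('i, 'v, 'w, 'k, 'f, 'c) fun2 \<Rightarrow>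
   'k \<Rightarrow> ('i, 'v, 'f, 'c) cone \<Rightarrow> bool" where
  "sigma_cone B I \<Sigma> F E \<theta> \<longleftrightarrow>
     leg \<theta> \<in> extensional (Ob (One I)) \<and> cel \<theta> \<in> extensional (Ar (One I)) \<and>
     (\<forall>i \<in> Ob (One I). leg \<theta> i \<in> hom (One B) (F0 F i) E) \<and>
     (\<forall>u \<in> Ar (One I). cel \<theta> u \<in>
        hom (Two B) (Cmp (One B) (leg \<theta> (Cd (One I) u)) (F1 F u)) (leg \<theta> (Dm (One I) u))) \<and>
     (\<forall>i \<in> Ob (One I). cel \<theta> (Idt (One I) i) = Idt (Two B) (leg \<theta> i)) \<and>
     (\<forall>u \<in> Ar (One I). \<forall>v \<in> Ar (One I). Dm (One I) v = Cd (One I) u \<longrightarrow>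
        cel \<theta> (Cmp (One I) v u) = Cmp (Two B) (cel \<theta> u) (rwhisk B (cel \<theta> v) (F1 F u))) \<and>
     (\<forall>\<gamma> \<in> Ar (Two I).
        Cmp (Two B) (cel \<theta> (Cd (Two I) \<gamma>)) (lwhisk B (leg \<theta> (cd0 I \<gamma>)) (F2 F \<gamma>)) =
        cel \<theta> (Dm (Two I) \<gamma>)) \<and>
     (\<forall>u \<in> \<Sigma>. invertible (Two B) (cel \<theta> u))"

definition sigma_cones ::
  "('k, 'f, 'c) cat2 \<Rightarrow> ('i, 'v, 'w) cat2 \<Rightarrow> 'v set \<Rightarrow> ('i, 'v, 'w, 'k, 'f, 'c) fun2 \<Rightarrow>
   ('k, 'f, 'c, ('i, 'v, 'f, 'c) cone, ('i, 'v, 'f, 'c) modif) cone_functor" where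
  "sigma_cones B I \<Sigma> F = cones B (One I) (\<lambda>E. {\<theta>. sigma_cone B I \<Sigma> F E \<theta>})
     (\<lambda>\<theta> \<theta>' \<rho>. \<forall>u \<in> Ar (One I).
        Cmp (Two B) (cel \<theta>' u) (rwhisk B (\<rho> (Cd (One I) u)) (F1 F u)) =
        Cmp (Two B) (\<rho> (Dm (One I) u)) (cel \<theta> u))"

text \<open>\<open>slot1 K T f A\<close> is \<open>T(f, A)\<close> and \<open>slot2 K T B f\<close> is \<open>T(B, f)\<close>; similarly for 2-cells.\<close>

definition slot1 :: "('a, 'v, 'w) cat2 \<Rightarrow> ('a \<times> 'a, 'v \<times> 'v, 'w \<times> 'w, 'k, 'f, 'c) fun2 \<Rightarrow> 'v \<Rightarrow> 'a \<Rightarrow> 'f"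
  where "slot1 K T f A = F1 T (f, Idt (One K) A)"

definition slot2 :: "('a, 'v, 'w) cat2 \<Rightarrow> ('a \<times> 'a, 'v \<times> 'v, 'w \<times> 'w, 'k, 'f, 'c) fun2 \<Rightarrow> 'a \<Rightarrow> 'v \<Rightarrow> 'f"
  where "slot2 K T B f = F1 T (Idt (One K) B, f)"

definition slot1_cell :: "('a, 'v, 'w) cat2 \<Rightarrow> ('a \<times> 'a, 'v \<times> 'v, 'w \<times> 'w, 'k, 'f, 'c) fun2 \<Rightarrow> 'w \<Rightarrow> 'a \<Rightarrow> 'c"
  where "slot1_cell K T \<gamma> A = F2 T (\<gamma>, Idt (Two K) (Idt (One K) A))"

definition slot2_cell :: "('a, 'v, 'w) cat2 \<Rightarrow> ('a \<times> 'a, 'v \<times> 'v, 'w \<times> 'w, 'k, 'f, 'c) fun2 \<Rightarrow> 'a \<Rightarrow> 'w \<Rightarrow> 'c"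
  where "slot2_cell K T B \<gamma> = F2 T (Idt (Two K) (Idt (One K) B), \<gamma>)"

definition pseudo_dicone ::
  "('k, 'f, 'c) cat2 \<Rightarrow> ('a, 'v, 'w) cat2 \<Rightarrow> ('a \<times> 'a, 'v \<times> 'v, 'w \<times> 'w, 'k, 'f, 'c) fun2 \<Rightarrow>
   'k \<Rightarrow> ('a, 'v, 'f, 'c) cone \<Rightarrow> bool" where
  "pseudo_dicone B K T E l \<longleftrightarrow>
     leg l \<in> extensional (Ob (One K)) \<and> cel l \<in> extensional (Ar (One K)) \<and>
     (\<forall>A \<in> Ob (One K). leg l A \<in> hom (One B) (F0 T (A, A)) E) \<and>
     (\<forall>f \<in> Ar (One K).
        cel l f \<in> hom (Two B) (Cmp (One B) (leg l (Cd (One K) f)) (slot2 K T (Cd (One K) f) f))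
                             (Cmp (One B) (leg l (Dm (One K) f)) (slot1 K T f (Dm (One K) f))) \<and>
        invertible (Two B) (cel l f)) \<and>
     (\<forall>A \<in> Ob (One K). cel l (Idt (One K) A) = Idt (Two B) (leg l A)) \<and>
     (\<forall>f \<in> Ar (One K). \<forall>g \<in> Ar (One K). Dm (One K) g = Cd (One K) f \<longrightarrow>
        cel l (Cmp (One K) g f) =
        Cmp (Two B) (rwhisk B (cel l f) (slot1 K T g (Dm (One K) f)))
                    (rwhisk B (cel l g) (slot2 K T (Cd (One K) g) f))) \<and>
     (\<forall>\<gamma> \<in> Ar (Two K).
        Cmp (Two B) (lwhisk B (leg l (dm0 K \<gamma>)) (slot1_cell K T \<gamma> (dm0 K \<gamma>))) (cel l (Dm (Two K) \<gamma>)) =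
        Cmp (Two B) (cel l (Cd (Two K) \<gamma>)) (lwhisk B (leg l (cd0 K \<gamma>)) (slot2_cell K T (cd0 K \<gamma>) \<gamma>)))"

definition pseudo_dicones ::
  "('k, 'f, 'c) cat2 \<Rightarrow> ('a, 'v, 'w) cat2 \<Rightarrow> ('a \<times> 'a, 'v \<times> 'v, 'w \<times> 'w, 'k, 'f, 'c) fun2 \<Rightarrow>
   ('k, 'f, 'c, ('a, 'v, 'f, 'c) cone, ('a, 'v, 'f, 'c) modif) cone_functor" where
  "pseudo_dicones B K T = cones B (One K) (\<lambda>E. {l. pseudo_dicone B K T E l})
     (\<lambda>l l' \<rho>. \<forall>f \<in> Ar (One K).
        Cmp (Two B) (cel l' f) (rwhisk B (\<rho> (Cd (One K) f)) (slot2 K T (Cd (One K) f) f)) =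
        Cmp (Two B) (rwhisk B (\<rho> (Dm (One K) f)) (slot1 K T f (Dm (One K) f))) (cel l f))"

text \<open>Thus \<open>universal B (sigma_cones B I \<Sigma> F) L \<theta>\<close> says that \<open>L\<close> with the cone \<open>\<theta>\<close> is the conical
  sigma-colimit of \<open>F : I \<rightarrow> B\<close> with respect to \<open>\<Sigma>\<close>, and \<open>universal B (pseudo_dicones B K T) L l\<close>
  that \<open>L\<close> with the dicone \<open>l\<close> is the pseudocoend of \<open>T : K\<^sup>o\<^sup>p \<times> K \<rightarrow> B\<close>.\<close>

end

theory Submission
  imports Defs
begin

text \<open>
  A pseudo-dicone \<open>\<lambda>\<close> for \<open>PA \<times> WA\<close> yields a sigma-cone with legs \<open>\<theta>\<^bsub>(x,A)\<^esub> = \<lambda>\<^sub>A(x, -)\<close> and 2-cells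
  \<open>\<theta>\<^bsub>(f,\<phi>)\<^esub> = \<lambda>\<^sub>B(\<phi>, -) \<circ> \<lambda>\<^sub>f(x, -)\<close>.  Conversely, since \<open>(f, \<phi>) = (id, \<phi>) (f, id)\<close>, a sigma-cone is
  determined by its cells at \<open>(id, a)\<close>, which supply functoriality in the first variable,
  \<open>\<lambda>\<^sub>A(a, k) = \<theta>\<^bsub>(id,a)\<^esub> \<circ> \<theta>\<^bsub>(x,A)\<^esub>(k)\<close>, and at the cartesian arrows \<open>(f, id)\<close>, which supply the invertible
  \<open>\<lambda>\<^sub>f\<close>.  The two pseudocoends are exchanged by swapping the factors and inverting the \<open>\<lambda>\<^sub>f\<close>, and the last
  equality is the first one for the opposite 2-category.
\<close>

section \<open>Categories\<close>

text \<open>The correspondence is arranged so that cells are inverted in one place only. For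
  \<open>f : A -> B\<close> in \<open>K\<close>, the cell of a dicone for \<open>QA x RA\<close>
  over the opposite of \<open>K\<close> leads from \<open>(x, Rf w)\<close> at \<open>A\<close> to
  \<open>(Qf x, w)\<close> at \<open>B\<close>. This is also the direction of a sigma-cone cell at
  an arrow of elements over \<open>f\<close>, so dicones and sigma-cones correspond without
  inverses, and invertibility is merely matched: the cell at \<open>(f, \<phi>)\<close> is
  \<open>la B \<phi>\<close> after \<open>t f\<close>, both invertible when \<open>\<phi>\<close>
  is. Exchanging the factors reverses the cells, and there their invertibility is essential. Since
  \<open>Cat\<close> consists of records of total functions, equalities of 2-cells are turned into
  equalities of components on object sets, and coded pairs \<open>pr (x, w)\<close> into two
  arguments. What remains is algebra in one category \<open>E\<close>. Universality is transported
  along isomorphisms of categories of cones, natural in the vertex. On morphisms these merely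
  reindex components, so the work lies in a bijection on cones, compatible with modifications and
  postcomposition.\<close>

lemma hom_iff: "f \<in> hom C x y \<longleftrightarrow> f \<in> Ar C \<and> Dm C f = x \<and> Cd C f = y"
  by (simp add: hom_def)

lemma hom_self: "f \<in> Ar C \<Longrightarrow> f \<in> hom C (Dm C f) (Cd C f)"
  by (simp add: hom_def)

context
  fixes C :: "('o, 'a) cat"
  assumes C: "category C"
begin

lemma hom_ob: "f \<in> hom C x y \<Longrightarrow> x \<in> Ob C" "f \<in> hom C x y \<Longrightarrow> y \<in> Ob C"
  using C by (auto simp: category_def hom_def)

lemma id_hom: "x \<in> Ob C \<Longrightarrow> Idt C x \<in> hom C x x"
  using C by (auto simp: category_def)

lemma cmp_hom: "f \<in> hom C x y \<Longrightarrow> g \<in> hom C y z \<Longrightarrow> Cmp C g f \<in> hom C x z"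
  using C unfolding category_def by (simp add: hom_iff)

lemma id_cmp: "f \<in> hom C x y \<Longrightarrow> Cmp C (Idt C y) f = f"
  using C unfolding category_def by (auto simp: hom_iff)

lemma cmp_id: "f \<in> hom C x y \<Longrightarrow> Cmp C f (Idt C x) = f"
  using C unfolding category_def by (auto simp: hom_iff)

lemma cmp_assoc:
  "f \<in> hom C x y \<Longrightarrow> g \<in> hom C y z \<Longrightarrow> h \<in> hom C z w \<Longrightarrow>
    Cmp C (Cmp C h g) f = Cmp C h (Cmp C g f)"
  using C unfolding category_def by (auto simp: hom_iff)

end

text \<open>The two squares share the edge \<open>g\<close>. This is the pattern behind composites
  of modifications and behind naturality of cells that are themselves composites.\<close>

lemma paste_squares:
  assumes E: "category E"
    and "f \<in> hom E x x'" "p \<in> hom E x y" "p' \<in> hom E x' y'" "g \<in> hom E y y'"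
    and "q \<in> hom E y z" "q' \<in> hom E y' z'" "h \<in> hom E z z'"
    and "Cmp E p' f = Cmp E g p" "Cmp E q' g = Cmp E h q"
  shows "Cmp E (Cmp E q' p') f = Cmp E h (Cmp E q p)"
proof -
  have "Cmp E (Cmp E q' p') f = Cmp E q' (Cmp E g p)"
    using cmp_assoc[OF E assms(2,4,7)] assms(9) by simp
  also have "\<dots> = Cmp E (Cmp E h q) p"
    using cmp_assoc[OF E assms(3,5,7)] assms(10) by simp
  finally show ?thesis
    using cmp_assoc[OF E assms(3,6,8)] by simp
qed

lemma ext_category_category: "ext_category C \<Longrightarrow> category C"
  by (simp add: ext_category_def)

lemma category_op1: "category C \<Longrightarrow> category (op1 C)"
  unfolding category_def op1_def hom_def by simp

lemma functor_ob: "is_functor C D fo fa \<Longrightarrow> x \<in> Ob C \<Longrightarrow> fo x \<in> Ob D"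
  and functor_id: "is_functor C D fo fa \<Longrightarrow> x \<in> Ob C \<Longrightarrow> fa (Idt C x) = Idt D (fo x)"
  and functor_hom: "is_functor C D fo fa \<Longrightarrow> f \<in> hom C x y \<Longrightarrow> fa f \<in> hom D (fo x) (fo y)"
  and functor_cmp: "is_functor C D fo fa \<Longrightarrow> f \<in> hom C x y \<Longrightarrow> g \<in> hom C y z \<Longrightarrow>
    fa (Cmp C g f) = Cmp D (fa g) (fa f)"
  by (auto simp: is_functor_def hom_def)

lemma is_functorI:
  assumes "category C"
    and "\<And>x. x \<in> Ob C \<Longrightarrow> fo x \<in> Ob D"
    and "\<And>x. x \<in> Ob C \<Longrightarrow> fa (Idt C x) = Idt D (fo x)"
    and "\<And>f x y. f \<in> hom C x y \<Longrightarrow> fa f \<in> hom D (fo x) (fo y)"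
    and "\<And>f g x y z. f \<in> hom C x y \<Longrightarrow> g \<in> hom C y z \<Longrightarrow> fa (Cmp C g f) = Cmp D (fa g) (fa f)"
  shows "is_functor C D fo fa"
  unfolding is_functor_def
proof (intro conjI ballI impI)
  fix f g
  assume "f \<in> Ar C" "g \<in> Ar C" "Dm C g = Cd C f"
  then show "fa (Cmp C g f) = Cmp D (fa g) (fa f)"
    by (intro assms(5)) (auto simp: hom_iff)
qed (blast intro: assms hom_self)+

text \<open>Functors in \<open>Cat\<close> are stored with \<open>restrict\<close>, so a composite
  or constructed functor agrees with the intended maps only on objects and arrows; functoriality has
  to survive this change.\<close>

lemma is_functor_cong:
  assumes "category C" "is_functor C D fo fa"
    and "\<And>x. x \<in> Ob C \<Longrightarrow> fo x = fo' x" "\<And>f. f \<in> Ar C \<Longrightarrow> fa f = fa' f"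
  shows "is_functor C D fo' fa'"
proof (rule is_functorI[OF assms(1)])
  note c = assms(1)
  fix f x y
  assume f: "f \<in> hom C x y"
  have "fa f \<in> hom D (fo x) (fo y)" using assms(2) f by (rule functor_hom)
  moreover have "x \<in> Ob C" "y \<in> Ob C" using hom_ob[OF c] f by auto
  ultimately show "fa' f \<in> hom D (fo' x) (fo' y)"
    using f assms(3,4) by (auto simp: hom_iff)
next
  note c = assms(1)
  fix f g x y z
  assume fg: "f \<in> hom C x y" "g \<in> hom C y z"
  then show "fa' (Cmp C g f) = Cmp D (fa' g) (fa' f)"
    using functor_cmp[OF assms(2) fg] cmp_hom[OF c fg] assms(4) by (auto simp: hom_iff)
next
  note c = assms(1)
  fix x assume x: "x \<in> Ob C"
  then show "fa' (Idt C x) = Idt D (fo' x)"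
    using functor_id[OF assms(2) x] id_hom[OF c x] assms(3,4) by (auto simp: hom_iff)
  show "fo' x \<in> Ob D"
    using functor_ob[OF assms(2) x] assms(3) x by auto
qed

lemma is_functor_comp:
  "is_functor C D fo fa \<Longrightarrow> is_functor D E go ga \<Longrightarrow> is_functor C E (\<lambda>x. go (fo x)) (\<lambda>f. ga (fa f))"
  by (auto simp: is_functor_def hom_def)

lemma is_iso_functor_comp:
  assumes "is_iso_functor C D fo fa" "is_iso_functor D E go ga"
  shows "is_iso_functor C E (\<lambda>x. go (fo x)) (\<lambda>f. ga (fa f))"
proof -
  obtain fo' fa' where f: "is_functor D C fo' fa'" "\<forall>x \<in> Ob C. fo' (fo x) = x"
    "\<forall>f \<in> Ar C. fa' (fa f) = f" "\<forall>y \<in> Ob D. fo (fo' y) = y" "\<forall>g \<in> Ar D. fa (fa' g) = g"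
    using assms(1) by (auto simp: is_iso_functor_def)
  obtain go' ga' where g: "is_functor E D go' ga'" "\<forall>x \<in> Ob D. go' (go x) = x"
    "\<forall>f \<in> Ar D. ga' (ga f) = f" "\<forall>y \<in> Ob E. go (go' y) = y" "\<forall>g \<in> Ar E. ga (ga' g) = g"
    using assms(2) by (auto simp: is_iso_functor_def)
  have F: "is_functor C D fo fa" "is_functor D E go ga"
    using assms by (auto simp: is_iso_functor_def)
  have "is_functor C E (\<lambda>x. go (fo x)) (\<lambda>f. ga (fa f))"
    using F by (rule is_functor_comp)
  moreover have "is_functor E C (\<lambda>x. fo' (go' x)) (\<lambda>f. fa' (ga' f))"
    using g(1) f(1) by (rule is_functor_comp)
  moreover have "fo x \<in> Ob D" if "x \<in> Ob C" for x
    using F(1) that by (rule functor_ob)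
  moreover have "fa f \<in> Ar D" if "f \<in> Ar C" for f
    using F(1) that by (auto simp: is_functor_def hom_def)
  moreover have "go' x \<in> Ob D" if "x \<in> Ob E" for x
    using g(1) that by (rule functor_ob)
  moreover have "ga' f \<in> Ar D" if "f \<in> Ar E" for f
    using g(1) that by (auto simp: is_functor_def hom_def)
  ultimately show ?thesis
    unfolding is_iso_functor_def using f g
    by (intro conjI exI[of _ "\<lambda>x. fo' (go' x)"] exI[of _ "\<lambda>f. fa' (ga' f)"]) auto
qed

text \<open>Only closure of \<open>C\<close> under its structure maps is needed to invert a bijective functor.\<close>

definition closed_cat :: "('o, 'a) cat \<Rightarrow> bool" where
  "closed_cat C \<longleftrightarrow>
     (\<forall>f \<in> Ar C. Dm C f \<in> Ob C \<and> Cd C f \<in> Ob C) \<and>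
     (\<forall>x \<in> Ob C. Idt C x \<in> hom C x x) \<and>
     (\<forall>f \<in> Ar C. \<forall>g \<in> Ar C. Dm C g = Cd C f \<longrightarrow> Cmp C g f \<in> hom C (Dm C f) (Cd C g))"

lemma is_iso_functorI:
  assumes C: "closed_cat C" and F: "is_functor C D fo fa"
    and bo: "bij_betw fo (Ob C) (Ob D)" and ba: "bij_betw fa (Ar C) (Ar D)"
  shows "is_iso_functor C D fo fa"
proof -
  define go where "go = inv_into (Ob C) fo"
  define ga where "ga = inv_into (Ar C) fa"
  have go: "go (fo x) = x" if "x \<in> Ob C" for x
    using bo that by (simp add: go_def bij_betw_def)
  have ga: "ga (fa x) = x" if "x \<in> Ar C" for x
    using ba that by (simp add: ga_def bij_betw_def)
  have ob: "\<exists>x. x \<in> Ob C \<and> y = fo x" if "y \<in> Ob D" for y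
    using bo that by (auto simp: bij_betw_def)
  have ar: "\<exists>x. x \<in> Ar C \<and> y = fa x" if "y \<in> Ar D" for y
    using ba that by (auto simp: bij_betw_def)
  have "is_functor D C go ga"
    unfolding is_functor_def
  proof (intro conjI ballI impI)
    fix y assume "y \<in> Ob D"
    then obtain x where x: "x \<in> Ob C" "y = fo x" using ob by blast
    then show "go y \<in> Ob C" by (simp add: go)
    have "Idt C x \<in> Ar C" using C x by (auto simp: closed_cat_def hom_def)
    then show "ga (Idt D y) = Idt C (go y)"
      using ga functor_id[OF F x(1)] x by (metis go)
  next
    fix g assume "g \<in> Ar D"
    then obtain f where f: "f \<in> Ar C" "g = fa f" using ar by blast
    have "Dm C f \<in> Ob C" "Cd C f \<in> Ob C" using C f by (auto simp: closed_cat_def)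
    then show "ga g \<in> hom C (go (Dm D g)) (go (Cd D g))"
      using F f go ga by (auto simp: is_functor_def hom_def)
  next
    fix g' g assume "g \<in> Ar D" "g' \<in> Ar D" and comp: "Dm D g' = Cd D g"
    then obtain f f' where f: "f \<in> Ar C" "g = fa f" "f' \<in> Ar C" "g' = fa f'" using ar by blast
    have "fo (Dm C f') = fo (Cd C f)" using F f comp by (auto simp: is_functor_def hom_def)
    moreover have "Dm C f' \<in> Ob C" "Cd C f \<in> Ob C" using C f by (auto simp: closed_cat_def)
    \<comment> \<open>Injectivity of \<open>fo\<close> on objects turns composability in
      \<open>D\<close> into composability in \<open>C\<close>; otherwise \<open>Cmp C f' f\<close>
      would be a junk value.\<close>
    ultimately have eq: "Dm C f' = Cd C f" using go by metis
    then have "Cmp C f' f \<in> Ar C" using C f by (auto simp: closed_cat_def hom_def)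
    moreover have "fa (Cmp C f' f) = Cmp D g' g" using F f eq by (auto simp: is_functor_def)
    ultimately show "ga (Cmp D g' g) = Cmp C (ga g') (ga g)"
      using f ga by metis
  qed
  moreover have "fo (go y) = y" if "y \<in> Ob D" for y
    using ob[OF that] go by auto
  moreover have "fa (ga y) = y" if "y \<in> Ar D" for y
    using ar[OF that] ga by auto
  ultimately show ?thesis
    unfolding is_iso_functor_def using F go ga by blast
qed

section \<open>Naturally isomorphic universal properties\<close>

text \<open>This records the well-typedness of a cone functor: its values are closed under their
  structure maps and both actions land in the value at the codomain. The laws of a category enter
  through the isomorphisms instead.\<close>

definition closed_cone_functor :: "('k, 'f, 'c) cat2 \<Rightarrow> ('k, 'f, 'c, 'x, 'y) cone_functor \<Rightarrow> bool" where
  "closed_cone_functor B U \<longleftrightarrow>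
     (\<forall>E \<in> Ob (One B). closed_cat (Val U E)) \<and>
     (\<forall>u \<in> Ar (One B). \<forall>\<xi> \<in> Ob (Val U (Dm (One B) u)). Act1 U u \<xi> \<in> Ob (Val U (Cd (One B) u))) \<and>
     (\<forall>\<alpha> \<in> Ar (Two B). \<forall>\<rho> \<in> Ar (Val U (dm0 B \<alpha>)). Act2 U \<alpha> \<rho> \<in> Ar (Val U (cd0 B \<alpha>)))"

lemma closed_cone_functorD:
  "closed_cone_functor B U \<Longrightarrow> E \<in> Ob (One B) \<Longrightarrow> closed_cat (Val U E)"
  by (simp add: closed_cone_functor_def)

text \<open>The inverse components are chosen simultaneously for all vertices; their naturality
  follows by conjugating the actions. The last conclusion supplies for \<open>V\<close> the one
  closure property needed later: its identities are images of identities of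
  \<open>U\<close>.\<close>

lemma natural_isomorphism_inverse:
  assumes U: "closed_cone_functor B U" and nat: "natural_isomorphism B U V \<Phi>o \<Phi>a"
    and B: "category (One B)" "category (Two B)" "Ob (Two B) = Ar (One B)"
  obtains \<Psi>o \<Psi>a where "natural_isomorphism B V U \<Psi>o \<Psi>a"
    and "\<And>E \<xi>. E \<in> Ob (One B) \<Longrightarrow> \<xi> \<in> Ob (Val U E) \<Longrightarrow> \<Psi>o E (\<Phi>o E \<xi>) = \<xi>"
    and "\<And>E \<xi>. E \<in> Ob (One B) \<Longrightarrow> \<xi> \<in> Ob (Val V E) \<Longrightarrow> \<Phi>o E (\<Psi>o E \<xi>) = \<xi>"
    and "\<And>E \<xi>. E \<in> Ob (One B) \<Longrightarrow> \<xi> \<in> Ob (Val V E) \<Longrightarrow> \<Psi>o E \<xi> \<in> Ob (Val U E)"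
    and "\<And>E \<xi>. E \<in> Ob (One B) \<Longrightarrow> \<xi> \<in> Ob (Val V E) \<Longrightarrow> Idt (Val V E) \<xi> \<in> Ar (Val V E)"
proof -
  have "\<forall>E. \<exists>go ga. E \<in> Ob (One B) \<longrightarrow> is_functor (Val V E) (Val U E) go ga \<and>
        (\<forall>x \<in> Ob (Val U E). go (\<Phi>o E x) = x) \<and> (\<forall>f \<in> Ar (Val U E). ga (\<Phi>a E f) = f) \<and>
        (\<forall>y \<in> Ob (Val V E). \<Phi>o E (go y) = y) \<and> (\<forall>g \<in> Ar (Val V E). \<Phi>a E (ga g) = g)"
    using nat unfolding natural_isomorphism_def is_iso_functor_def by blast
  \<comment> \<open>Choice is applied twice because the object part and the arrow part of the
    inverse are bound by separate quantifiers.\<close>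
  from this[THEN choice] obtain \<Psi>o where "\<forall>E. \<exists>ga. E \<in> Ob (One B) \<longrightarrow> is_functor (Val V E) (Val U E) (\<Psi>o E) ga \<and>
        (\<forall>x \<in> Ob (Val U E). \<Psi>o E (\<Phi>o E x) = x) \<and> (\<forall>f \<in> Ar (Val U E). ga (\<Phi>a E f) = f) \<and>
        (\<forall>y \<in> Ob (Val V E). \<Phi>o E (\<Psi>o E y) = y) \<and> (\<forall>g \<in> Ar (Val V E). \<Phi>a E (ga g) = g)" ..
  from this[THEN choice] obtain \<Psi>a where \<Psi>: "\<forall>E. E \<in> Ob (One B) \<longrightarrow> is_functor (Val V E) (Val U E) (\<Psi>o E) (\<Psi>a E) \<and>
        (\<forall>x \<in> Ob (Val U E). \<Psi>o E (\<Phi>o E x) = x) \<and> (\<forall>f \<in> Ar (Val U E). \<Psi>a E (\<Phi>a E f) = f) \<and>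
        (\<forall>y \<in> Ob (Val V E). \<Phi>o E (\<Psi>o E y) = y) \<and> (\<forall>g \<in> Ar (Val V E). \<Phi>a E (\<Psi>a E g) = g)" ..
  have F: "is_functor (Val V E) (Val U E) (\<Psi>o E) (\<Psi>a E)" if "E \<in> Ob (One B)" for E
    using \<Psi> that by blast
  have i: "E \<in> Ob (One B) \<Longrightarrow> x \<in> Ob (Val U E) \<Longrightarrow> \<Psi>o E (\<Phi>o E x) = x"
     "E \<in> Ob (One B) \<Longrightarrow> f \<in> Ar (Val U E) \<Longrightarrow> \<Psi>a E (\<Phi>a E f) = f"
     "E \<in> Ob (One B) \<Longrightarrow> y \<in> Ob (Val V E) \<Longrightarrow> \<Phi>o E (\<Psi>o E y) = y"
     "E \<in> Ob (One B) \<Longrightarrow> g \<in> Ar (Val V E) \<Longrightarrow> \<Phi>a E (\<Psi>a E g) = g" for E x f y g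
    using \<Psi> by blast+
  have G: "E \<in> Ob (One B) \<Longrightarrow> is_functor (Val U E) (Val V E) (\<Phi>o E) (\<Phi>a E)" for E
    using nat by (auto simp: natural_isomorphism_def is_iso_functor_def)
  have fo: "\<Psi>o E x \<in> Ob (Val U E)" if "E \<in> Ob (One B)" "x \<in> Ob (Val V E)" for E x
    using F that by (auto simp: is_functor_def)
  have fa: "\<Psi>a E x \<in> Ar (Val U E)" if "E \<in> Ob (One B)" "x \<in> Ar (Val V E)" for E x
    using F that by (auto simp: is_functor_def hom_def)
  have ga: "\<Phi>a E x \<in> Ar (Val V E)" if "E \<in> Ob (One B)" "x \<in> Ar (Val U E)" for E x
    using G that by (auto simp: is_functor_def hom_def)
  have B1: "Dm (One B) u \<in> Ob (One B)" "Cd (One B) u \<in> Ob (One B)" if "u \<in> Ar (One B)" for u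
    using B that by (auto simp: category_def)
  have B2: "Dm (Two B) \<alpha> \<in> Ar (One B)" if "\<alpha> \<in> Ar (Two B)" for \<alpha>
    using B that unfolding category_def by metis
  have n1: "\<Phi>o (Cd (One B) u) (Act1 U u \<xi>) = Act1 V u (\<Phi>o (Dm (One B) u) \<xi>)"
    if "u \<in> Ar (One B)" "\<xi> \<in> Ob (Val U (Dm (One B) u))" for u \<xi>
    using nat that by (auto simp: natural_isomorphism_def)
  have n2: "\<Phi>a (cd0 B \<alpha>) (Act2 U \<alpha> \<rho>) = Act2 V \<alpha> (\<Phi>a (dm0 B \<alpha>) \<rho>)"
    if "\<alpha> \<in> Ar (Two B)" "\<rho> \<in> Ar (Val U (dm0 B \<alpha>))" for \<alpha> \<rho>
    using nat that by (auto simp: natural_isomorphism_def)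
  have c1: "Act1 U u \<xi> \<in> Ob (Val U (Cd (One B) u))"
    if "u \<in> Ar (One B)" "\<xi> \<in> Ob (Val U (Dm (One B) u))" for u \<xi>
    using U that by (auto simp: closed_cone_functor_def)
  have c2: "Act2 U \<alpha> \<rho> \<in> Ar (Val U (cd0 B \<alpha>))"
    if "\<alpha> \<in> Ar (Two B)" "\<rho> \<in> Ar (Val U (dm0 B \<alpha>))" for \<alpha> \<rho>
    using U that by (auto simp: closed_cone_functor_def)
  \<comment> \<open>The action on \<open>V\<close> is the conjugate of the action on
    \<open>U\<close>; in this form the inverse cancels at once.\<close>
  have m1: "Act1 V u \<xi> = \<Phi>o (Cd (One B) u) (Act1 U u (\<Psi>o (Dm (One B) u) \<xi>))"
    if "u \<in> Ar (One B)" "\<xi> \<in> Ob (Val V (Dm (One B) u))" for u \<xi>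
    using n1[OF that(1)] fo i(3) B1 that by metis
  have m2: "Act2 V \<alpha> \<rho> = \<Phi>a (cd0 B \<alpha>) (Act2 U \<alpha> (\<Psi>a (dm0 B \<alpha>) \<rho>))"
    if "\<alpha> \<in> Ar (Two B)" "\<rho> \<in> Ar (Val V (dm0 B \<alpha>))" for \<alpha> \<rho>
    using n2[OF that(1)] fa i(4) B1 B2 that by metis
  have "natural_isomorphism B V U \<Psi>o \<Psi>a"
    unfolding natural_isomorphism_def
  proof (intro conjI ballI)
    fix E assume E: "E \<in> Ob (One B)"
    show "is_iso_functor (Val V E) (Val U E) (\<Psi>o E) (\<Psi>a E)"
      unfolding is_iso_functor_def using F[OF E] G[OF E] i E by blast
  next
    fix u \<xi> assume u: "u \<in> Ar (One B)" "\<xi> \<in> Ob (Val V (Dm (One B) u))"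
    show "\<Psi>o (Cd (One B) u) (Act1 V u \<xi>) = Act1 U u (\<Psi>o (Dm (One B) u) \<xi>)"
      using m1[OF u] i(1) c1 fo B1 u by simp
  next
    fix \<alpha> \<rho> assume u: "\<alpha> \<in> Ar (Two B)" "\<rho> \<in> Ar (Val V (dm0 B \<alpha>))"
    show "\<Psi>a (cd0 B \<alpha>) (Act2 V \<alpha> \<rho>) = Act2 U \<alpha> (\<Psi>a (dm0 B \<alpha>) \<rho>)"
      using m2[OF u] i(2) c2 fa B1 B2 u by simp
  qed
  moreover have "Idt (Val V E) x \<in> Ar (Val V E)" if E: "E \<in> Ob (One B)" and x: "x \<in> Ob (Val V E)" for E x
  proof -
    have "Idt (Val V E) x = \<Phi>a E (Idt (Val U E) (\<Psi>o E x))"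
      using functor_id[OF G[OF E] fo[OF E x]] i(3)[OF E x] by simp
    moreover have "Idt (Val U E) (\<Psi>o E x) \<in> Ar (Val U E)"
      using closed_cone_functorD[OF U E] fo[OF E x] by (auto simp: closed_cat_def hom_def)
    ultimately show ?thesis using ga[OF E] by simp
  qed
  ultimately show thesis
    using that i fo by blast
qed

lemma is_iso_functor_cong:
  assumes "is_iso_functor C D fo fa"
    and "\<And>x. x \<in> Ob C \<Longrightarrow> fo' x = fo x" "\<And>f. f \<in> Ar C \<Longrightarrow> fa' f = fa f"
    and C: "closed_cat C"
  shows "is_iso_functor C D fo' fa'"
proof -
  obtain go ga where f: "is_functor D C go ga" "\<forall>x \<in> Ob C. go (fo x) = x"
    "\<forall>f \<in> Ar C. ga (fa f) = f" "\<forall>y \<in> Ob D. fo (go y) = y" "\<forall>g \<in> Ar D. fa (ga g) = g"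
    using assms(1) by (auto simp: is_iso_functor_def)
  have "is_functor C D fo fa" using assms(1) by (simp add: is_iso_functor_def)
  then have "is_functor C D fo' fa'"
    using assms(2,3) C by (auto simp: is_functor_def hom_def closed_cat_def)
  moreover have "go y \<in> Ob C" if "y \<in> Ob D" for y using f(1) that by (auto simp: is_functor_def)
  moreover have "ga y \<in> Ar C" if "y \<in> Ar D" for y using f(1) that by (auto simp: is_functor_def hom_def)
  ultimately show ?thesis
    unfolding is_iso_functor_def using f assms(2,3) by (intro conjI exI[of _ go] exI[of _ ga]) auto
qed

text \<open>By naturality, the comparison from \<open>Hom B L E\<close> to \<open>Val V E\<close> is
  the comparison to \<open>Val U E\<close> followed by the isomorphism at \<open>E\<close>, and
  isomorphisms compose.\<close>

lemma universal_transfer: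
  assumes U: "\<And>\<xi>. \<xi> \<in> Ob (Val U L) \<Longrightarrow> Idt (Val U L) \<xi> \<in> Ar (Val U L)"
    and nat: "natural_isomorphism B U V \<Phi>o \<Phi>a"
    and H: "\<And>L E. closed_cat (Hom B L E)"
    and u: "universal B U L \<xi>"
  shows "universal B V L (\<Phi>o L \<xi>)"
proof -
  have L: "L \<in> Ob (One B)" and xi: "\<xi> \<in> Ob (Val U L)"
    using u by (auto simp: universal_def)
  have G: "is_iso_functor (Val U E) (Val V E) (\<Phi>o E) (\<Phi>a E)" if "E \<in> Ob (One B)" for E
    using nat that by (auto simp: natural_isomorphism_def)
  have fL: "is_functor (Val U L) (Val V L) (\<Phi>o L) (\<Phi>a L)"
    using G[OF L] by (simp add: is_iso_functor_def)
  have idar: "Idt (Val U L) \<xi> \<in> Ar (Val U L)"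
    using xi by (rule U)
  have "is_iso_functor (Hom B L E) (Val V E) (\<lambda>u. Act1 V u (\<Phi>o L \<xi>))
          (\<lambda>\<alpha>. Act2 V \<alpha> (Idt (Val V L) (\<Phi>o L \<xi>)))" if E: "E \<in> Ob (One B)" for E
  proof (rule is_iso_functor_cong[OF is_iso_functor_comp[OF _ G[OF E]]])
    show "is_iso_functor (Hom B L E) (Val U E) (\<lambda>u. Act1 U u \<xi>) (\<lambda>\<alpha>. Act2 U \<alpha> (Idt (Val U L) \<xi>))"
      using u E by (auto simp: universal_def)
    show "closed_cat (Hom B L E)" by (rule H)
    fix f assume f: "f \<in> Ob (Hom B L E)"
    then show "Act1 V f (\<Phi>o L \<xi>) = \<Phi>o E (Act1 U f \<xi>)"
      using nat xi by (auto simp: natural_isomorphism_def Hom_def hom_def)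
  next
    fix \<alpha> assume f: "\<alpha> \<in> Ar (Hom B L E)"
    \<comment> \<open>Naturality in 2-cells is used at the identity of \<open>\<xi>\<close>, which
      \<open>\<Phi>a L\<close> sends to the identity of the corresponding cone.\<close>
    have "\<Phi>a E (Act2 U \<alpha> (Idt (Val U L) \<xi>)) = Act2 V \<alpha> (\<Phi>a L (Idt (Val U L) \<xi>))"
      using nat idar f by (auto simp: natural_isomorphism_def Hom_def hom_def)
    then show "Act2 V \<alpha> (Idt (Val V L) (\<Phi>o L \<xi>)) = \<Phi>a E (Act2 U \<alpha> (Idt (Val U L) \<xi>))"
      using functor_id[OF fL xi] by simp
  qed
  then show ?thesis
    using L functor_ob[OF fL xi] by (auto simp: universal_def)
qed

text \<open>Universality is reflected by transferring it back along the inverse isomorphism. Since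
  both orders of \<open>U\<close> and \<open>V\<close> result, each pair of cone functors has to be
  compared in one direction only.\<close>

lemma equivalent_universal_propertiesI:
  assumes U: "closed_cone_functor B U" and nat: "natural_isomorphism B U V \<Phi>o \<Phi>a"
    and B: "category (One B)" "category (Two B)" "Ob (Two B) = Ar (One B)" and H: "\<And>L E. closed_cat (Hom B L E)"
  shows "equivalent_universal_properties B U V" "equivalent_universal_properties B V U"
proof -
  obtain \<Psi>o \<Psi>a where nat': "natural_isomorphism B V U \<Psi>o \<Psi>a"
    and i: "\<And>E \<xi>. E \<in> Ob (One B) \<Longrightarrow> \<xi> \<in> Ob (Val U E) \<Longrightarrow> \<Psi>o E (\<Phi>o E \<xi>) = \<xi>"
    "\<And>E \<xi>. E \<in> Ob (One B) \<Longrightarrow> \<xi> \<in> Ob (Val V E) \<Longrightarrow> \<Phi>o E (\<Psi>o E \<xi>) = \<xi>"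
    "\<And>E \<xi>. E \<in> Ob (One B) \<Longrightarrow> \<xi> \<in> Ob (Val V E) \<Longrightarrow> \<Psi>o E \<xi> \<in> Ob (Val U E)"
    and V: "\<And>E \<xi>. E \<in> Ob (One B) \<Longrightarrow> \<xi> \<in> Ob (Val V E) \<Longrightarrow> Idt (Val V E) \<xi> \<in> Ar (Val V E)"
    using natural_isomorphism_inverse[OF U nat B] by blast
  have "Idt (Val U E) \<xi> \<in> Ar (Val U E)" if "E \<in> Ob (One B)" "\<xi> \<in> Ob (Val U E)" for E \<xi>
    using closed_cone_functorD[OF U that(1)] that(2) by (auto simp: closed_cat_def hom_def)
  note t = universal_transfer[OF this nat H] and t' = universal_transfer[OF V nat' H]
  show "equivalent_universal_properties B U V"
    unfolding equivalent_universal_properties_def using nat t t' i by metis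
  show "equivalent_universal_properties B V U"
    unfolding equivalent_universal_properties_def using nat' t t' i by metis
qed

section \<open>The 2-category \<open>Cat\<close>\<close>

lemma small_functorD:
  assumes "small_functor F"
  shows "ext_category (FSrc F)" "ext_category (FTgt F)" "category (FSrc F)" "category (FTgt F)"
    "FO F \<in> extensional (Ob (FSrc F))" "FA F \<in> extensional (Ar (FSrc F))"
    "is_functor (FSrc F) (FTgt F) (FO F) (FA F)"
  using assms by (auto simp: small_functor_def ext_category_def)

lemma small_transformationD:
  assumes "small_transformation \<alpha>"
  shows "small_functor (NSrc \<alpha>)" "small_functor (NTgt \<alpha>)"
    "FSrc (NTgt \<alpha>) = FSrc (NSrc \<alpha>)" "FTgt (NTgt \<alpha>) = FTgt (NSrc \<alpha>)"
    "NC \<alpha> \<in> extensional (Ob (FSrc (NSrc \<alpha>)))"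
    "x \<in> Ob (FSrc (NSrc \<alpha>)) \<Longrightarrow> NC \<alpha> x \<in> hom (FTgt (NSrc \<alpha>)) (FO (NSrc \<alpha>) x) (FO (NTgt \<alpha>) x)"
    "f \<in> hom (FSrc (NSrc \<alpha>)) x y \<Longrightarrow>
      Cmp (FTgt (NSrc \<alpha>)) (NC \<alpha> y) (FA (NSrc \<alpha>) f) = Cmp (FTgt (NSrc \<alpha>)) (FA (NTgt \<alpha>) f) (NC \<alpha> x)"
  using assms by (auto simp: small_transformation_def hom_def)

lemma small_transformationI:
  assumes "small_functor (NSrc \<alpha>)" "small_functor (NTgt \<alpha>)"
    "FSrc (NTgt \<alpha>) = FSrc (NSrc \<alpha>)" "FTgt (NTgt \<alpha>) = FTgt (NSrc \<alpha>)"
    "NC \<alpha> \<in> extensional (Ob (FSrc (NSrc \<alpha>)))"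
    "\<And>x. x \<in> Ob (FSrc (NSrc \<alpha>)) \<Longrightarrow> NC \<alpha> x \<in> hom (FTgt (NSrc \<alpha>)) (FO (NSrc \<alpha>) x) (FO (NTgt \<alpha>) x)"
    "\<And>f x y. f \<in> hom (FSrc (NSrc \<alpha>)) x y \<Longrightarrow>
      Cmp (FTgt (NSrc \<alpha>)) (NC \<alpha> y) (FA (NSrc \<alpha>) f) = Cmp (FTgt (NSrc \<alpha>)) (FA (NTgt \<alpha>) f) (NC \<alpha> x)"
  shows "small_transformation \<alpha>"
  unfolding small_transformation_def using assms(1-6) assms(7)[OF hom_self] by blast

text \<open>Arrows of \<open>Cat\<close> are equal only as records; extensionality of the object and
  arrow parts reduces this to values on the source category. The same holds for transformations
  below.\<close>

lemma fnc_eqI: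
  assumes "small_functor F" "small_functor G" "FSrc F = FSrc G" "FTgt F = FTgt G"
    and "\<And>x. x \<in> Ob (FSrc G) \<Longrightarrow> FO F x = FO G x" "\<And>f. f \<in> Ar (FSrc G) \<Longrightarrow> FA F f = FA G f"
  shows "F = G"
proof (rule fnc.equality)
  show "FO F = FO G"
    using small_functorD(5)[OF assms(1)] small_functorD(5)[OF assms(2)] assms(3,5)
    by (intro extensionalityI[where A = "Ob (FSrc G)"]) auto
  show "FA F = FA G"
    using small_functorD(6)[OF assms(1)] small_functorD(6)[OF assms(2)] assms(3,6)
    by (intro extensionalityI[where A = "Ar (FSrc G)"]) auto
qed (use assms in auto)

lemma ntr_eqI:
  assumes "small_transformation \<alpha>" "small_transformation \<beta>" "NSrc \<alpha> = NSrc \<beta>" "NTgt \<alpha> = NTgt \<beta>"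
    and "\<And>x. x \<in> Ob (FSrc (NSrc \<beta>)) \<Longrightarrow> NC \<alpha> x = NC \<beta> x"
  shows "\<alpha> = \<beta>"
proof (rule ntr.equality)
  show "NC \<alpha> = NC \<beta>"
    using small_transformationD(5)[OF assms(1)] small_transformationD(5)[OF assms(2)] assms(3,5)
    by (intro extensionalityI[where A = "Ob (FSrc (NSrc \<beta>))"]) auto
qed (use assms in auto)

lemma Cat_One [simp]:
  "Ob (One Cat) = {C. ext_category C}" "Ar (One Cat) = {F. small_functor F}"
  "Dm (One Cat) = FSrc" "Cd (One Cat) = FTgt"
  "FSrc (Cmp (One Cat) G F) = FSrc F" "FTgt (Cmp (One Cat) G F) = FTgt G"
  "FO (Cmp (One Cat) G F) = (\<lambda>x \<in> Ob (FSrc F). FO G (FO F x))"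
  "FA (Cmp (One Cat) G F) = (\<lambda>f \<in> Ar (FSrc F). FA G (FA F f))"
  "FSrc (Idt (One Cat) C) = C" "FTgt (Idt (One Cat) C) = C"
  "FO (Idt (One Cat) C) = (\<lambda>x \<in> Ob C. x)" "FA (Idt (One Cat) C) = (\<lambda>f \<in> Ar C. f)"
  by (simp_all add: Cat_def)

lemma Cat_Two [simp]:
  "Ob (Two Cat) = {F. small_functor F}" "Ar (Two Cat) = {\<alpha>. small_transformation \<alpha>}"
  "Dm (Two Cat) = NSrc" "Cd (Two Cat) = NTgt"
  "NSrc (Cmp (Two Cat) \<beta> \<alpha>) = NSrc \<alpha>" "NTgt (Cmp (Two Cat) \<beta> \<alpha>) = NTgt \<beta>"
  "NC (Cmp (Two Cat) \<beta> \<alpha>) = (\<lambda>x \<in> Ob (FSrc (NSrc \<alpha>)). Cmp (FTgt (NSrc \<alpha>)) (NC \<beta> x) (NC \<alpha> x))"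
  "NSrc (Idt (Two Cat) F) = F" "NTgt (Idt (Two Cat) F) = F"
  "NC (Idt (Two Cat) F) = (\<lambda>x \<in> Ob (FSrc F). Idt (FTgt F) (FO F x))"
  by (simp_all add: Cat_def)

lemma Cat_HCmp [simp]:
  "NSrc (HCmp Cat \<beta> \<alpha>) = Cmp (One Cat) (NSrc \<beta>) (NSrc \<alpha>)"
  "NTgt (HCmp Cat \<beta> \<alpha>) = \<lparr>FSrc = FSrc (NSrc \<alpha>), FTgt = FTgt (NSrc \<beta>),
     FO = (\<lambda>x \<in> Ob (FSrc (NSrc \<alpha>)). FO (NTgt \<beta>) (FO (NTgt \<alpha>) x)),
     FA = (\<lambda>f \<in> Ar (FSrc (NSrc \<alpha>)). FA (NTgt \<beta>) (FA (NTgt \<alpha>) f))\<rparr>"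
  "NC (HCmp Cat \<beta> \<alpha>) = (\<lambda>x \<in> Ob (FSrc (NSrc \<alpha>)).
     Cmp (FTgt (NSrc \<beta>)) (NC \<beta> (FO (NTgt \<alpha>) x)) (FA (NSrc \<beta>) (NC \<alpha> x)))"
  by (simp_all add: Cat_def)

text \<open>\<open>HCmp\<close> takes the outer categories of both functors from
  \<open>NSrc\<close>. They agree with those of \<open>NTgt\<close> only for genuine
  transformations, hence the separate statement with hypotheses.\<close>

lemma NTgt_HCmp:
  assumes "small_transformation \<alpha>" "small_transformation \<beta>"
  shows "NTgt (HCmp Cat \<beta> \<alpha>) = Cmp (One Cat) (NTgt \<beta>) (NTgt \<alpha>)"
  using small_transformationD(3,4)[OF assms(1)] small_transformationD(3,4)[OF assms(2)]
  by (intro fnc.equality) auto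

lemma hom_One: "F \<in> hom (One Cat) C D \<longleftrightarrow> small_functor F \<and> FSrc F = C \<and> FTgt F = D"
  by (auto simp: hom_def)

lemma hom_Two: "\<alpha> \<in> hom (Two Cat) F G \<longleftrightarrow> small_transformation \<alpha> \<and> NSrc \<alpha> = F \<and> NTgt \<alpha> = G"
  by (auto simp: hom_def)

lemma hom_TwoD:
  assumes "\<alpha> \<in> hom (Two Cat) F G"
  shows "x \<in> Ob (FSrc F) \<Longrightarrow> NC \<alpha> x \<in> hom (FTgt F) (FO F x) (FO G x)"
    and "f \<in> hom (FSrc F) x y \<Longrightarrow>
      Cmp (FTgt F) (NC \<alpha> y) (FA F f) = Cmp (FTgt F) (FA G f) (NC \<alpha> x)"
  using assms by (auto simp: hom_Two dest: small_transformationD)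

lemma small_functor_Idt [simp]: "ext_category C \<Longrightarrow> small_functor (Idt (One Cat) C)"
  using id_hom[of C] hom_ob[of C] cmp_hom[of C] by (auto simp: small_functor_def ext_category_category
    intro!: is_functorI) (auto simp: hom_def)

lemma small_functor_Cmp:
  assumes "small_functor F" "small_functor G" "FTgt F = FSrc G"
  shows "small_functor (Cmp (One Cat) G F)"
  unfolding small_functor_def
proof (intro conjI)
  show "is_functor (FSrc (Cmp (One Cat) G F)) (FTgt (Cmp (One Cat) G F))
          (FO (Cmp (One Cat) G F)) (FA (Cmp (One Cat) G F))"
    by (simp, rule is_functor_cong[OF _ is_functor_comp[OF small_functorD(7)[OF assms(1)]
          small_functorD(7)[OF assms(2), folded assms(3)]]])
      (use assms in \<open>auto dest: small_functorD\<close>)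
qed (use assms small_functorD in auto)

lemma Cmp_Idt:
  assumes "small_functor F"
  shows "Cmp (One Cat) F (Idt (One Cat) (FSrc F)) = F" "Cmp (One Cat) (Idt (One Cat) (FTgt F)) F = F"
proof -
  note F = small_functorD[OF assms]
  show "Cmp (One Cat) F (Idt (One Cat) (FSrc F)) = F"
    by (rule fnc_eqI) (use assms F in \<open>auto intro!: small_functor_Cmp\<close>)
  show "Cmp (One Cat) (Idt (One Cat) (FTgt F)) F = F"
    by (rule fnc_eqI) (use assms F in \<open>auto intro!: small_functor_Cmp simp: is_functor_def hom_def\<close>)
qed

lemma Cmp_One_assoc:
  assumes "small_functor F" "small_functor G" "small_functor H" "FTgt F = FSrc G" "FTgt G = FSrc H"
  shows "Cmp (One Cat) (Cmp (One Cat) H G) F = Cmp (One Cat) H (Cmp (One Cat) G F)"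
  using assms small_functorD(7)[OF assms(1)]
  by (intro fnc_eqI) (auto intro!: small_functor_Cmp simp: is_functor_def hom_def)

lemma small_transformation_Idt [simp]:
  assumes "small_functor F"
  shows "small_transformation (Idt (Two Cat) F)"
proof (rule small_transformationI)
  note F = small_functorD[OF assms]
  fix f x y
  assume "f \<in> hom (FSrc (NSrc (Idt (Two Cat) F))) x y"
  then have f: "f \<in> hom (FSrc F) x y" by simp
  then have "x \<in> Ob (FSrc F)" "y \<in> Ob (FSrc F)" using hom_ob F(3) by metis+
  then show "Cmp (FTgt (NSrc (Idt (Two Cat) F))) (NC (Idt (Two Cat) F) y) (FA (NSrc (Idt (Two Cat) F)) f) =
      Cmp (FTgt (NSrc (Idt (Two Cat) F))) (FA (NTgt (Idt (Two Cat) F)) f) (NC (Idt (Two Cat) F) x)"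
    using functor_hom[OF F(7) f] by (simp add: id_cmp[OF F(4)] cmp_id[OF F(4)])
qed (use assms small_functorD[OF assms] in \<open>auto intro: id_hom functor_ob\<close>)

lemma small_transformation_Cmp:
  assumes "small_transformation \<alpha>" "small_transformation \<beta>" "NTgt \<alpha> = NSrc \<beta>"
  shows "small_transformation (Cmp (Two Cat) \<beta> \<alpha>)"
proof (rule small_transformationI)
  note a = small_transformationD[OF assms(1)] and b = small_transformationD[OF assms(2)]
  let ?C = "FSrc (NSrc \<alpha>)" and ?E = "FTgt (NSrc \<alpha>)"
  have C: "category ?C" and E: "category ?E" using a(1) small_functorD by blast+
  have e: "FSrc (NSrc \<beta>) = ?C" "FTgt (NSrc \<beta>) = ?E" using assms(3) a by simp_all
  note b' = b(6,7)[unfolded e] and a' = a(6,7)[unfolded assms(3)]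
  fix f x y
  assume "f \<in> hom (FSrc (NSrc (Cmp (Two Cat) \<beta> \<alpha>))) x y"
  then have f: "f \<in> hom ?C x y" by simp
  then have xy: "x \<in> Ob ?C" "y \<in> Ob ?C" using hom_ob C by metis+
  have F: "FA (NSrc \<alpha>) f \<in> hom ?E (FO (NSrc \<alpha>) x) (FO (NSrc \<alpha>) y)"
    and G: "FA (NSrc \<beta>) f \<in> hom ?E (FO (NSrc \<beta>) x) (FO (NSrc \<beta>) y)"
    and H: "FA (NTgt \<beta>) f \<in> hom ?E (FO (NTgt \<beta>) x) (FO (NTgt \<beta>) y)"
    using functor_hom[OF small_functorD(7) f] functor_hom[OF small_functorD(7)] f a b e by metis+
  have "Cmp ?E (Cmp ?E (NC \<beta> y) (NC \<alpha> y)) (FA (NSrc \<alpha>) f) =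
      Cmp ?E (NC \<beta> y) (Cmp ?E (NC \<alpha> y) (FA (NSrc \<alpha>) f))"
    using cmp_assoc[OF E F a'(1) b'(1)] xy by simp
  also have "\<dots> = Cmp ?E (Cmp ?E (NC \<beta> y) (FA (NSrc \<beta>) f)) (NC \<alpha> x)"
    using a'(2)[OF f] cmp_assoc[OF E a'(1) G b'(1)] xy by simp
  also have "\<dots> = Cmp ?E (FA (NTgt \<beta>) f) (Cmp ?E (NC \<beta> x) (NC \<alpha> x))"
    using b'(2)[OF f] cmp_assoc[OF E a'(1) b'(1) H] xy by simp
  finally show "Cmp (FTgt (NSrc (Cmp (Two Cat) \<beta> \<alpha>))) (NC (Cmp (Two Cat) \<beta> \<alpha>) y) (FA (NSrc (Cmp (Two Cat) \<beta> \<alpha>)) f) =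
      Cmp (FTgt (NSrc (Cmp (Two Cat) \<beta> \<alpha>))) (FA (NTgt (Cmp (Two Cat) \<beta> \<alpha>)) f) (NC (Cmp (Two Cat) \<beta> \<alpha>) x)"
    using xy by simp
next
  note a = small_transformationD[OF assms(1)] and b = small_transformationD[OF assms(2)]
  have E: "category (FTgt (NSrc \<alpha>))" using a(1) small_functorD by blast+
  fix x assume "x \<in> Ob (FSrc (NSrc (Cmp (Two Cat) \<beta> \<alpha>)))"
  then show "NC (Cmp (Two Cat) \<beta> \<alpha>) x \<in> hom (FTgt (NSrc (Cmp (Two Cat) \<beta> \<alpha>)))
      (FO (NSrc (Cmp (Two Cat) \<beta> \<alpha>)) x) (FO (NTgt (Cmp (Two Cat) \<beta> \<alpha>)) x)"
    using a(6)[of x] b(6)[of x] a(3,4) assms(3) by (auto intro: cmp_hom[OF E])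
qed (use assms small_transformationD[OF assms(1)] small_transformationD[OF assms(2)] in auto)

text \<open>Naturality of \<open>\<alpha>\<close> is applied under the functor
  \<open>NSrc \<beta>\<close>, then naturality of \<open>\<beta>\<close> at the arrow
  \<open>FA (NTgt \<alpha>) f\<close>.\<close>

lemma small_transformation_HCmp:
  assumes "small_transformation \<alpha>" "small_transformation \<beta>" "FTgt (NSrc \<alpha>) = FSrc (NSrc \<beta>)"
  shows "small_transformation (HCmp Cat \<beta> \<alpha>)"
proof (rule small_transformationI)
  note a = small_transformationD[OF assms(1)] and b = small_transformationD[OF assms(2)]
  show "small_functor (NSrc (HCmp Cat \<beta> \<alpha>))"
    using a(1) b(1) assms(3) by (simp add: small_functor_Cmp)
  show "small_functor (NTgt (HCmp Cat \<beta> \<alpha>))"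
    using a(2-4) b(2-4) assms by (simp add: NTgt_HCmp small_functor_Cmp del: Cat_HCmp)
  show "FSrc (NTgt (HCmp Cat \<beta> \<alpha>)) = FSrc (NSrc (HCmp Cat \<beta> \<alpha>))"
    "FTgt (NTgt (HCmp Cat \<beta> \<alpha>)) = FTgt (NSrc (HCmp Cat \<beta> \<alpha>))"
    "NC (HCmp Cat \<beta> \<alpha>) \<in> extensional (Ob (FSrc (NSrc (HCmp Cat \<beta> \<alpha>))))"
    by simp_all
next
  note a = small_transformationD[OF assms(1)] and b = small_transformationD[OF assms(2)]
  let ?C = "FSrc (NSrc \<alpha>)" and ?D = "FTgt (NSrc \<alpha>)" and ?E = "FTgt (NSrc \<beta>)"
  have C: "category ?C" and E: "category ?E" using a(1) b(1) small_functorD by blast+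
  \<comment> \<open>The functors \<open>NSrc \<alpha>\<close>, \<open>NTgt \<alpha>\<close>,
    \<open>NSrc \<beta>\<close>, \<open>NTgt \<beta>\<close> in this order, retyped so that only
    \<open>?C\<close>, \<open>?D\<close> and \<open>?E\<close> occur.\<close>
  note Fn = small_functorD(7)[OF a(1)] small_functorD(7)[OF a(2), unfolded a(3,4)]
    small_functorD(7)[OF b(1), folded assms(3)] small_functorD(7)[OF b(2), unfolded b(3,4), folded assms(3)]
  note bb = b(6,7)[folded assms(3)]
  { fix x assume x: "x \<in> Ob ?C"
    have "Cmp ?E (NC \<beta> (FO (NTgt \<alpha>) x)) (FA (NSrc \<beta>) (NC \<alpha> x)) \<in>
        hom ?E (FO (NSrc \<beta>) (FO (NSrc \<alpha>) x)) (FO (NTgt \<beta>) (FO (NTgt \<alpha>) x))"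
      using functor_hom[OF Fn(3) a(6)[OF x]] bb(1)[OF functor_ob[OF Fn(2) x]] by (rule cmp_hom[OF E]) }
  note H = this
  show "NC (HCmp Cat \<beta> \<alpha>) x \<in> hom (FTgt (NSrc (HCmp Cat \<beta> \<alpha>)))
      (FO (NSrc (HCmp Cat \<beta> \<alpha>)) x) (FO (NTgt (HCmp Cat \<beta> \<alpha>)) x)"
    if "x \<in> Ob (FSrc (NSrc (HCmp Cat \<beta> \<alpha>)))" for x
    using H that by simp
  fix f x y
  assume "f \<in> hom (FSrc (NSrc (HCmp Cat \<beta> \<alpha>))) x y"
  then have f: "f \<in> hom ?C x y" by simp
  then have xy: "x \<in> Ob ?C" "y \<in> Ob ?C" and fa: "f \<in> Ar ?C"
    using hom_ob[OF C f] f by (auto simp: hom_iff)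
  let ?F = "NSrc \<alpha>" and ?G = "NTgt \<alpha>" and ?F' = "NSrc \<beta>" and ?G' = "NTgt \<beta>"
  note Ff = functor_hom[OF Fn(1) f] and Gf = functor_hom[OF Fn(2) f]
  have "Cmp ?E (Cmp ?E (NC \<beta> (FO ?G y)) (FA ?F' (NC \<alpha> y))) (FA ?F' (FA ?F f)) =
      Cmp ?E (NC \<beta> (FO ?G y)) (FA ?F' (Cmp ?D (NC \<alpha> y) (FA ?F f)))"
    using cmp_assoc[OF E functor_hom[OF Fn(3) Ff] functor_hom[OF Fn(3) a(6)[OF xy(2)]] bb(1)[OF functor_ob[OF Fn(2) xy(2)]]]
      functor_cmp[OF Fn(3) Ff a(6)[OF xy(2)]] by simp
  also have "\<dots> = Cmp ?E (NC \<beta> (FO ?G y)) (Cmp ?E (FA ?F' (FA ?G f)) (FA ?F' (NC \<alpha> x)))"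
    using a(7)[OF f] functor_cmp[OF Fn(3) a(6)[OF xy(1)] Gf] by simp
  also have "\<dots> = Cmp ?E (Cmp ?E (NC \<beta> (FO ?G y)) (FA ?F' (FA ?G f))) (FA ?F' (NC \<alpha> x))"
    using cmp_assoc[OF E functor_hom[OF Fn(3) a(6)[OF xy(1)]] functor_hom[OF Fn(3) Gf] bb(1)[OF functor_ob[OF Fn(2) xy(2)]]]
    by simp
  also have "\<dots> = Cmp ?E (FA ?G' (FA ?G f)) (Cmp ?E (NC \<beta> (FO ?G x)) (FA ?F' (NC \<alpha> x)))"
    using bb(2)[OF Gf] cmp_assoc[OF E functor_hom[OF Fn(3) a(6)[OF xy(1)]] bb(1)[OF functor_ob[OF Fn(2) xy(1)]] functor_hom[OF Fn(4) Gf]]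
    by simp
  finally show "Cmp (FTgt (NSrc (HCmp Cat \<beta> \<alpha>))) (NC (HCmp Cat \<beta> \<alpha>) y) (FA (NSrc (HCmp Cat \<beta> \<alpha>)) f) =
      Cmp (FTgt (NSrc (HCmp Cat \<beta> \<alpha>))) (FA (NTgt (HCmp Cat \<beta> \<alpha>)) f) (NC (HCmp Cat \<beta> \<alpha>) x)"
    using xy fa by simp
qed

text \<open>The component formula of \<open>HCmp\<close> contains an extra identity factor, removed
  by functoriality and the unit law. This makes the whiskered cells of cones computable by
  components; \<open>lwhisk_Cat\<close> does the same on the other side.\<close>

lemma rwhisk_Cat:
  assumes "small_transformation \<alpha>" "small_functor F" "FTgt F = FSrc (NSrc \<alpha>)"
  shows "small_transformation (rwhisk Cat \<alpha> F)"
    "NSrc (rwhisk Cat \<alpha> F) = Cmp (One Cat) (NSrc \<alpha>) F" "NTgt (rwhisk Cat \<alpha> F) = Cmp (One Cat) (NTgt \<alpha>) F"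
    "x \<in> Ob (FSrc F) \<Longrightarrow> NC (rwhisk Cat \<alpha> F) x = NC \<alpha> (FO F x)"
proof -
  note a = small_transformationD[OF assms(1)]
  show "small_transformation (rwhisk Cat \<alpha> F)"
    using assms by (simp add: rwhisk_def small_transformation_HCmp)
  show "NSrc (rwhisk Cat \<alpha> F) = Cmp (One Cat) (NSrc \<alpha>) F" "NTgt (rwhisk Cat \<alpha> F) = Cmp (One Cat) (NTgt \<alpha>) F"
    using assms by (simp_all add: rwhisk_def NTgt_HCmp del: Cat_HCmp(2))
  assume x: "x \<in> Ob (FSrc F)"
  then have Fx: "FO F x \<in> Ob (FSrc (NSrc \<alpha>))"
    using functor_ob small_functorD(7)[OF assms(2)] assms(3) by metis
  show "NC (rwhisk Cat \<alpha> F) x = NC \<alpha> (FO F x)"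
    using x a(6)[OF Fx] functor_id[OF small_functorD(7)[OF a(1)] Fx] assms(3)
    by (simp add: rwhisk_def cmp_id[OF small_functorD(4)[OF a(1)]])
qed

lemma lwhisk_Cat:
  assumes "small_transformation \<alpha>" "small_functor G" "FTgt (NSrc \<alpha>) = FSrc G"
  shows "small_transformation (lwhisk Cat G \<alpha>)"
    "NSrc (lwhisk Cat G \<alpha>) = Cmp (One Cat) G (NSrc \<alpha>)" "NTgt (lwhisk Cat G \<alpha>) = Cmp (One Cat) G (NTgt \<alpha>)"
    "x \<in> Ob (FSrc (NSrc \<alpha>)) \<Longrightarrow> NC (lwhisk Cat G \<alpha>) x = FA G (NC \<alpha> x)"
proof -
  note a = small_transformationD[OF assms(1)] and G = small_functorD[OF assms(2)]
  show "small_transformation (lwhisk Cat G \<alpha>)"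
    using assms by (simp add: lwhisk_def small_transformation_HCmp)
  show "NSrc (lwhisk Cat G \<alpha>) = Cmp (One Cat) G (NSrc \<alpha>)" "NTgt (lwhisk Cat G \<alpha>) = Cmp (One Cat) G (NTgt \<alpha>)"
    using assms by (simp_all add: lwhisk_def NTgt_HCmp del: Cat_HCmp(2))
  assume x: "x \<in> Ob (FSrc (NSrc \<alpha>))"
  have ax: "NC \<alpha> x \<in> hom (FSrc G) (FO (NSrc \<alpha>) x) (FO (NTgt \<alpha>) x)"
    using a(6)[OF x] assms(3) by simp
  have "FO (NTgt \<alpha>) x \<in> Ob (FSrc G)" using hom_ob[OF G(3) ax] by simp
  then show "NC (lwhisk Cat G \<alpha>) x = FA G (NC \<alpha> x)"
    using x functor_hom[OF G(7) ax] by (simp add: lwhisk_def id_cmp[OF G(4)])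
qed

lemma category_Cat:
  "category (One (Cat :: ('u small_cat, 'u fnc, 'u ntr) cat2))"
  "category (Two (Cat :: ('u small_cat, 'u fnc, 'u ntr) cat2))"
proof -
  show "category (One (Cat :: ('u small_cat, 'u fnc, 'u ntr) cat2))"
    unfolding category_def hom_One
    by (simp add: small_functorD(1,2) small_functor_Cmp Cmp_Idt Cmp_One_assoc)
  have i: "Cmp (Two Cat) \<alpha> (Idt (Two Cat) (NSrc \<alpha>)) = \<alpha>" "Cmp (Two Cat) (Idt (Two Cat) (NTgt \<alpha>)) \<alpha> = \<alpha>"
    if "small_transformation \<alpha>" for \<alpha> :: "'u ntr"
  proof -
    note a = small_transformationD[OF that]
    have E: "category (FTgt (NSrc \<alpha>))" using a(1) small_functorD by blast
    show "Cmp (Two Cat) \<alpha> (Idt (Two Cat) (NSrc \<alpha>)) = \<alpha>" "Cmp (Two Cat) (Idt (Two Cat) (NTgt \<alpha>)) \<alpha> = \<alpha>"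
      using a by (auto intro!: ntr_eqI small_transformation_Cmp that simp: cmp_id[OF E a(6)] id_cmp[OF E a(6)])
  qed
  have "Cmp (Two Cat) \<gamma> (Cmp (Two Cat) \<beta> \<alpha>) = Cmp (Two Cat) (Cmp (Two Cat) \<gamma> \<beta>) \<alpha>"
    if "small_transformation \<alpha>" "small_transformation \<beta>" "small_transformation \<gamma>"
      "NSrc \<beta> = NTgt \<alpha>" "NSrc \<gamma> = NTgt \<beta>" for \<alpha> \<beta> \<gamma> :: "'u ntr"
  proof -
    note a = small_transformationD[OF that(1)] and b = small_transformationD[OF that(2)]
      and c = small_transformationD[OF that(3)]
    have E: "category (FTgt (NSrc \<alpha>))" using a(1) small_functorD by blast
    have e: "FSrc (NSrc \<beta>) = FSrc (NSrc \<alpha>)" "FTgt (NSrc \<beta>) = FTgt (NSrc \<alpha>)"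
      "FSrc (NSrc \<gamma>) = FSrc (NSrc \<alpha>)" "FTgt (NSrc \<gamma>) = FTgt (NSrc \<alpha>)"
      using a(3,4) b(3,4) that(4,5) by simp_all
    have "Cmp (FTgt (NSrc \<alpha>)) (NC \<gamma> x) (Cmp (FTgt (NSrc \<alpha>)) (NC \<beta> x) (NC \<alpha> x)) =
       Cmp (FTgt (NSrc \<alpha>)) (Cmp (FTgt (NSrc \<alpha>)) (NC \<gamma> x) (NC \<beta> x)) (NC \<alpha> x)"
      if x: "x \<in> Ob (FSrc (NSrc \<alpha>))" for x
    proof -
      have "NC \<beta> x \<in> hom (FTgt (NSrc \<alpha>)) (FO (NTgt \<alpha>) x) (FO (NTgt \<beta>) x)"
        "NC \<gamma> x \<in> hom (FTgt (NSrc \<alpha>)) (FO (NTgt \<beta>) x) (FO (NTgt \<gamma>) x)"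
        using b(6)[of x] c(6)[of x] x e \<open>NSrc \<beta> = NTgt \<alpha>\<close> \<open>NSrc \<gamma> = NTgt \<beta>\<close> by auto
      then show ?thesis using a(6)[OF x] cmp_assoc[OF E] by metis
    qed
    then show ?thesis
      using that a(3,4) b(3,4) by (intro ntr_eqI) (auto intro!: small_transformation_Cmp)
  qed
  then show "category (Two (Cat :: ('u small_cat, 'u fnc, 'u ntr) cat2))"
    unfolding category_def hom_Two using i
    by (simp add: small_transformation_Cmp small_transformationD(1,2))
qed

lemma closed_cat_Hom_Cat: "closed_cat (Hom Cat L E)"
  unfolding closed_cat_def Hom_def hom_def
  by (auto simp: small_transformation_Cmp)

lemma hom_TwoI:
  assumes F: "small_functor F" and G: "small_functor G" "FSrc G = FSrc F" "FTgt G = FTgt F"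
    and n: "\<And>x. x \<in> Ob (FSrc F) \<Longrightarrow> n x \<in> hom (FTgt F) (FO F x) (FO G x)"
    and nat: "\<And>f x y. f \<in> hom (FSrc F) x y \<Longrightarrow> Cmp (FTgt F) (n y) (FA F f) = Cmp (FTgt F) (FA G f) (n x)"
  shows "\<lparr>NSrc = F, NTgt = G, NC = restrict n (Ob (FSrc F))\<rparr> \<in> hom (Two Cat) F G"
proof -
  have "x \<in> Ob (FSrc F) \<and> y \<in> Ob (FSrc F)" if "f \<in> hom (FSrc F) x y" for f x y
    using hom_ob[OF small_functorD(3)[OF F] that] by blast
  then show ?thesis
    unfolding hom_Two by (auto intro!: small_transformationI simp: F G n nat)
qed

section \<open>Cones in \<open>Cat\<close>\<close>

text \<open>Sigma-cones and pseudo-dicones share the shape: a functor \<open>D i \<rightarrow> E\<close> for each object \<open>i\<close> and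
  a natural transformation \<open>leg (a u) \<circ> S u \<Rightarrow> leg (b u) \<circ> T u\<close> for each arrow \<open>u\<close>.  For
  sigma-cones \<open>T u\<close> is an identity.\<close>

locale cone_shape =
  fixes J :: "('i, 'v) cat" and D :: "'i \<Rightarrow> 'u small_cat"
    and S T :: "'v \<Rightarrow> 'u fnc" and a b :: "'v \<Rightarrow> 'i"
  assumes D: "i \<in> Ob J \<Longrightarrow> ext_category (D i)"
    and S: "v \<in> Ar J \<Longrightarrow> small_functor (S v)" "v \<in> Ar J \<Longrightarrow> FTgt (S v) = D (a v)"
    and T: "v \<in> Ar J \<Longrightarrow> small_functor (T v)" "v \<in> Ar J \<Longrightarrow> FTgt (T v) = D (b v)"
    and ST: "v \<in> Ar J \<Longrightarrow> FSrc (T v) = FSrc (S v)"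
    and ab: "v \<in> Ar J \<Longrightarrow> a v \<in> Ob J" "v \<in> Ar J \<Longrightarrow> b v \<in> Ob J"
begin

text \<open>The typing that both kinds of cones share. Their equations and invertibility conditions
  are kept apart, so that everything depending on typing alone is proved once.\<close>

definition precone :: "'u small_cat \<Rightarrow> ('i, 'v, 'u fnc, 'u ntr) cone \<Rightarrow> bool" where
  "precone E c \<longleftrightarrow> leg c \<in> extensional (Ob J) \<and> cel c \<in> extensional (Ar J) \<and>
     (\<forall>i \<in> Ob J. leg c i \<in> hom (One Cat) (D i) E) \<and>
     (\<forall>v \<in> Ar J. cel c v \<in> hom (Two Cat) (Cmp (One Cat) (leg c (a v)) (S v)) (Cmp (One Cat) (leg c (b v)) (T v)))"

text \<open>All raw maps are cut down by \<open>restrict\<close>: this is what makes cones with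
  equal components equal.\<close>

definition mk_cone ::
  "'u small_cat \<Rightarrow> ('i \<Rightarrow> 'u \<Rightarrow> 'u) \<Rightarrow> ('i \<Rightarrow> 'u \<Rightarrow> 'u) \<Rightarrow> ('v \<Rightarrow> 'u \<Rightarrow> 'u) \<Rightarrow> ('i, 'v, 'u fnc, 'u ntr) cone"
  where
  "mk_cone E lo la t =
     (let lg = (\<lambda>i \<in> Ob J. \<lparr>FSrc = D i, FTgt = E, FO = restrict (lo i) (Ob (D i)), FA = restrict (la i) (Ar (D i))\<rparr>)
      in \<lparr>leg = lg,
          cel = (\<lambda>v \<in> Ar J. \<lparr>NSrc = Cmp (One Cat) (lg (a v)) (S v), NTgt = Cmp (One Cat) (lg (b v)) (T v),
                            NC = restrict (t v) (Ob (FSrc (S v)))\<rparr>)\<rparr>)"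

lemma mk_cone_sel:
  "i \<in> Ob J \<Longrightarrow> z \<in> Ob (D i) \<Longrightarrow> FO (leg (mk_cone E lo la t) i) z = lo i z"
  "i \<in> Ob J \<Longrightarrow> h \<in> Ar (D i) \<Longrightarrow> FA (leg (mk_cone E lo la t) i) h = la i h"
  "v \<in> Ar J \<Longrightarrow> x \<in> Ob (FSrc (S v)) \<Longrightarrow> NC (cel (mk_cone E lo la t) v) x = t v x"
  by (simp_all add: mk_cone_def)

lemma Sob: "v \<in> Ar J \<Longrightarrow> x \<in> Ob (FSrc (S v)) \<Longrightarrow> FO (S v) x \<in> Ob (D (a v))"
  and Tob: "v \<in> Ar J \<Longrightarrow> x \<in> Ob (FSrc (S v)) \<Longrightarrow> FO (T v) x \<in> Ob (D (b v))"
  and Shom: "v \<in> Ar J \<Longrightarrow> g \<in> hom (FSrc (S v)) x y \<Longrightarrow> FA (S v) g \<in> hom (D (a v)) (FO (S v) x) (FO (S v) y)"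
  and Thom: "v \<in> Ar J \<Longrightarrow> g \<in> hom (FSrc (S v)) x y \<Longrightarrow> FA (T v) g \<in> hom (D (b v)) (FO (T v) x) (FO (T v) y)"
  using S T ST by (metis functor_ob functor_hom small_functorD(7))+

context
  fixes E :: "'u small_cat" and c :: "('i, 'v, 'u fnc, 'u ntr) cone"
  assumes c: "precone E c"
begin

lemma precone_leg:
  assumes "i \<in> Ob J"
  shows "small_functor (leg c i)" "FSrc (leg c i) = D i" "FTgt (leg c i) = E"
    "is_functor (D i) E (FO (leg c i)) (FA (leg c i))"
  using c assms small_functorD(7) by (force simp: precone_def hom_One)+

lemma precone_cel:
  assumes "v \<in> Ar J"
  shows "small_transformation (cel c v)"
    "NSrc (cel c v) = Cmp (One Cat) (leg c (a v)) (S v)"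
    "NTgt (cel c v) = Cmp (One Cat) (leg c (b v)) (T v)"
    "FSrc (NSrc (cel c v)) = FSrc (S v)" "FTgt (NSrc (cel c v)) = E"
    "x \<in> Ob (FSrc (S v)) \<Longrightarrow>
       NC (cel c v) x \<in> hom E (FO (leg c (a v)) (FO (S v) x)) (FO (leg c (b v)) (FO (T v) x))"
    "g \<in> hom (FSrc (S v)) x y \<Longrightarrow>
       Cmp E (NC (cel c v) y) (FA (leg c (a v)) (FA (S v) g)) =
       Cmp E (FA (leg c (b v)) (FA (T v) g)) (NC (cel c v) x)"
proof -
  have h: "cel c v \<in> hom (Two Cat) (Cmp (One Cat) (leg c (a v)) (S v)) (Cmp (One Cat) (leg c (b v)) (T v))"
    using c assms by (auto simp: precone_def)
  then show "small_transformation (cel c v)"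
    and e: "NSrc (cel c v) = Cmp (One Cat) (leg c (a v)) (S v)"
    "NTgt (cel c v) = Cmp (One Cat) (leg c (b v)) (T v)"
    by (simp_all add: hom_Two)
  show "FSrc (NSrc (cel c v)) = FSrc (S v)" "FTgt (NSrc (cel c v)) = E"
    using e precone_leg ab assms by simp_all
  show "NC (cel c v) x \<in> hom E (FO (leg c (a v)) (FO (S v) x)) (FO (leg c (b v)) (FO (T v) x))"
    if "x \<in> Ob (FSrc (S v))" for x
    using hom_TwoD(1)[OF h, of x] that precone_leg ab ST assms by simp
  show "Cmp E (NC (cel c v) y) (FA (leg c (a v)) (FA (S v) g)) =
       Cmp E (FA (leg c (b v)) (FA (T v) g)) (NC (cel c v) x)" if "g \<in> hom (FSrc (S v)) x y" for g x y
    using hom_TwoD(2)[OF h, of g x y] that precone_leg ab ST assms by (simp add: hom_iff)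
qed

end

text \<open>Sources and targets of legs and cells are forced by typing, and values off the domains
  by extensionality; only components are left to compare. The round trips between the kinds of cones
  are checked through this.\<close>

lemma precone_eqI:
  assumes c: "precone E c" and d: "precone E d"
    and lo: "\<And>i z. i \<in> Ob J \<Longrightarrow> z \<in> Ob (D i) \<Longrightarrow> FO (leg c i) z = FO (leg d i) z"
    and la: "\<And>i h. i \<in> Ob J \<Longrightarrow> h \<in> Ar (D i) \<Longrightarrow> FA (leg c i) h = FA (leg d i) h"
    and t: "\<And>v x. v \<in> Ar J \<Longrightarrow> x \<in> Ob (FSrc (S v)) \<Longrightarrow> NC (cel c v) x = NC (cel d v) x"
  shows "c = d"
proof -
  have l: "leg c i = leg d i" if "i \<in> Ob J" for i
    using precone_leg[OF c that] precone_leg[OF d that] lo la that by (intro fnc_eqI) auto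
  have "leg c = leg d"
    by (rule extensionalityI[where A = "Ob J"]) (use c d l in \<open>auto simp: precone_def\<close>)
  moreover have "cel c v = cel d v" if "v \<in> Ar J" for v
    using precone_cel[OF c that] precone_cel[OF d that] l[OF ab(1)] l[OF ab(2)] t that by (intro ntr_eqI) auto
  then have "cel c = cel d"
    by (intro extensionalityI[where A = "Ar J"]) (use c d in \<open>auto simp: precone_def\<close>)
  ultimately show ?thesis by simp
qed

lemma precone_mk_cone:
  assumes E: "ext_category E"
    and l: "\<And>i. i \<in> Ob J \<Longrightarrow> is_functor (D i) E (lo i) (la i)"
    and t: "\<And>v x. v \<in> Ar J \<Longrightarrow> x \<in> Ob (FSrc (S v)) \<Longrightarrow>
      t v x \<in> hom E (lo (a v) (FO (S v) x)) (lo (b v) (FO (T v) x))"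
    and nat: "\<And>v x y g. v \<in> Ar J \<Longrightarrow> g \<in> hom (FSrc (S v)) x y \<Longrightarrow>
       Cmp E (t v y) (la (a v) (FA (S v) g)) = Cmp E (la (b v) (FA (T v) g)) (t v x)"
  shows "precone E (mk_cone E lo la t)"
proof -
  define lg where "lg = (\<lambda>i \<in> Ob J. \<lparr>FSrc = D i, FTgt = E, FO = restrict (lo i) (Ob (D i)),
    FA = restrict (la i) (Ar (D i))\<rparr>)"
  have lg: "small_functor (lg i)" "FSrc (lg i) = D i" "FTgt (lg i) = E" if "i \<in> Ob J" for i
    using D[OF that] E that is_functor_cong[OF ext_category_category[OF D[OF that]] l[OF that]]
    by (auto simp: small_functor_def lg_def)
  have "\<lparr>NSrc = Cmp (One Cat) (lg (a v)) (S v), NTgt = Cmp (One Cat) (lg (b v)) (T v),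
         NC = restrict (t v) (Ob (FSrc (S v)))\<rparr> \<in>
         hom (Two Cat) (Cmp (One Cat) (lg (a v)) (S v)) (Cmp (One Cat) (lg (b v)) (T v))"
    if v: "v \<in> Ar J" for v
  proof -
    note ab = ab[OF v] and S = S[OF v] and T = T[OF v] and ST = ST[OF v]
    note la = lg[OF ab(1)] and lb = lg[OF ab(2)]
    have "\<lparr>NSrc = Cmp (One Cat) (lg (a v)) (S v), NTgt = Cmp (One Cat) (lg (b v)) (T v),
        NC = restrict (t v) (Ob (FSrc (Cmp (One Cat) (lg (a v)) (S v))))\<rparr> \<in>
         hom (Two Cat) (Cmp (One Cat) (lg (a v)) (S v)) (Cmp (One Cat) (lg (b v)) (T v))"
    proof (rule hom_TwoI)
      show "small_functor (Cmp (One Cat) (lg (a v)) (S v))" "small_functor (Cmp (One Cat) (lg (b v)) (T v))"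
        using la lb S T by (auto intro!: small_functor_Cmp)
      show "FSrc (Cmp (One Cat) (lg (b v)) (T v)) = FSrc (Cmp (One Cat) (lg (a v)) (S v))"
        "FTgt (Cmp (One Cat) (lg (b v)) (T v)) = FTgt (Cmp (One Cat) (lg (a v)) (S v))"
        using ST la lb by auto
    next
      fix x assume "x \<in> Ob (FSrc (Cmp (One Cat) (lg (a v)) (S v)))"
      then have x: "x \<in> Ob (FSrc (S v))" by simp
      show "t v x \<in> hom (FTgt (Cmp (One Cat) (lg (a v)) (S v)))
          (FO (Cmp (One Cat) (lg (a v)) (S v)) x) (FO (Cmp (One Cat) (lg (b v)) (T v)) x)"
        using t[OF v x] x Sob[OF v x] Tob[OF v x] ab ST by (simp add: lg_def)
    next
      fix f x y assume "f \<in> hom (FSrc (Cmp (One Cat) (lg (a v)) (S v))) x y"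
      then have f: "f \<in> hom (FSrc (S v)) x y" by simp
      have "FA (S v) f \<in> Ar (D (a v))" "FA (T v) f \<in> Ar (D (b v))"
        using Shom[OF v f] Thom[OF v f] by (auto simp: hom_iff)
      moreover have "f \<in> Ar (FSrc (S v))" using f by (simp add: hom_iff)
      ultimately show "Cmp (FTgt (Cmp (One Cat) (lg (a v)) (S v))) (t v y) (FA (Cmp (One Cat) (lg (a v)) (S v)) f) =
          Cmp (FTgt (Cmp (One Cat) (lg (a v)) (S v))) (FA (Cmp (One Cat) (lg (b v)) (T v)) f) (t v x)"
        using nat[OF v f] ab ST by (simp add: lg_def)
    qed
    then show ?thesis by simp
  qed
  then show ?thesis
    using lg unfolding precone_def mk_cone_def by (auto simp: hom_One Let_def lg_def)
qed

section \<open>Modifications of precones by components, and postcomposition with cells of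
  \<open>Cat\<close>\<close>

definition modification where
  "modification E c d r \<longleftrightarrow>
     (\<forall>i \<in> Ob J. \<forall>z \<in> Ob (D i). r i z \<in> hom E (FO (leg c i) z) (FO (leg d i) z)) \<and>
     (\<forall>i \<in> Ob J. \<forall>g z z'. g \<in> hom (D i) z z' \<longrightarrow>
        Cmp E (r i z') (FA (leg c i) g) = Cmp E (FA (leg d i) g) (r i z)) \<and>
     (\<forall>v \<in> Ar J. \<forall>x \<in> Ob (FSrc (S v)).
        Cmp E (NC (cel d v) x) (r (a v) (FO (S v) x)) = Cmp E (r (b v) (FO (T v) x)) (NC (cel c v) x))"

lemma modificationD:
  assumes "modification E c d r"
  shows "i \<in> Ob J \<Longrightarrow> z \<in> Ob (D i) \<Longrightarrow> r i z \<in> hom E (FO (leg c i) z) (FO (leg d i) z)"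
    "i \<in> Ob J \<Longrightarrow> g \<in> hom (D i) z z' \<Longrightarrow>
        Cmp E (r i z') (FA (leg c i) g) = Cmp E (FA (leg d i) g) (r i z)"
    "v \<in> Ar J \<Longrightarrow> x \<in> Ob (FSrc (S v)) \<Longrightarrow>
        Cmp E (NC (cel d v) x) (r (a v) (FO (S v) x)) = Cmp E (r (b v) (FO (T v) x)) (NC (cel c v) x)"
  using assms by (auto simp: modification_def)

text \<open>Reindexing components forth and back returns the original family only on the object
  sets, which is all that a modification sees.\<close>

lemma modification_cong:
  assumes eq: "\<And>i z. i \<in> Ob J \<Longrightarrow> z \<in> Ob (D i) \<Longrightarrow> r i z = r' i z"
    and r: "modification E c d r"
  shows "modification E c d r'"
  unfolding modification_def
proof (intro conjI ballI allI impI)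
  fix i z assume "i \<in> Ob J" "z \<in> Ob (D i)"
  then show "r' i z \<in> hom E (FO (leg c i) z) (FO (leg d i) z)"
    using modificationD(1)[OF r, of i z] eq[of i z] by simp
next
  fix i g z z' assume i: "i \<in> Ob J" and g: "g \<in> hom (D i) z z'"
  then show "Cmp E (r' i z') (FA (leg c i) g) = Cmp E (FA (leg d i) g) (r' i z)"
    using modificationD(2)[OF r i g] eq[OF i] hom_ob[OF ext_category_category[OF D[OF i]] g] by simp
next
  fix v x assume v: "v \<in> Ar J" and x: "x \<in> Ob (FSrc (S v))"
  then show "Cmp E (NC (cel d v) x) (r' (a v) (FO (S v) x)) = Cmp E (r' (b v) (FO (T v) x)) (NC (cel c v) x)"
    using modificationD(3)[OF r v x] eq ab Sob Tob by simp
qed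

lemma modification_id:
  assumes "ext_category E" "precone E c"
  shows "modification E c c (\<lambda>i z. Idt E (FO (leg c i) z))"
proof -
  note E = ext_category_category[OF assms(1)]
  show ?thesis
    unfolding modification_def
  proof (intro conjI ballI allI impI)
    fix i g z z' assume i: "i \<in> Ob J" and g: "g \<in> hom (D i) z z'"
    have "FA (leg c i) g \<in> hom E (FO (leg c i) z) (FO (leg c i) z')"
      using functor_hom[OF precone_leg(4)[OF assms(2) i] g] .
    then show "Cmp E (Idt E (FO (leg c i) z')) (FA (leg c i) g) = Cmp E (FA (leg c i) g) (Idt E (FO (leg c i) z))"
      by (simp add: cmp_id[OF E] id_cmp[OF E])
  next
    fix v x assume v: "v \<in> Ar J" and x: "x \<in> Ob (FSrc (S v))"
    show "Cmp E (NC (cel c v) x) (Idt E (FO (leg c (a v)) (FO (S v) x))) =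
          Cmp E (Idt E (FO (leg c (b v)) (FO (T v) x))) (NC (cel c v) x)"
      using precone_cel(6)[OF assms(2) v x] by (simp add: cmp_id[OF E] id_cmp[OF E])
  qed (use assms precone_leg(4) in \<open>blast intro: id_hom[OF E] functor_ob\<close>)
qed

lemma modification_cmp:
  assumes "ext_category E" "precone E c" "precone E d" "precone E e"
    and r: "modification E c d r" and s: "modification E d e s"
  shows "modification E c e (\<lambda>i z. Cmp E (s i z) (r i z))"
proof -
  note E = ext_category_category[OF assms(1)]
  show ?thesis
    unfolding modification_def
  proof (intro conjI ballI allI impI)
    fix i z assume "i \<in> Ob J" "z \<in> Ob (D i)"
    then show "Cmp E (s i z) (r i z) \<in> hom E (FO (leg c i) z) (FO (leg e i) z)"
      using modificationD(1)[OF r] modificationD(1)[OF s] by (blast intro: cmp_hom[OF E])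
  next
    fix i g z z' assume i: "i \<in> Ob J" and g: "g \<in> hom (D i) z z'"
    have z: "z \<in> Ob (D i)" "z' \<in> Ob (D i)" using hom_ob[OF ext_category_category[OF D[OF i]] g] by auto
    show "Cmp E (Cmp E (s i z') (r i z')) (FA (leg c i) g) = Cmp E (FA (leg e i) g) (Cmp E (s i z) (r i z))"
      using functor_hom[OF precone_leg(4)[OF assms(2) i] g] functor_hom[OF precone_leg(4)[OF assms(3) i] g]
        functor_hom[OF precone_leg(4)[OF assms(4) i] g] modificationD(1)[OF r i] modificationD(1)[OF s i] z
        modificationD(2)[OF r i g] modificationD(2)[OF s i g]
      by (intro paste_squares[OF E]) auto
  next
    fix v x assume v: "v \<in> Ar J" and x: "x \<in> Ob (FSrc (S v))"
    note rr = modificationD(1)[OF r ab(1)[OF v] Sob[OF v x]] modificationD(1)[OF r ab(2)[OF v] Tob[OF v x]]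
    note ss = modificationD(1)[OF s ab(1)[OF v] Sob[OF v x]] modificationD(1)[OF s ab(2)[OF v] Tob[OF v x]]
    show "Cmp E (NC (cel e v) x) (Cmp E (s (a v) (FO (S v) x)) (r (a v) (FO (S v) x))) =
        Cmp E (Cmp E (s (b v) (FO (T v) x)) (r (b v) (FO (T v) x))) (NC (cel c v) x)"
      using rr ss precone_cel(6)[OF assms(2) v x] precone_cel(6)[OF assms(3) v x] precone_cel(6)[OF assms(4) v x]
        modificationD(3)[OF r v x] modificationD(3)[OF s v x]
      by (intro paste_squares[OF E, symmetric]) auto
  qed
qed

definition act where
  "act u c = \<lparr>leg = (\<lambda>i \<in> Ob J. Cmp (One Cat) u (leg c i)), cel = (\<lambda>v \<in> Ar J. lwhisk Cat u (cel c v))\<rparr>"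

context
  fixes E :: "'u small_cat" and c :: "('i, 'v, 'u fnc, 'u ntr) cone" and u
  assumes c: "precone E c" and u: "small_functor u" "FSrc u = E"
begin

lemma act_leg: "i \<in> Ob J \<Longrightarrow> leg (act u c) i = Cmp (One Cat) u (leg c i)"
  and act_cel: "v \<in> Ar J \<Longrightarrow> cel (act u c) v = lwhisk Cat u (cel c v)"
  by (simp_all add: act_def)

lemma act_sel:
  "i \<in> Ob J \<Longrightarrow> z \<in> Ob (D i) \<Longrightarrow> FO (leg (act u c) i) z = FO u (FO (leg c i) z)"
  "i \<in> Ob J \<Longrightarrow> h \<in> Ar (D i) \<Longrightarrow> FA (leg (act u c) i) h = FA u (FA (leg c i) h)"
  "v \<in> Ar J \<Longrightarrow> x \<in> Ob (FSrc (S v)) \<Longrightarrow> NC (cel (act u c) v) x = FA u (NC (cel c v) x)"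
  using precone_leg[OF c] precone_cel[OF c] u by (simp_all add: act_leg act_cel lwhisk_Cat)

lemma precone_act: "precone (FTgt u) (act u c)"
  unfolding precone_def
proof (intro conjI ballI)
  fix i assume "i \<in> Ob J"
  then show "leg (act u c) i \<in> hom (One Cat) (D i) (FTgt u)"
    using precone_leg[OF c] u by (auto simp: act_def hom_One intro!: small_functor_Cmp)
next
  fix v assume v: "v \<in> Ar J"
  have "small_transformation (cel (act u c) v)"
    "NSrc (cel (act u c) v) = Cmp (One Cat) u (Cmp (One Cat) (leg c (a v)) (S v))"
    "NTgt (cel (act u c) v) = Cmp (One Cat) u (Cmp (One Cat) (leg c (b v)) (T v))"
    using lwhisk_Cat[OF precone_cel(1)[OF c v] u(1)] precone_cel[OF c v] act_cel v u by auto
  moreover have "Cmp (One Cat) (leg (act u c) (a v)) (S v) = Cmp (One Cat) u (Cmp (One Cat) (leg c (a v)) (S v))"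
    "Cmp (One Cat) (leg (act u c) (b v)) (T v) = Cmp (One Cat) u (Cmp (One Cat) (leg c (b v)) (T v))"
    using precone_leg[OF c] ab v act_leg u S T by (auto intro!: Cmp_One_assoc)
  ultimately show "cel (act u c) v \<in>
      hom (Two Cat) (Cmp (One Cat) (leg (act u c) (a v)) (S v)) (Cmp (One Cat) (leg (act u c) (b v)) (T v))"
    by (simp add: hom_Two)
qed (simp_all add: act_def)

end

text \<open>The components are those of the horizontal composite of \<open>\<alpha>\<close> with
  \<open>r\<close>. Each square pastes the image under \<open>NSrc \<alpha>\<close> of a square for
  \<open>r\<close> with a naturality square of \<open>\<alpha>\<close>.\<close>

lemma modification_act:
  assumes c: "precone E c" and d: "precone E d" and r: "modification E c d r"
    and \<alpha>: "small_transformation \<alpha>" "FSrc (NSrc \<alpha>) = E"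
  shows "modification (FTgt (NSrc \<alpha>)) (act (NSrc \<alpha>) c) (act (NTgt \<alpha>) d)
    (\<lambda>i z. Cmp (FTgt (NSrc \<alpha>)) (NC \<alpha> (FO (leg d i) z)) (FA (NSrc \<alpha>) (r i z)))"
proof -
  let ?u = "NSrc \<alpha>" and ?v = "NTgt \<alpha>" and ?E = "FTgt (NSrc \<alpha>)"
  note a = small_transformationD[OF \<alpha>(1)]
  have u: "small_functor ?u" "FSrc ?u = E" and v: "small_functor ?v" "FSrc ?v = E"
    using a \<alpha> by auto
  note U = small_functorD(7)[OF u(1), unfolded u(2)] and V = small_functorD(7)[OF v(1), unfolded v(2) a(4)]
  have E: "category ?E" using a(1) small_functorD by blast
  note n = a(6,7)[unfolded \<alpha>(2)]
  have H: "FO (leg c i) z \<in> Ob E" "FO (leg d i) z \<in> Ob E" if "i \<in> Ob J" "z \<in> Ob (D i)" for i z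
    using precone_leg(4)[OF c that(1)] precone_leg(4)[OF d that(1)] that(2) by (blast intro: functor_ob)+
  show ?thesis
    unfolding modification_def
  proof (intro conjI ballI allI impI)
    fix i z assume i: "i \<in> Ob J" "z \<in> Ob (D i)"
    have "Cmp ?E (NC \<alpha> (FO (leg d i) z)) (FA ?u (r i z)) \<in> hom ?E (FO ?u (FO (leg c i) z)) (FO ?v (FO (leg d i) z))"
      using functor_hom[OF U modificationD(1)[OF r i]] n(1)[OF H(2)[OF i]] by (rule cmp_hom[OF E])
    then show "Cmp ?E (NC \<alpha> (FO (leg d i) z)) (FA ?u (r i z)) \<in>
        hom ?E (FO (leg (act ?u c) i) z) (FO (leg (act ?v d) i) z)"
      by (simp add: act_sel[OF c u] act_sel[OF d v] i)
  next
    fix i g z z' assume i: "i \<in> Ob J" and g: "g \<in> hom (D i) z z'"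
    have z: "z \<in> Ob (D i)" "z' \<in> Ob (D i)" "g \<in> Ar (D i)"
      using hom_ob[OF ext_category_category[OF D[OF i]] g] g by (auto simp: hom_iff)
    note C = functor_hom[OF precone_leg(4)[OF c i] g] and D' = functor_hom[OF precone_leg(4)[OF d i] g]
    note r1 = modificationD(1)[OF r i z(1)] and r2 = modificationD(1)[OF r i z(2)]
    have "Cmp ?E (FA ?u (r i z')) (FA ?u (FA (leg c i) g)) = Cmp ?E (FA ?u (FA (leg d i) g)) (FA ?u (r i z))"
      using functor_cmp[OF U C r2] functor_cmp[OF U r1 D'] modificationD(2)[OF r i g] by simp
    then have "Cmp ?E (Cmp ?E (NC \<alpha> (FO (leg d i) z')) (FA ?u (r i z'))) (FA ?u (FA (leg c i) g)) =
        Cmp ?E (FA ?v (FA (leg d i) g)) (Cmp ?E (NC \<alpha> (FO (leg d i) z)) (FA ?u (r i z)))"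
      using n(2)[OF D'] functor_hom[OF U C] functor_hom[OF U D'] functor_hom[OF V D']
        functor_hom[OF U r1] functor_hom[OF U r2] n(1)[OF H(2)[OF i z(1)]] n(1)[OF H(2)[OF i z(2)]]
      by (intro paste_squares[OF E]) auto
    then show "Cmp ?E (Cmp ?E (NC \<alpha> (FO (leg d i) z')) (FA ?u (r i z'))) (FA (leg (act ?u c) i) g) =
        Cmp ?E (FA (leg (act ?v d) i) g) (Cmp ?E (NC \<alpha> (FO (leg d i) z)) (FA ?u (r i z)))"
      by (simp add: act_sel[OF c u] act_sel[OF d v] i z)
  next
    fix w x assume w: "w \<in> Ar J" and x: "x \<in> Ob (FSrc (S w))"
    let ?s = "FO (S w) x" and ?t = "FO (T w) x"
    note ia = ab(1)[OF w] Sob[OF w x] and ib = ab(2)[OF w] Tob[OF w x]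
    note ra = modificationD(1)[OF r ia] and rb = modificationD(1)[OF r ib]
    note cc = precone_cel(6)[OF c w x] and cd = precone_cel(6)[OF d w x]
    have "Cmp ?E (FA ?u (r (b w) ?t)) (FA ?u (NC (cel c w) x)) = Cmp ?E (FA ?u (NC (cel d w) x)) (FA ?u (r (a w) ?s))"
      using functor_cmp[OF U cc rb] functor_cmp[OF U ra cd] modificationD(3)[OF r w x] by simp
    then have "Cmp ?E (Cmp ?E (NC \<alpha> (FO (leg d (b w)) ?t)) (FA ?u (r (b w) ?t))) (FA ?u (NC (cel c w) x)) =
      Cmp ?E (FA ?v (NC (cel d w) x)) (Cmp ?E (NC \<alpha> (FO (leg d (a w)) ?s)) (FA ?u (r (a w) ?s)))"
      using n(2)[OF cd] functor_hom[OF U cc] functor_hom[OF U cd] functor_hom[OF V cd]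
        functor_hom[OF U ra] functor_hom[OF U rb] n(1)[OF H(2)[OF ia]] n(1)[OF H(2)[OF ib]]
      by (intro paste_squares[OF E]) auto
    then show "Cmp ?E (NC (cel (act ?v d) w) x) (Cmp ?E (NC \<alpha> (FO (leg d (a w)) ?s)) (FA ?u (r (a w) ?s))) =
        Cmp ?E (Cmp ?E (NC \<alpha> (FO (leg d (b w)) ?t)) (FA ?u (r (b w) ?t))) (NC (cel (act ?u c) w) x)"
      by (simp add: act_sel[OF c u] act_sel[OF d v] w x)
  qed
qed

text \<open>Both sides are parallel 2-cells, so their equality is componentwise, and whiskering on
  the right only evaluates \<open>\<rho>\<close> at \<open>FO (S v) x\<close> or
  \<open>FO (T v) x\<close>.\<close>

lemma modification_compat_iff:
  assumes c: "precone E c" and d: "precone E d"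
    and \<rho>: "\<And>i. i \<in> Ob J \<Longrightarrow> \<rho> i \<in> hom (Two Cat) (leg c i) (leg d i)" and v: "v \<in> Ar J"
  shows "Cmp (Two Cat) (cel d v) (rwhisk Cat (\<rho> (a v)) (S v)) = Cmp (Two Cat) (rwhisk Cat (\<rho> (b v)) (T v)) (cel c v)
    \<longleftrightarrow> (\<forall>x \<in> Ob (FSrc (S v)).
        Cmp E (NC (cel d v) x) (NC (\<rho> (a v)) (FO (S v) x)) = Cmp E (NC (\<rho> (b v)) (FO (T v) x)) (NC (cel c v) x))"
    (is "?L = ?R \<longleftrightarrow> _")
proof -
  have a: "small_transformation (\<rho> (a v))" "NSrc (\<rho> (a v)) = leg c (a v)" "NTgt (\<rho> (a v)) = leg d (a v)"
    and b: "small_transformation (\<rho> (b v))" "NSrc (\<rho> (b v)) = leg c (b v)" "NTgt (\<rho> (b v)) = leg d (b v)"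
    using \<rho> ab[OF v] by (auto simp: hom_Two)
  have la: "FSrc (leg c (a v)) = D (a v)" "FTgt (leg c (a v)) = E"
     "FSrc (leg c (b v)) = D (b v)" "FTgt (leg c (b v)) = E"
    using precone_leg[OF c] ab[OF v] by auto
  note wa = rwhisk_Cat[OF a(1) S(1)[OF v], unfolded a la, OF S(2)[OF v]]
  note wb = rwhisk_Cat[OF b(1) T(1)[OF v], unfolded b la ST[OF v], OF T(2)[OF v]]
  note cc = precone_cel[OF c v] and cd = precone_cel[OF d v]
  have "?L = ?R" if "\<forall>x \<in> Ob (FSrc (S v)). NC ?L x = NC ?R x"
  proof (rule ntr_eqI)
    show "small_transformation ?L" "small_transformation ?R"
      using wa wb cc cd by (auto intro!: small_transformation_Cmp)
  qed (use wa wb cc cd that in simp_all)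
  then have "?L = ?R \<longleftrightarrow> (\<forall>x \<in> Ob (FSrc (S v)). NC ?L x = NC ?R x)"
    by metis
  then show ?thesis
    using wa(2,4) wb(2,4) cc(2,4,5) la by simp
qed

end

text \<open>\<open>Sx\<close> and \<open>Rx\<close> are the parameters of \<open>cones\<close>. The
  assumptions split membership in \<open>Sx\<close> into typing and a remaining property
  \<open>X\<close>, and express \<open>Rx\<close> by components; nothing else about the kind of cone
  is visible in this locale.\<close>

locale cone_category = cone_shape J D S T a b
  for J :: "('i, 'v) cat" and D :: "'i \<Rightarrow> 'u small_cat"
    and S T :: "'v \<Rightarrow> 'u fnc" and a b :: "'v \<Rightarrow> 'i" +
  fixes Sx :: "'u small_cat \<Rightarrow> ('i, 'v, 'u fnc, 'u ntr) cone set"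
    and Rx :: "('i, 'v, 'u fnc, 'u ntr) cone \<Rightarrow> ('i, 'v, 'u fnc, 'u ntr) cone \<Rightarrow> ('i \<Rightarrow> 'u ntr) \<Rightarrow> bool"
    and X :: "'u small_cat \<Rightarrow> ('i, 'v, 'u fnc, 'u ntr) cone \<Rightarrow> bool"
  assumes Sx: "ext_category E \<Longrightarrow> c \<in> Sx E \<longleftrightarrow> precone E c \<and> X E c"
    and Rx: "ext_category E \<Longrightarrow> precone E c \<Longrightarrow> precone E d \<Longrightarrow>
      (\<And>i. i \<in> Ob J \<Longrightarrow> \<rho> i \<in> hom (Two Cat) (leg c i) (leg d i)) \<Longrightarrow>
      Rx c d \<rho> \<longleftrightarrow> (\<forall>v \<in> Ar J. \<forall>x \<in> Ob (FSrc (S v)).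
        Cmp E (NC (cel d v) x) (NC (\<rho> (a v)) (FO (S v) x)) = Cmp E (NC (\<rho> (b v)) (FO (T v) x)) (NC (cel c v) x))"
begin

abbreviation U where "U \<equiv> cones Cat J Sx Rx"

definition mk_modif where
  "mk_modif c d r = \<lparr>MSrc = c, MTgt = d,
     MC = (\<lambda>i \<in> Ob J. \<lparr>NSrc = leg c i, NTgt = leg d i, NC = restrict (r i) (Ob (D i))\<rparr>)\<rparr>"

lemma mk_modif_sel [simp]:
  "MSrc (mk_modif c d r) = c" "MTgt (mk_modif c d r) = d"
  "i \<in> Ob J \<Longrightarrow> z \<in> Ob (D i) \<Longrightarrow> NC (MC (mk_modif c d r) i) z = r i z"
  by (simp_all add: mk_modif_def)

lemma mk_modif_cong:
  "(\<And>i z. i \<in> Ob J \<Longrightarrow> z \<in> Ob (D i) \<Longrightarrow> r i z = r' i z) \<Longrightarrow> mk_modif c d r = mk_modif c d r'"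
  by (auto simp: mk_modif_def intro!: restrict_ext)

lemma U_sel [simp]:
  "Ob (Val U E) = Sx E" "Dm (Val U E) = MSrc" "Cd (Val U E) = MTgt" "Act1 U u c = act u c"
  by (simp_all add: cones_def Let_def act_def)

lemma mem_Sx: "ext_category E \<Longrightarrow> c \<in> Sx E \<Longrightarrow> precone E c"
  by (simp add: Sx)

text \<open>Arrows between cones are exactly the families of raw components that form a
  modification, so all later arguments about them can use functions instead of records of
  2-cells.\<close>

lemma mem_Ar_iff:
  assumes E: "ext_category E"
  shows "m \<in> Ar (Val U E) \<longleftrightarrow> (\<exists>c d r. c \<in> Sx E \<and> d \<in> Sx E \<and> modification E c d r \<and> m = mk_modif c d r)"
    (is "_ = ?R")
proof
  assume m: "m \<in> Ar (Val U E)"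
  let ?c = "MSrc m" and ?d = "MTgt m" and ?r = "\<lambda>i. NC (MC m i)"
  have cd: "?c \<in> Sx E" "?d \<in> Sx E" "MC m \<in> extensional (Ob J)"
    and h: "\<And>i. i \<in> Ob J \<Longrightarrow> MC m i \<in> hom (Two Cat) (leg ?c i) (leg ?d i)" and R: "Rx ?c ?d (MC m)"
    using m by (auto simp: cones_def Let_def)
  note c = mem_Sx[OF E cd(1)] and d = mem_Sx[OF E cd(2)]
  have "modification E ?c ?d ?r"
    unfolding modification_def
  proof (intro conjI)
    show "\<forall>i \<in> Ob J. \<forall>z \<in> Ob (D i). ?r i z \<in> hom E (FO (leg ?c i) z) (FO (leg ?d i) z)"
      using hom_TwoD(1)[OF h] precone_leg[OF c] by metis
    show "\<forall>i \<in> Ob J. \<forall>g z z'. g \<in> hom (D i) z z' \<longrightarrow>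
        Cmp E (?r i z') (FA (leg ?c i) g) = Cmp E (FA (leg ?d i) g) (?r i z)"
      using hom_TwoD(2)[OF h] precone_leg[OF c] by metis
    show "\<forall>v \<in> Ar J. \<forall>x \<in> Ob (FSrc (S v)).
        Cmp E (NC (cel ?d v) x) (?r (a v) (FO (S v) x)) = Cmp E (?r (b v) (FO (T v) x)) (NC (cel ?c v) x)"
      using R Rx[OF E c d h] by blast
  qed
  \<comment> \<open>A transformation is extensional on the objects of its source, hence is recovered
    from its components restricted to \<open>Ob (D i)\<close>.\<close>
  moreover have "MC m i = \<lparr>NSrc = leg ?c i, NTgt = leg ?d i, NC = restrict (?r i) (Ob (D i))\<rparr>" if "i \<in> Ob J" for i
    using h[OF that] small_transformationD(5)[of "MC m i"] precone_leg(2)[OF c that]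
    by (intro ntr.equality) (auto simp: hom_Two extensional_restrict)
  then have "MC m = MC (mk_modif ?c ?d ?r)"
    using cd(3) by (intro extensionalityI[where A = "Ob J"]) (auto simp: mk_modif_def)
  then have "m = mk_modif ?c ?d ?r"
    by (intro modif.equality) auto
  ultimately show ?R using cd by blast
next
  assume ?R
  then obtain c d r where cd: "c \<in> Sx E" "d \<in> Sx E" and r: "modification E c d r" and m: "m = mk_modif c d r"
    by blast
  note c = mem_Sx[OF E cd(1)] and d = mem_Sx[OF E cd(2)]
  have h: "MC m i \<in> hom (Two Cat) (leg c i) (leg d i)" if i: "i \<in> Ob J" for i
    using hom_TwoI[OF precone_leg(1)[OF c i] precone_leg(1)[OF d i], of "r i"]
      precone_leg[OF c i] precone_leg[OF d i] modificationD(1,2)[OF r i] i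
    by (simp add: m mk_modif_def)
  have "Rx c d (MC m)"
    using Rx[OF E c d h] modificationD(3)[OF r] ab Sob Tob m by simp
  then show "m \<in> Ar (Val U E)"
    using h cd m by (auto simp: cones_def Let_def) (auto simp: mk_modif_def)
qed

lemma mk_modif_in_Ar:
  "ext_category E \<Longrightarrow> c \<in> Sx E \<Longrightarrow> d \<in> Sx E \<Longrightarrow> modification E c d r \<Longrightarrow> mk_modif c d r \<in> Ar (Val U E)"
  using mem_Ar_iff by blast

lemma Idt_U:
  assumes "ext_category E" "c \<in> Sx E"
  shows "Idt (Val U E) c = mk_modif c c (\<lambda>i z. Idt E (FO (leg c i) z))"
  using precone_leg[OF mem_Sx[OF assms]]
  by (auto simp: cones_def Let_def mk_modif_def Cat_def intro!: restrict_ext)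

lemma Cmp_U:
  assumes "ext_category E" "c \<in> Sx E"
  shows "Cmp (Val U E) (mk_modif d e s) (mk_modif c d' r) = mk_modif c e (\<lambda>i z. Cmp E (s i z) (r i z))"
  using precone_leg[OF mem_Sx[OF assms]]
  by (auto simp: cones_def Let_def mk_modif_def Cat_def intro!: restrict_ext)

lemma Act2_U:
  assumes "small_transformation \<alpha>" "ext_category E" "E = FSrc (NSrc \<alpha>)" "c \<in> Sx E" "d \<in> Sx E"
  shows "Act2 U \<alpha> (mk_modif c d r) = mk_modif (act (NSrc \<alpha>) c) (act (NTgt \<alpha>) d)
    (\<lambda>i z. Cmp (FTgt (NSrc \<alpha>)) (NC \<alpha> (FO (leg d i) z)) (FA (NSrc \<alpha>) (r i z)))"
proof -
  note c = precone_leg[OF mem_Sx[OF assms(2,4)]] and d = precone_leg[OF mem_Sx[OF assms(2,5)]]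
  have "HCmp Cat \<alpha> \<lparr>NSrc = leg c i, NTgt = leg d i, NC = restrict (r i) (Ob (D i))\<rparr> =
    \<lparr>NSrc = leg (act (NSrc \<alpha>) c) i, NTgt = leg (act (NTgt \<alpha>) d) i,
     NC = restrict (\<lambda>z. Cmp (FTgt (NSrc \<alpha>)) (NC \<alpha> (FO (leg d i) z)) (FA (NSrc \<alpha>) (r i z))) (Ob (D i))\<rparr>"
    if i: "i \<in> Ob J" for i
    using c[OF i] d[OF i] i small_transformationD(3,4)[OF assms(1)]
    by (intro ntr.equality fnc.equality) (auto simp: act_def intro!: fnc.equality restrict_ext)
  then show ?thesis
    by (auto simp: cones_def Let_def mk_modif_def intro!: restrict_ext) (simp_all add: act_def)
qed

text \<open>Identities, composites and whiskerings of modifications are modifications whatever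
  \<open>X\<close> is; \<open>X\<close> enters through its stability under postcomposition.\<close>

lemma closed_U:
  assumes X: "\<And>c u. small_functor u \<Longrightarrow> precone (FSrc u) c \<Longrightarrow> X (FSrc u) c \<Longrightarrow> X (FTgt u) (act u c)"
  shows "closed_cone_functor Cat U"
proof -
  have A: "act u c \<in> Sx (FTgt u)" if "small_functor u" "c \<in> Sx (FSrc u)" for u c
    using that X precone_act Sx small_functorD(1,2)[OF that(1)] by auto
  have "closed_cat (Val U E)" if E: "ext_category E" for E
    unfolding closed_cat_def
  proof (intro conjI ballI impI)
    fix c assume "c \<in> Ob (Val U E)"
    then show "Idt (Val U E) c \<in> hom (Val U E) c c"
      using mk_modif_in_Ar[OF E] modification_id[OF E] mem_Sx[OF E] by (simp add: Idt_U[OF E] hom_iff)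
  next
    fix m assume "m \<in> Ar (Val U E)"
    then show "Dm (Val U E) m \<in> Ob (Val U E)" "Cd (Val U E) m \<in> Ob (Val U E)"
      by (auto simp: mem_Ar_iff[OF E])
  next
    fix m n assume "m \<in> Ar (Val U E)" "n \<in> Ar (Val U E)" "Dm (Val U E) n = Cd (Val U E) m"
    then obtain c d e r s where "c \<in> Sx E" "d \<in> Sx E" "e \<in> Sx E" "modification E c d r" "modification E d e s"
      and mn: "m = mk_modif c d r" "n = mk_modif d e s"
      by (auto simp: mem_Ar_iff[OF E])
    then have "mk_modif c e (\<lambda>i z. Cmp E (s i z) (r i z)) \<in> Ar (Val U E)"
      by (intro mk_modif_in_Ar[OF E] modification_cmp[OF E] mem_Sx[OF E])
    then show "Cmp (Val U E) n m \<in> hom (Val U E) (Dm (Val U E) m) (Cd (Val U E) n)"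
      using \<open>c \<in> Sx E\<close> by (simp add: mn Cmp_U[OF E] hom_iff)
  qed
  moreover have "Act2 U \<alpha> \<rho> \<in> Ar (Val U (FTgt (NSrc \<alpha>)))"
    if \<alpha>: "small_transformation \<alpha>" and \<rho>: "\<rho> \<in> Ar (Val U (FSrc (NSrc \<alpha>)))" for \<alpha> \<rho>
  proof -
    note a = small_transformationD[OF \<alpha>] note E = small_functorD(1,2)[OF a(1)]
    obtain c d r where r: "c \<in> Sx (FSrc (NSrc \<alpha>))" "d \<in> Sx (FSrc (NSrc \<alpha>))"
      "modification (FSrc (NSrc \<alpha>)) c d r" "\<rho> = mk_modif c d r"
      using \<rho> mem_Ar_iff[OF E(1)] by blast
    show ?thesis
      unfolding r(4) Act2_U[OF \<alpha> E(1) refl r(1,2)]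
      using A[OF a(1) r(1)] A[OF a(2), of d] r a(3,4) mem_Sx[OF E(1)]
      by (intro mk_modif_in_Ar[OF E(2)] modification_act \<alpha>) auto
  qed
  ultimately show ?thesis
    unfolding closed_cone_functor_def using A by simp
qed

end

text \<open>If the disjoint unions of the object sets \<open>Ob (D i)\<close> and \<open>Ob (D' j)\<close> correspond under
  \<open>(j, z) \<mapsto> (h j, k j z)\<close>, families of components are reindexed along this bijection; then only
  the correspondence \<open>\<Phi>\<close> on objects depends on the two kinds of cones.\<close>

locale cone_reindexing =
  U: cone_category J D S T a b Sx Rx X + V: cone_category J' D' S' T' a' b' Sx' Rx' X'
  for J :: "('i, 'v) cat" and D :: "'i \<Rightarrow> 'u small_cat"
    and S T :: "'v \<Rightarrow> 'u fnc" and a b :: "'v \<Rightarrow> 'i" and Sx Rx X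
    and J' :: "('j, 'w) cat" and D' :: "'j \<Rightarrow> 'u small_cat"
    and S' T' :: "'w \<Rightarrow> 'u fnc" and a' b' :: "'w \<Rightarrow> 'j" and Sx' Rx' X' +
  fixes h :: "'j \<Rightarrow> 'i" and k :: "'j \<Rightarrow> 'u \<Rightarrow> 'u" and hi :: "'i \<Rightarrow> 'u \<Rightarrow> 'j" and ki :: "'i \<Rightarrow> 'u \<Rightarrow> 'u"
    and \<Phi> :: "'u small_cat \<Rightarrow> ('i, 'v, 'u fnc, 'u ntr) cone \<Rightarrow> ('j, 'w, 'u fnc, 'u ntr) cone"
  assumes hk: "j \<in> Ob J' \<Longrightarrow> h j \<in> Ob J" "j \<in> Ob J' \<Longrightarrow> z \<in> Ob (D' j) \<Longrightarrow> k j z \<in> Ob (D (h j))"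
      "j \<in> Ob J' \<Longrightarrow> z \<in> Ob (D' j) \<Longrightarrow> hi (h j) (k j z) = j"
      "j \<in> Ob J' \<Longrightarrow> z \<in> Ob (D' j) \<Longrightarrow> ki (h j) (k j z) = z"
    and hki: "i \<in> Ob J \<Longrightarrow> z \<in> Ob (D i) \<Longrightarrow> hi i z \<in> Ob J'"
      "i \<in> Ob J \<Longrightarrow> z \<in> Ob (D i) \<Longrightarrow> ki i z \<in> Ob (D' (hi i z))"
      "i \<in> Ob J \<Longrightarrow> z \<in> Ob (D i) \<Longrightarrow> h (hi i z) = i"
      "i \<in> Ob J \<Longrightarrow> z \<in> Ob (D i) \<Longrightarrow> k (hi i z) (ki i z) = z"
    and bij: "ext_category E \<Longrightarrow> bij_betw (\<Phi> E) (Sx E) (Sx' E)"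
    and leg: "ext_category E \<Longrightarrow> c \<in> Sx E \<Longrightarrow> j \<in> Ob J' \<Longrightarrow> z \<in> Ob (D' j) \<Longrightarrow>
      FO (leg (\<Phi> E c) j) z = FO (leg c (h j)) (k j z)"
    and modif: "ext_category E \<Longrightarrow> c \<in> Sx E \<Longrightarrow> d \<in> Sx E \<Longrightarrow>
      U.modification E c d r \<longleftrightarrow> V.modification E (\<Phi> E c) (\<Phi> E d) (\<lambda>j z. r (h j) (k j z))"
    and act: "small_functor u \<Longrightarrow> c \<in> Sx (FSrc u) \<Longrightarrow> \<Phi> (FTgt u) (U.act u c) = V.act u (\<Phi> (FSrc u) c)"
    and X_act: "small_functor u \<Longrightarrow> U.precone (FSrc u) c \<Longrightarrow> X (FSrc u) c \<Longrightarrow> X (FTgt u) (U.act u c)"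
begin

definition \<Phi>a where
  "\<Phi>a E m = V.mk_modif (\<Phi> E (MSrc m)) (\<Phi> E (MTgt m)) (\<lambda>j z. NC (MC m (h j)) (k j z))"

lemma \<Phi>a_mk_modif:
  "\<Phi>a E (U.mk_modif c d r) = V.mk_modif (\<Phi> E c) (\<Phi> E d) (\<lambda>j z. r (h j) (k j z))"
  by (auto simp: \<Phi>a_def hk intro!: V.mk_modif_cong)

lemma \<Phi>_mem: "ext_category E \<Longrightarrow> c \<in> Sx E \<Longrightarrow> \<Phi> E c \<in> Sx' E"
  by (rule bij_betw_apply[OF bij])

lemma is_functor_\<Phi>:
  assumes E: "ext_category E"
  shows "is_functor (Val U.U E) (Val V.U E) (\<Phi> E) (\<Phi>a E)"
  unfolding is_functor_def
proof (intro conjI ballI impI)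
  fix c assume "c \<in> Ob (Val U.U E)"
  then have c: "c \<in> Sx E" by simp
  then show "\<Phi> E c \<in> Ob (Val V.U E)" using \<Phi>_mem[OF E] by simp
  show "\<Phi>a E (Idt (Val U.U E) c) = Idt (Val V.U E) (\<Phi> E c)"
    using leg[OF E c] by (auto simp: U.Idt_U[OF E c] V.Idt_U[OF E \<Phi>_mem[OF E c]] \<Phi>a_mk_modif intro!: V.mk_modif_cong)
next
  fix m assume "m \<in> Ar (Val U.U E)"
  then show "\<Phi>a E m \<in> hom (Val V.U E) (\<Phi> E (Dm (Val U.U E) m)) (\<Phi> E (Cd (Val U.U E) m))"
    using V.mk_modif_in_Ar[OF E \<Phi>_mem[OF E] \<Phi>_mem[OF E]] modif[OF E]
    by (auto simp: U.mem_Ar_iff[OF E] hom_iff \<Phi>a_mk_modif)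
next
  fix m n assume "m \<in> Ar (Val U.U E)" "n \<in> Ar (Val U.U E)"
  then show "\<Phi>a E (Cmp (Val U.U E) n m) = Cmp (Val V.U E) (\<Phi>a E n) (\<Phi>a E m)"
    using \<Phi>_mem[OF E] by (auto simp: U.mem_Ar_iff[OF E] U.Cmp_U[OF E] V.Cmp_U[OF E] \<Phi>a_mk_modif)
qed

text \<open>The component at \<open>(i, z)\<close> is read off at \<open>(hi i z, ki i z)\<close>,
  which gives injectivity; the same formula defines a preimage.\<close>

lemma bij_betw_\<Phi>a:
  assumes E: "ext_category E"
  shows "bij_betw (\<Phi>a E) (Ar (Val U.U E)) (Ar (Val V.U E))"
  unfolding bij_betw_def
proof
  show "inj_on (\<Phi>a E) (Ar (Val U.U E))"
  proof (rule inj_onI)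
    fix m n assume m: "m \<in> Ar (Val U.U E)" and n: "n \<in> Ar (Val U.U E)" and eq: "\<Phi>a E m = \<Phi>a E n"
    obtain c d r where m': "c \<in> Sx E" "d \<in> Sx E" "m = U.mk_modif c d r"
      using m U.mem_Ar_iff[OF E] by blast
    obtain c' d' r' where n': "c' \<in> Sx E" "d' \<in> Sx E" "n = U.mk_modif c' d' r'"
      using n U.mem_Ar_iff[OF E] by blast
    have "\<Phi> E c = \<Phi> E c'" "\<Phi> E d = \<Phi> E d'"
      using arg_cong[OF eq, of MSrc] arg_cong[OF eq, of MTgt] by (simp_all add: m' n' \<Phi>a_mk_modif)
    then have "c = c'" "d = d'"
      using bij[OF E] m' n' by (auto simp: bij_betw_def inj_on_def)
    moreover have "r i z = r' i z" if i: "i \<in> Ob J" "z \<in> Ob (D i)" for i z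
    proof -
      have "NC (MC (\<Phi>a E m) (hi i z)) (ki i z) = NC (MC (\<Phi>a E n) (hi i z)) (ki i z)"
        using eq by simp
      then show ?thesis
        using hki i by (simp add: m' n' \<Phi>a_mk_modif)
    qed
    ultimately show "m = n"
      unfolding m' n' using U.mk_modif_cong by blast
  qed
  show "\<Phi>a E ` Ar (Val U.U E) = Ar (Val V.U E)"
  proof
    show "\<Phi>a E ` Ar (Val U.U E) \<subseteq> Ar (Val V.U E)"
      using is_functor_\<Phi>[OF E] by (auto simp: is_functor_def hom_def)
    show "Ar (Val V.U E) \<subseteq> \<Phi>a E ` Ar (Val U.U E)"
    proof
      fix n assume "n \<in> Ar (Val V.U E)"
      then obtain c' d' s where n: "c' \<in> Sx' E" "d' \<in> Sx' E" "V.modification E c' d' s" "n = V.mk_modif c' d' s"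
        using V.mem_Ar_iff[OF E] by blast
      obtain c d where cd: "c \<in> Sx E" "d \<in> Sx E" "c' = \<Phi> E c" "d' = \<Phi> E d"
        using n(1,2) unfolding bij_betw_imp_surj_on[OF bij[OF E], symmetric] by blast
      \<comment> \<open>The components are pulled back along the inverse bijection. Pushed forward
        again they equal \<open>s\<close> on object sets, and the equivalence \<open>modif\<close>
        carries the modification property back to \<open>U\<close>.\<close>
      let ?r = "\<lambda>i z. s (hi i z) (ki i z)"
      have "V.modification E c' d' (\<lambda>j z. ?r (h j) (k j z))"
        by (rule V.modification_cong[OF _ n(3)]) (simp add: hk)
      then have "U.modification E c d ?r"
        using modif[OF E cd(1,2)] cd by simp
      then have "U.mk_modif c d ?r \<in> Ar (Val U.U E)"
        using U.mk_modif_in_Ar[OF E] cd by blast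
      moreover have "\<Phi>a E (U.mk_modif c d ?r) = n"
        unfolding n(4) cd(3,4) \<Phi>a_mk_modif by (rule V.mk_modif_cong) (simp add: hk)
      ultimately show "n \<in> \<Phi>a E ` Ar (Val U.U E)" by blast
    qed
  qed
qed

lemma closed_U: "closed_cone_functor Cat U.U"
  using X_act by (rule U.closed_U)

lemma natural_isomorphism_\<Phi>: "natural_isomorphism Cat U.U V.U \<Phi> \<Phi>a"
  unfolding natural_isomorphism_def
proof (intro conjI ballI)
  fix E :: "'u small_cat" assume "E \<in> Ob (One Cat)"
  then have E: "ext_category E" by simp
  show "is_iso_functor (Val U.U E) (Val V.U E) (\<Phi> E) (\<Phi>a E)"
  proof (rule is_iso_functorI)
    show "closed_cat (Val U.U E)"
      using closed_cone_functorD[OF closed_U] E by simp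
  qed (use is_functor_\<Phi>[OF E] bij_betw_\<Phi>a[OF E] bij[OF E] in simp_all)
next
  fix u \<xi> assume "u \<in> Ar (One Cat)" "\<xi> \<in> Ob (Val U.U (Dm (One Cat) u))"
  then show "\<Phi> (Cd (One Cat) u) (Act1 U.U u \<xi>) = Act1 V.U u (\<Phi> (Dm (One Cat) u) \<xi>)"
    using act by simp
next
  fix \<alpha> \<rho> assume "\<alpha> \<in> Ar (Two Cat)" and "\<rho> \<in> Ar (Val U.U (dm0 Cat \<alpha>))"
  then have \<alpha>: "small_transformation \<alpha>" and \<rho>: "\<rho> \<in> Ar (Val U.U (FSrc (NSrc \<alpha>)))" by simp_all
  note t = small_transformationD[OF \<alpha>]
  note E = small_functorD(1,2)[OF t(1)]
  obtain c d r where r: "c \<in> Sx (FSrc (NSrc \<alpha>))" "d \<in> Sx (FSrc (NSrc \<alpha>))" "\<rho> = U.mk_modif c d r"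
    using \<rho> U.mem_Ar_iff[OF E(1)] by blast
  show "\<Phi>a (cd0 Cat \<alpha>) (Act2 U.U \<alpha> \<rho>) = Act2 V.U \<alpha> (\<Phi>a (dm0 Cat \<alpha>) \<rho>)"
    using act[OF t(1) r(1)] act[OF t(2), of d] r t(3,4) leg[OF E(1) r(2)] \<Phi>_mem[OF E(1)]
    by (auto simp: U.Act2_U[OF \<alpha> E(1) refl r(1,2)] V.Act2_U[OF \<alpha> E(1) refl] \<Phi>a_mk_modif
        intro!: V.mk_modif_cong)
qed

lemma equivalent_UV:
  "equivalent_universal_properties Cat U.U V.U" "equivalent_universal_properties Cat V.U U.U"
  using equivalent_universal_propertiesI[OF closed_U natural_isomorphism_\<Phi> category_Cat _ closed_cat_Hom_Cat]
  by simp_all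

end

section \<open>Products in \<open>Cat\<close>\<close>

text \<open>Pointwise inverses of a natural transformation are automatically natural. This lets the
  invertibility conditions on cells of cones be stated and checked inside \<open>E\<close>.\<close>

lemma invertible_Two_iff:
  assumes \<alpha>: "small_transformation \<alpha>"
  shows "invertible (Two Cat) \<alpha> \<longleftrightarrow> (\<forall>x \<in> Ob (FSrc (NSrc \<alpha>)). invertible (FTgt (NSrc \<alpha>)) (NC \<alpha> x))"
proof -
  note a = small_transformationD[OF \<alpha>]
  let ?F = "NSrc \<alpha>" and ?G = "NTgt \<alpha>" and ?C = "FSrc (NSrc \<alpha>)" and ?E = "FTgt (NSrc \<alpha>)"
  have C: "category ?C" and E: "category ?E" using a(1) small_functorD by blast+
  show ?thesis
  proof
    assume "invertible (Two Cat) \<alpha>"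
    then obtain \<beta> where \<beta>: "small_transformation \<beta>" "NSrc \<beta> = ?G" "NTgt \<beta> = ?F"
      and e: "Cmp (Two Cat) \<beta> \<alpha> = Idt (Two Cat) ?F" "Cmp (Two Cat) \<alpha> \<beta> = Idt (Two Cat) ?G"
      by (auto simp: invertible_def hom_Two)
    show "\<forall>x \<in> Ob ?C. invertible ?E (NC \<alpha> x)"
    proof
      fix x assume x: "x \<in> Ob ?C"
      have "Cmp ?E (NC \<beta> x) (NC \<alpha> x) = Idt ?E (FO ?F x)" "Cmp ?E (NC \<alpha> x) (NC \<beta> x) = Idt ?E (FO ?G x)"
        using fun_cong[OF arg_cong[OF e(1), of NC], of x] fun_cong[OF arg_cong[OF e(2), of NC], of x] x a(3,4) \<beta>
        by simp_all
      moreover have "NC \<beta> x \<in> hom ?E (FO ?G x) (FO ?F x)"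
        using small_transformationD(6)[OF \<beta>(1), of x] x a(3,4) \<beta> by simp
      ultimately show "invertible ?E (NC \<alpha> x)"
        using a(6)[OF x] by (auto simp: invertible_def hom_iff)
    qed
  next
    assume inv: "\<forall>x \<in> Ob ?C. invertible ?E (NC \<alpha> x)"
    have "\<forall>x. \<exists>g. x \<in> Ob ?C \<longrightarrow> g \<in> hom ?E (FO ?G x) (FO ?F x) \<and>
        Cmp ?E g (NC \<alpha> x) = Idt ?E (FO ?F x) \<and> Cmp ?E (NC \<alpha> x) g = Idt ?E (FO ?G x)"
    proof (intro allI)
      fix x
      show "\<exists>g. x \<in> Ob ?C \<longrightarrow> g \<in> hom ?E (FO ?G x) (FO ?F x) \<and>
        Cmp ?E g (NC \<alpha> x) = Idt ?E (FO ?F x) \<and> Cmp ?E (NC \<alpha> x) g = Idt ?E (FO ?G x)"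
      proof (cases "x \<in> Ob ?C")
        case True
        then have "Dm ?E (NC \<alpha> x) = FO ?F x" "Cd ?E (NC \<alpha> x) = FO ?G x" "invertible ?E (NC \<alpha> x)"
          using a(6)[OF True] inv by (auto simp: hom_iff)
        then show ?thesis unfolding invertible_def by auto
      qed simp
    qed
    from this[THEN choice] obtain n where "\<forall>x. x \<in> Ob ?C \<longrightarrow> n x \<in> hom ?E (FO ?G x) (FO ?F x) \<and>
        Cmp ?E (n x) (NC \<alpha> x) = Idt ?E (FO ?F x) \<and> Cmp ?E (NC \<alpha> x) (n x) = Idt ?E (FO ?G x)" ..
    then have n: "\<And>x. x \<in> Ob ?C \<Longrightarrow> n x \<in> hom ?E (FO ?G x) (FO ?F x)"
      "\<And>x. x \<in> Ob ?C \<Longrightarrow> Cmp ?E (n x) (NC \<alpha> x) = Idt ?E (FO ?F x)"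
      "\<And>x. x \<in> Ob ?C \<Longrightarrow> Cmp ?E (NC \<alpha> x) (n x) = Idt ?E (FO ?G x)" for x
      by blast+
    let ?b = "\<lparr>NSrc = ?G, NTgt = ?F, NC = restrict n (Ob (FSrc ?G))\<rparr>"
    have b: "?b \<in> hom (Two Cat) ?G ?F"
    proof (rule hom_TwoI)
      fix f x y assume "f \<in> hom (FSrc ?G) x y"
      then have f: "f \<in> hom ?C x y" using a(3) by simp
      have x: "x \<in> Ob ?C" "y \<in> Ob ?C" using hom_ob[OF C f] by auto
      note F = functor_hom[OF small_functorD(7)[OF a(1)] f]
        and G = functor_hom[OF small_functorD(7)[OF a(2), unfolded a(3,4)] f]
      \<comment> \<open>The factor \<open>NC \<alpha> x\<close> composed with \<open>n x\<close> is
        inserted on the right, naturality of \<open>\<alpha>\<close> moves it across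
        \<open>f\<close>, and \<open>n y\<close> cancels \<open>NC \<alpha> y\<close>.\<close>
      have "Cmp ?E (n y) (FA ?G f) = Cmp ?E (n y) (Cmp ?E (FA ?G f) (Cmp ?E (NC \<alpha> x) (n x)))"
        using n(3)[OF x(1)] cmp_id[OF E G] by simp
      also have "\<dots> = Cmp ?E (n y) (Cmp ?E (Cmp ?E (FA ?G f) (NC \<alpha> x)) (n x))"
        using cmp_assoc[OF E n(1)[OF x(1)] a(6)[OF x(1)] G] by simp
      also have "\<dots> = Cmp ?E (n y) (Cmp ?E (NC \<alpha> y) (Cmp ?E (FA ?F f) (n x)))"
        using a(7)[OF f] cmp_assoc[OF E n(1)[OF x(1)] F a(6)[OF x(2)]] by simp
      also have "\<dots> = Cmp ?E (FA ?F f) (n x)"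
        using cmp_assoc[OF E cmp_hom[OF E n(1)[OF x(1)] F] a(6)[OF x(2)] n(1)[OF x(2)]]
          n(2)[OF x(2)] id_cmp[OF E cmp_hom[OF E n(1)[OF x(1)] F]] by simp
      finally show "Cmp (FTgt ?G) (n y) (FA ?G f) = Cmp (FTgt ?G) (FA ?F f) (n x)"
        using a(4) by simp
    qed (use a n in simp_all)
    have b': "small_transformation ?b" using b by (simp add: hom_Two)
    have "Cmp (Two Cat) ?b \<alpha> = Idt (Two Cat) ?F" "Cmp (Two Cat) \<alpha> ?b = Idt (Two Cat) ?G"
      by (rule ntr_eqI; use n a b' \<alpha> in \<open>simp add: small_transformation_Cmp\<close>)+
    then show "invertible (Two Cat) \<alpha>"
      unfolding invertible_def using b \<alpha> by auto
  qed
qed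

section \<open>Product categories, functors and transformations through the pairing
  \<open>pr\<close>\<close>

lemma prod_cat_sel [simp]:
  "Ob (prod_cat C D) = pr ` (Ob C \<times> Ob D)" "Ar (prod_cat C D) = pr ` (Ar C \<times> Ar D)"
  "f \<in> Ar C \<Longrightarrow> g \<in> Ar D \<Longrightarrow> Dm (prod_cat C D) (pr (f, g)) = pr (Dm C f, Dm D g)"
  "f \<in> Ar C \<Longrightarrow> g \<in> Ar D \<Longrightarrow> Cd (prod_cat C D) (pr (f, g)) = pr (Cd C f, Cd D g)"
  "x \<in> Ob C \<Longrightarrow> y \<in> Ob D \<Longrightarrow> Idt (prod_cat C D) (pr (x, y)) = pr (Idt C x, Idt D y)"
  by (auto simp: prod_cat_def)

lemma pr_eq [simp]: "pr (x, y) = pr (x', y') \<longleftrightarrow> x = x' \<and> y = y'"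
  using inj_pr by (auto dest: injD)

lemma pr_mem [simp]: "pr (x, y) \<in> pr ` (X \<times> Y) \<longleftrightarrow> x \<in> X \<and> y \<in> Y"
  by auto

lemma hom_prod_cat [simp]:
  "pr (f, g) \<in> hom (prod_cat C D) (pr (x, y)) (pr (x', y')) \<longleftrightarrow> f \<in> hom C x x' \<and> g \<in> hom D y y'"
  by (auto simp: hom_iff)

lemma hom_prod_catE:
  assumes "h \<in> hom (prod_cat C D) z z'"
  obtains f g x x' y y' where "h = pr (f, g)" "z = pr (x, y)" "z' = pr (x', y')" "f \<in> hom C x x'" "g \<in> hom D y y'"
  using assms by (auto simp: hom_iff)

text \<open>The typing premises discharge the composability test in \<open>prod_cat\<close>, whose
  other branch is \<open>undefined\<close>.\<close>

lemma Cmp_prod_cat: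
  "f \<in> hom C x y \<Longrightarrow> g \<in> hom C y z \<Longrightarrow> f' \<in> hom D x' y' \<Longrightarrow> g' \<in> hom D y' z' \<Longrightarrow>
    Cmp (prod_cat C D) (pr (g, g')) (pr (f, f')) = pr (Cmp C g f, Cmp D g' f')"
  by (auto simp: prod_cat_def hom_iff)

lemma category_prod_cat:
  assumes "category C" "category D"
  shows "category (prod_cat C D)"
  unfolding category_def
proof (intro conjI ballI impI)
  note C = assms(1) and D = assms(2)
  fix z assume "z \<in> Ob (prod_cat C D)"
  then show "Idt (prod_cat C D) z \<in> hom (prod_cat C D) z z"
    using id_hom[OF C] id_hom[OF D] by auto
next
  note C = assms(1) and D = assms(2)
  fix h assume "h \<in> Ar (prod_cat C D)"
  then obtain f g x x' y y' where h: "h = pr (f, g)" "f \<in> hom C x x'" "g \<in> hom D y y'"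
    by (auto simp: hom_iff)
  have o: "x \<in> Ob C" "x' \<in> Ob C" "y \<in> Ob D" "y' \<in> Ob D"
    using hom_ob[OF C h(2)] hom_ob[OF D h(3)] by auto
  have hh: "h \<in> hom (prod_cat C D) (pr (x, y)) (pr (x', y'))" using h by simp
  then have [simp]: "Dm (prod_cat C D) h = pr (x, y)" "Cd (prod_cat C D) h = pr (x', y')"
    by (auto simp: hom_iff)
  show "Dm (prod_cat C D) h \<in> Ob (prod_cat C D)" "Cd (prod_cat C D) h \<in> Ob (prod_cat C D)"
    using o by simp_all
  show "Cmp (prod_cat C D) h (Idt (prod_cat C D) (Dm (prod_cat C D) h)) = h"
    "Cmp (prod_cat C D) (Idt (prod_cat C D) (Cd (prod_cat C D) h)) h = h"
    using o Cmp_prod_cat[OF id_hom[OF C o(1)] h(2) id_hom[OF D o(3)] h(3)]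
      Cmp_prod_cat[OF h(2) id_hom[OF C o(2)] h(3) id_hom[OF D o(4)]]
      h(2)[unfolded hom_iff] h(3)[unfolded hom_iff]
    by (simp_all add: h(1) cmp_id[OF C h(2)] id_cmp[OF C h(2)] cmp_id[OF D h(3)] id_cmp[OF D h(3)])
next
  note C = assms(1) and D = assms(2)
  fix h k assume h: "h \<in> Ar (prod_cat C D)" and k: "k \<in> Ar (prod_cat C D)"
    and e: "Dm (prod_cat C D) k = Cd (prod_cat C D) h"
  obtain f g where h': "h = pr (f, g)" "f \<in> Ar C" "g \<in> Ar D" using h by auto
  obtain f' g' where k': "k = pr (f', g')" "f' \<in> Ar C" "g' \<in> Ar D" using k by auto
  have hom: "f \<in> hom C (Dm C f) (Cd C f)" "f' \<in> hom C (Cd C f) (Cd C f')"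
    "g \<in> hom D (Dm D g) (Cd D g)" "g' \<in> hom D (Cd D g) (Cd D g')"
    using e h' k' by (auto simp: hom_iff)
  show "Cmp (prod_cat C D) k h \<in> hom (prod_cat C D) (Dm (prod_cat C D) h) (Cd (prod_cat C D) k)"
    using cmp_hom[OF C hom(1,2)] cmp_hom[OF D hom(3,4)] h' k' by (simp add: Cmp_prod_cat[OF hom])
  fix l assume l: "l \<in> Ar (prod_cat C D)" and e': "Dm (prod_cat C D) l = Cd (prod_cat C D) k"
  obtain f'' g'' where l': "l = pr (f'', g'')" "f'' \<in> Ar C" "g'' \<in> Ar D" using l by auto
  have hom': "f'' \<in> hom C (Cd C f') (Cd C f'')" "g'' \<in> hom D (Cd D g') (Cd D g'')"
    using e' k' l' by (auto simp: hom_iff)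
  show "Cmp (prod_cat C D) l (Cmp (prod_cat C D) k h) = Cmp (prod_cat C D) (Cmp (prod_cat C D) l k) h"
    unfolding h' k' l' Cmp_prod_cat[OF hom] Cmp_prod_cat[OF hom(2) hom'(1) hom(4) hom'(2)]
      Cmp_prod_cat[OF cmp_hom[OF C hom(1,2)] hom'(1) cmp_hom[OF D hom(3,4)] hom'(2)]
      Cmp_prod_cat[OF hom(1) cmp_hom[OF C hom(2) hom'(1)] hom(3) cmp_hom[OF D hom(4) hom'(2)]]
    by (simp add: cmp_assoc[OF C hom(1,2) hom'(1)] cmp_assoc[OF D hom(3,4) hom'(2)])
qed

lemma ext_category_prod_cat:
  assumes "ext_category C" "ext_category D"
  shows "ext_category (prod_cat C D)"
  unfolding ext_category_def
proof (intro conjI allI impI)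
  show "category (prod_cat C D)"
    using assms by (simp add: category_prod_cat ext_category_category)
qed (auto simp: prod_cat_def)

lemma prod_fnc_sel [simp]:
  "FSrc (prod_fnc F G) = prod_cat (FSrc F) (FSrc G)" "FTgt (prod_fnc F G) = prod_cat (FTgt F) (FTgt G)"
  "x \<in> Ob (FSrc F) \<Longrightarrow> y \<in> Ob (FSrc G) \<Longrightarrow> FO (prod_fnc F G) (pr (x, y)) = pr (FO F x, FO G y)"
  "f \<in> Ar (FSrc F) \<Longrightarrow> g \<in> Ar (FSrc G) \<Longrightarrow> FA (prod_fnc F G) (pr (f, g)) = pr (FA F f, FA G g)"
  by (auto simp: prod_fnc_def)

lemma small_functor_prod_fnc:
  assumes "small_functor F" "small_functor G"
  shows "small_functor (prod_fnc F G)"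
proof -
  note F = small_functorD[OF assms(1)] and G = small_functorD[OF assms(2)]
  have "is_functor (prod_cat (FSrc F) (FSrc G)) (prod_cat (FTgt F) (FTgt G)) (FO (prod_fnc F G)) (FA (prod_fnc F G))"
  proof (rule is_functorI[OF category_prod_cat[OF F(3) G(3)]])
    fix z assume z: "z \<in> Ob (prod_cat (FSrc F) (FSrc G))"
    then show "FO (prod_fnc F G) z \<in> Ob (prod_cat (FTgt F) (FTgt G))"
      using functor_ob[OF F(7)] functor_ob[OF G(7)] by auto
    show "FA (prod_fnc F G) (Idt (prod_cat (FSrc F) (FSrc G)) z) =
        Idt (prod_cat (FTgt F) (FTgt G)) (FO (prod_fnc F G) z)"
      using z functor_ob[OF F(7)] functor_ob[OF G(7)] functor_id[OF F(7)] functor_id[OF G(7)]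
        id_hom[OF F(3)] id_hom[OF G(3)] by (auto simp: hom_iff)
  next
    fix h z z' assume "h \<in> hom (prod_cat (FSrc F) (FSrc G)) z z'"
    then show "FA (prod_fnc F G) h \<in> hom (prod_cat (FTgt F) (FTgt G)) (FO (prod_fnc F G) z) (FO (prod_fnc F G) z')"
    proof (rule hom_prod_catE)
      fix f g x x' y y' assume "h = pr (f, g)" "z = pr (x, y)" "z' = pr (x', y')"
        and f: "f \<in> hom (FSrc F) x x'" and g: "g \<in> hom (FSrc G) y y'"
      then show ?thesis
        using functor_hom[OF F(7) f] functor_hom[OF G(7) g] hom_ob[OF F(3) f] hom_ob[OF G(3) g]
          f[unfolded hom_iff] g[unfolded hom_iff] by simp
    qed
  next
    fix h k z z' z'' assume "h \<in> hom (prod_cat (FSrc F) (FSrc G)) z z'"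
      and "k \<in> hom (prod_cat (FSrc F) (FSrc G)) z' z''"
    then obtain f g x x' y y' f' g' x'' y'' where e: "h = pr (f, g)" "z = pr (x, y)" "z' = pr (x', y')"
       "k = pr (f', g')" "z'' = pr (x'', y'')"
      and f: "f \<in> hom (FSrc F) x x'" and g: "g \<in> hom (FSrc G) y y'"
      and f': "f' \<in> hom (FSrc F) x' x''" and g': "g' \<in> hom (FSrc G) y' y''"
      by (elim hom_prod_catE) auto
    show "FA (prod_fnc F G) (Cmp (prod_cat (FSrc F) (FSrc G)) k h) =
       Cmp (prod_cat (FTgt F) (FTgt G)) (FA (prod_fnc F G) k) (FA (prod_fnc F G) h)"
      using functor_cmp[OF F(7) f f'] functor_cmp[OF G(7) g g'] cmp_hom[OF F(3) f f'] cmp_hom[OF G(3) g g']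
        f[unfolded hom_iff] g[unfolded hom_iff] f'[unfolded hom_iff] g'[unfolded hom_iff]
      by (simp add: e Cmp_prod_cat[OF f f' g g'] hom_iff
          Cmp_prod_cat[OF functor_hom[OF F(7) f] functor_hom[OF F(7) f'] functor_hom[OF G(7) g] functor_hom[OF G(7) g']])
  qed
  then show ?thesis
    unfolding small_functor_def using F G ext_category_prod_cat by (auto simp: prod_fnc_def)
qed

lemma prod_fnc_Idt: "ext_category C \<Longrightarrow> ext_category D \<Longrightarrow>
    prod_fnc (Idt (One Cat) C) (Idt (One Cat) D) = Idt (One Cat) (prod_cat C D)"
  by (rule fnc_eqI) (use ext_category_prod_cat[of C D] in \<open>auto intro!: small_functor_prod_fnc small_functor_Idt\<close>)

lemma prod_fnc_Cmp:
  assumes "small_functor F" "small_functor G" "small_functor F'" "small_functor G'"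
    and "FTgt F = FSrc F'" "FTgt G = FSrc G'"
  shows "prod_fnc (Cmp (One Cat) F' F) (Cmp (One Cat) G' G) = Cmp (One Cat) (prod_fnc F' G') (prod_fnc F G)"
  using assms functor_ob[OF small_functorD(7)[OF assms(1)]] functor_ob[OF small_functorD(7)[OF assms(2)]]
    functor_hom[OF small_functorD(7)[OF assms(1)] hom_self] functor_hom[OF small_functorD(7)[OF assms(2)] hom_self]
  by (intro fnc_eqI) (auto intro!: small_functor_prod_fnc small_functor_Cmp simp: hom_iff)

lemma prod_ntr_hom:
  assumes "\<alpha> \<in> hom (Two Cat) F F'" "\<beta> \<in> hom (Two Cat) G G'"
  shows "prod_ntr \<alpha> \<beta> \<in> hom (Two Cat) (prod_fnc F G) (prod_fnc F' G')"
    and "x \<in> Ob (FSrc F) \<Longrightarrow> y \<in> Ob (FSrc G) \<Longrightarrow> NC (prod_ntr \<alpha> \<beta>) (pr (x, y)) = pr (NC \<alpha> x, NC \<beta> y)"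
proof -
  have a: "small_transformation \<alpha>" "NSrc \<alpha> = F" "NTgt \<alpha> = F'" and b: "small_transformation \<beta>" "NSrc \<beta> = G" "NTgt \<beta> = G'"
    using assms by (auto simp: hom_Two)
  note A = small_transformationD[OF a(1), unfolded a(2,3)] and B = small_transformationD[OF b(1), unfolded b(2,3)]
  note F = small_functorD[OF A(1)] and G = small_functorD[OF B(1)]
  note F' = small_functorD(7)[OF A(2), unfolded A(3,4)] and G' = small_functorD(7)[OF B(2), unfolded B(3,4)]
  show n: "NC (prod_ntr \<alpha> \<beta>) (pr (x, y)) = pr (NC \<alpha> x, NC \<beta> y)" if "x \<in> Ob (FSrc F)" "y \<in> Ob (FSrc G)" for x y
    using that a b by (simp add: prod_ntr_def)
  let ?n = "\<lambda>z. pr (NC \<alpha> (p1 z), NC \<beta> (p2 z))"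
  have "\<lparr>NSrc = prod_fnc F G, NTgt = prod_fnc F' G', NC = restrict ?n (Ob (FSrc (prod_fnc F G)))\<rparr>
      \<in> hom (Two Cat) (prod_fnc F G) (prod_fnc F' G')"
  proof (rule hom_TwoI)
    fix z assume "z \<in> Ob (FSrc (prod_fnc F G))"
    then show "?n z \<in> hom (FTgt (prod_fnc F G)) (FO (prod_fnc F G) z) (FO (prod_fnc F' G') z)"
      using A(3,4,6) B(3,4,6) by auto
  next
    fix h z z' assume "h \<in> hom (FSrc (prod_fnc F G)) z z'"
    then obtain f g x x' y y' where e: "h = pr (f, g)" "z = pr (x, y)" "z' = pr (x', y')"
      and f: "f \<in> hom (FSrc F) x x'" and g: "g \<in> hom (FSrc G) y y'"
      by (auto elim!: hom_prod_catE)
    note o = hom_ob[OF F(3) f] hom_ob[OF G(3) g]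
    show "Cmp (FTgt (prod_fnc F G)) (?n z') (FA (prod_fnc F G) h) =
        Cmp (FTgt (prod_fnc F G)) (FA (prod_fnc F' G') h) (?n z)"
      using A(3,4) B(3,4) f[unfolded hom_iff] g[unfolded hom_iff] A(7)[OF f] B(7)[OF g]
      by (simp add: e Cmp_prod_cat[OF functor_hom[OF F(7) f] A(6)[OF o(2)] functor_hom[OF G(7) g] B(6)[OF o(4)]]
        Cmp_prod_cat[OF A(6)[OF o(1)] functor_hom[OF F' f] B(6)[OF o(3)] functor_hom[OF G' g]])
  qed (use A B in \<open>simp_all add: small_functor_prod_fnc\<close>)
  then show "prod_ntr \<alpha> \<beta> \<in> hom (Two Cat) (prod_fnc F G) (prod_fnc F' G')"
    using a b by (simp add: prod_ntr_def)
qed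

text \<open>Every object and arrow of the product is a coded pair, so a functor out of it is a pair
  of two-argument maps. This removes \<open>pr\<close> from the conditions on the legs of a
  dicone.\<close>

lemma is_functor_prod_cat_iff:
  assumes "category C" "category D"
  shows "is_functor (prod_cat C D) E fo fa \<longleftrightarrow>
    (\<forall>x \<in> Ob C. \<forall>y \<in> Ob D. fo (pr (x, y)) \<in> Ob E \<and> fa (pr (Idt C x, Idt D y)) = Idt E (fo (pr (x, y)))) \<and>
    (\<forall>f g x x' y y'. f \<in> hom C x x' \<longrightarrow> g \<in> hom D y y' \<longrightarrow>
       fa (pr (f, g)) \<in> hom E (fo (pr (x, y))) (fo (pr (x', y')))) \<and>
    (\<forall>f g f' g' x x' x'' y y' y''. f \<in> hom C x x' \<longrightarrow> f' \<in> hom C x' x'' \<longrightarrow> g \<in> hom D y y' \<longrightarrow> g' \<in> hom D y' y'' \<longrightarrow>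
       fa (pr (Cmp C f' f, Cmp D g' g)) = Cmp E (fa (pr (f', g'))) (fa (pr (f, g))))"
    (is "?L \<longleftrightarrow> ?R")
proof
  assume F: ?L
  show ?R
  proof (intro conjI ballI allI impI)
    fix x y assume x: "x \<in> Ob C" "y \<in> Ob D"
    then show "fo (pr (x, y)) \<in> Ob E" "fa (pr (Idt C x, Idt D y)) = Idt E (fo (pr (x, y)))"
      using functor_ob[OF F, of "pr (x, y)"] functor_id[OF F, of "pr (x, y)"] by simp_all
  next
    fix f g x x' y y' assume "f \<in> hom C x x'" "g \<in> hom D y y'"
    then show "fa (pr (f, g)) \<in> hom E (fo (pr (x, y))) (fo (pr (x', y')))"
      by (intro functor_hom[OF F]) simp
  next
    fix f g f' g' x x' x'' y y' y''
    assume f: "f \<in> hom C x x'" "f' \<in> hom C x' x''" "g \<in> hom D y y'" "g' \<in> hom D y' y''"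
    then have "fa (Cmp (prod_cat C D) (pr (f', g')) (pr (f, g))) = Cmp E (fa (pr (f', g'))) (fa (pr (f, g)))"
      by (intro functor_cmp[OF F, where x = "pr (x, y)" and y = "pr (x', y')" and z = "pr (x'', y'')"]) simp_all
    then show "fa (pr (Cmp C f' f, Cmp D g' g)) = Cmp E (fa (pr (f', g'))) (fa (pr (f, g)))"
      by (simp add: Cmp_prod_cat[OF f])
  qed
next
  assume R: ?R
  show ?L
  proof (rule is_functorI[OF category_prod_cat[OF assms]])
    fix h k z z' z'' assume "h \<in> hom (prod_cat C D) z z'" "k \<in> hom (prod_cat C D) z' z''"
    then obtain f g x x' y y' f' g' x'' y'' where e: "h = pr (f, g)" "k = pr (f', g')"
      and f: "f \<in> hom C x x'" "f' \<in> hom C x' x''" "g \<in> hom D y y'" "g' \<in> hom D y' y''"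
      by (elim hom_prod_catE) auto
    then show "fa (Cmp (prod_cat C D) k h) = Cmp E (fa k) (fa h)"
      using R f unfolding e Cmp_prod_cat[OF f] by blast
  qed (use R in \<open>auto elim!: hom_prod_catE\<close>)
qed

section \<open>Pseudo-dicones in elementary terms\<close>

text \<open>\<open>Q\<close> is covariant and \<open>R\<close> contravariant. The assumptions are
  invariant under passing from \<open>K\<close>, \<open>Q\<close>, \<open>R\<close> to
  \<open>op2 K\<close>, \<open>R\<close>, \<open>Q\<close>, see \<open>swap\<close>; so whatever is
  proved here also holds with the two functors exchanged.\<close>

locale cat_pair =
  fixes K :: "('k, 'f, 'c) cat2" and Q R :: "('k, 'f, 'c, 'u::infinite) cat_functor"
  assumes K: "category (One K)"
    and cell_typed: "\<gamma> \<in> Ar (Two K) \<Longrightarrow> Dm (Two K) \<gamma> \<in> Ar (One K)"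
      "\<gamma> \<in> Ar (Two K) \<Longrightarrow> Cd (Two K) \<gamma> \<in> Ar (One K)"
      "\<gamma> \<in> Ar (Two K) \<Longrightarrow> Dm (One K) (Cd (Two K) \<gamma>) = dm0 K \<gamma>"
      "\<gamma> \<in> Ar (Two K) \<Longrightarrow> Cd (One K) (Cd (Two K) \<gamma>) = cd0 K \<gamma>"
    and Ob_Two: "Ob (Two K) = Ar (One K)"
    and Q: "two_functor K Cat Q" and R: "two_functor (op2 K) Cat R"
begin

abbreviation KO where "KO \<equiv> Ob (One K)"
abbreviation kid where "kid \<equiv> Idt (One K)"
abbreviation kc where "kc \<equiv> Cmp (One K)"

lemma op2_sel [simp]:
  "Ob (One (op2 K)) = KO" "Ar (One (op2 K)) = Ar (One K)" "Dm (One (op2 K)) = Cd (One K)"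
  "Cd (One (op2 K)) = Dm (One K)" "Idt (One (op2 K)) = kid" "Cmp (One (op2 K)) g f = kc f g"
  "Two (op2 K) = Two K"
  by (simp_all add: op2_def op1_def)

lemma functor_Q:
  "A \<in> KO \<Longrightarrow> ext_category (F0 Q A)"
  "A \<in> KO \<Longrightarrow> F1 Q (kid A) = Idt (One Cat) (F0 Q A)"
  "f \<in> hom (One K) A B \<Longrightarrow> small_functor (F1 Q f) \<and> FSrc (F1 Q f) = F0 Q A \<and> FTgt (F1 Q f) = F0 Q B"
  "f \<in> hom (One K) A B \<Longrightarrow> g \<in> hom (One K) B C \<Longrightarrow> F1 Q (kc g f) = Cmp (One Cat) (F1 Q g) (F1 Q f)"
  "\<gamma> \<in> hom (Two K) f g \<Longrightarrow> F2 Q \<gamma> \<in> hom (Two Cat) (F1 Q f) (F1 Q g)"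
  "f \<in> Ar (One K) \<Longrightarrow> F2 Q (Idt (Two K) f) = Idt (Two Cat) (F1 Q f)"
  using Q by (auto simp: two_functor_def is_functor_def hom_iff Ob_Two)

lemma functor_R:
  "A \<in> KO \<Longrightarrow> ext_category (F0 R A)"
  "A \<in> KO \<Longrightarrow> F1 R (kid A) = Idt (One Cat) (F0 R A)"
  "f \<in> hom (One K) A B \<Longrightarrow> small_functor (F1 R f) \<and> FSrc (F1 R f) = F0 R B \<and> FTgt (F1 R f) = F0 R A"
  "f \<in> hom (One K) A B \<Longrightarrow> g \<in> hom (One K) B C \<Longrightarrow> F1 R (kc g f) = Cmp (One Cat) (F1 R f) (F1 R g)"
  "\<gamma> \<in> hom (Two K) f g \<Longrightarrow> F2 R \<gamma> \<in> hom (Two Cat) (F1 R f) (F1 R g)"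
  "f \<in> Ar (One K) \<Longrightarrow> F2 R (Idt (Two K) f) = Idt (Two Cat) (F1 R f)"
  using R by (auto simp: two_functor_def is_functor_def hom_iff Ob_Two)

lemma functor_Q1:
  assumes "f \<in> hom (One K) A B"
  shows "small_functor (F1 Q f)" "FSrc (F1 Q f) = F0 Q A" "FTgt (F1 Q f) = F0 Q B"
    "is_functor (F0 Q A) (F0 Q B) (FO (F1 Q f)) (FA (F1 Q f))"
  using functor_Q(3)[OF assms] small_functorD(7)[of "F1 Q f"] by auto

lemma functor_R1:
  assumes "f \<in> hom (One K) A B"
  shows "small_functor (F1 R f)" "FSrc (F1 R f) = F0 R B" "FTgt (F1 R f) = F0 R A"
    "is_functor (F0 R B) (F0 R A) (FO (F1 R f)) (FA (F1 R f))"
  using functor_R(3)[OF assms] small_functorD(7)[of "F1 R f"] by auto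

lemma category_QR: "A \<in> KO \<Longrightarrow> category (F0 Q A)" "A \<in> KO \<Longrightarrow> category (F0 R A)"
  using functor_Q(1) functor_R(1) ext_category_category by auto

lemma cell_hom:
  assumes "\<gamma> \<in> hom (Two K) f g"
  shows "f \<in> hom (One K) A B \<longleftrightarrow> g \<in> hom (One K) A B" "f \<in> Ar (One K)" "g \<in> Ar (One K)"
  using assms cell_typed[of \<gamma>] by (auto simp: hom_iff)

lemma swap: "cat_pair (op2 K) R Q"
proof -
  have e: "op2 (op2 K) = K" by (simp add: op2_def op1_def)
  have "category (One (op2 K))" using category_op1[OF K] by (simp add: op2_def)
  then show ?thesis
    unfolding cat_pair_def e using cell_typed Ob_Two Q R by auto
qed

end

text \<open>A pseudo-dicone for \<open>T(A, B) = QA \<times> RB\<close> over the opposite of \<open>K\<close>, with \<open>lo\<close> and \<open>la\<close> the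
  object and arrow parts of its legs and \<open>t\<close> the components of its 2-cells.\<close>

locale dicone = cat_pair K Q R
  for K :: "('k, 'f, 'c) cat2" and Q R :: "('k, 'f, 'c, 'u::infinite) cat_functor" +
  fixes E :: "'u small_cat" and lo la :: "'k \<Rightarrow> 'u \<Rightarrow> 'u \<Rightarrow> 'u" and t :: "'f \<Rightarrow> 'u \<Rightarrow> 'u \<Rightarrow> 'u"
  assumes lo: "A \<in> Ob (One K) \<Longrightarrow> x \<in> Ob (F0 Q A) \<Longrightarrow> w \<in> Ob (F0 R A) \<Longrightarrow> lo A x w \<in> Ob E"
    and la_id: "A \<in> Ob (One K) \<Longrightarrow> x \<in> Ob (F0 Q A) \<Longrightarrow> w \<in> Ob (F0 R A) \<Longrightarrow>
      la A (Idt (F0 Q A) x) (Idt (F0 R A) w) = Idt E (lo A x w)"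
    and la_hom: "A \<in> Ob (One K) \<Longrightarrow> p \<in> hom (F0 Q A) x x' \<Longrightarrow> k \<in> hom (F0 R A) w w' \<Longrightarrow>
      la A p k \<in> hom E (lo A x w) (lo A x' w')"
    and la_cmp: "A \<in> Ob (One K) \<Longrightarrow> p \<in> hom (F0 Q A) x x' \<Longrightarrow> p' \<in> hom (F0 Q A) x' x'' \<Longrightarrow>
      k \<in> hom (F0 R A) w w' \<Longrightarrow> k' \<in> hom (F0 R A) w' w'' \<Longrightarrow>
      la A (Cmp (F0 Q A) p' p) (Cmp (F0 R A) k' k) = Cmp E (la A p' k') (la A p k)"
    and t_hom: "f \<in> hom (One K) A B \<Longrightarrow> x \<in> Ob (F0 Q A) \<Longrightarrow> w \<in> Ob (F0 R B) \<Longrightarrow>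
      t f x w \<in> hom E (lo A x (FO (F1 R f) w)) (lo B (FO (F1 Q f) x) w)"
    and t_nat: "f \<in> hom (One K) A B \<Longrightarrow> p \<in> hom (F0 Q A) x x' \<Longrightarrow> k \<in> hom (F0 R B) w w' \<Longrightarrow>
      Cmp E (t f x' w') (la A p (FA (F1 R f) k)) = Cmp E (la B (FA (F1 Q f) p) k) (t f x w)"
    and t_inv: "f \<in> hom (One K) A B \<Longrightarrow> x \<in> Ob (F0 Q A) \<Longrightarrow> w \<in> Ob (F0 R B) \<Longrightarrow> invertible E (t f x w)"
    and t_id: "A \<in> Ob (One K) \<Longrightarrow> x \<in> Ob (F0 Q A) \<Longrightarrow> w \<in> Ob (F0 R A) \<Longrightarrow>
      t (Idt (One K) A) x w = Idt E (lo A x w)"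
    and t_cmp: "f \<in> hom (One K) A B \<Longrightarrow> g \<in> hom (One K) B C \<Longrightarrow> x \<in> Ob (F0 Q A) \<Longrightarrow> w \<in> Ob (F0 R C) \<Longrightarrow>
      t (Cmp (One K) g f) x w = Cmp E (t g (FO (F1 Q f) x) w) (t f x (FO (F1 R g) w))"
    and t_cell: "\<gamma> \<in> hom (Two K) f g \<Longrightarrow> f \<in> hom (One K) A B \<Longrightarrow> x \<in> Ob (F0 Q A) \<Longrightarrow> w \<in> Ob (F0 R B) \<Longrightarrow>
      Cmp E (la B (NC (F2 Q \<gamma>) x) (Idt (F0 R B) w)) (t f x w) = Cmp E (t g x w) (la A (Idt (F0 Q A) x) (NC (F2 R \<gamma>) w))"

text \<open>The components of a constructed or postcomposed cone agree with the intended maps only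
  on typed arguments. All axioms evaluate them at such arguments, so the axioms carry over.\<close>

lemma dicone_cong:
  assumes "dicone K Q R E lo la t"
    and eq_lo: "\<And>A x w. A \<in> Ob (One K) \<Longrightarrow> x \<in> Ob (F0 Q A) \<Longrightarrow> w \<in> Ob (F0 R A) \<Longrightarrow> lo' A x w = lo A x w"
    and eq_la: "\<And>A p k. A \<in> Ob (One K) \<Longrightarrow> p \<in> Ar (F0 Q A) \<Longrightarrow> k \<in> Ar (F0 R A) \<Longrightarrow> la' A p k = la A p k"
    and eq_t: "\<And>f A B x w. f \<in> hom (One K) A B \<Longrightarrow> x \<in> Ob (F0 Q A) \<Longrightarrow> w \<in> Ob (F0 R B) \<Longrightarrow> t' f x w = t f x w"
  shows "dicone K Q R E lo' la' t'"
proof -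
  interpret dicone K Q R E lo la t by fact
  have la': "la' A p k = la A p k"
    if "A \<in> KO" "p \<in> hom (F0 Q A) x x'" "k \<in> hom (F0 R A) w w'" for A p k x x' w w'
    using eq_la[of A p k] that by (auto simp: hom_iff)
  note QR = category_QR
  show ?thesis
  proof (unfold_locales, goal_cases)
    case (1 A x w) then show ?case using lo eq_lo by simp
  next
    case (2 A x w) then show ?case
      using la_id[OF 2] la'[OF 2(1) id_hom[OF QR(1) 2(2)] id_hom[OF QR(2) 2(3)]] eq_lo by simp
  next
    case (3 A p x x' k w w') then show ?case
      using la_hom[OF 3] la'[OF 3] eq_lo[OF 3(1)] hom_ob[OF QR(1)[OF 3(1)] 3(2)] hom_ob[OF QR(2)[OF 3(1)] 3(3)] by simp
  next
    case (4 A p x x' p' x'' k w w' k' w'') then show ?case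
      using la_cmp[OF 4] la'[OF 4(1,2,4)] la'[OF 4(1,3,5)]
        la'[OF 4(1) cmp_hom[OF QR(1)[OF 4(1)] 4(2,3)] cmp_hom[OF QR(2)[OF 4(1)] 4(4,5)]] by simp
  next
    case (5 f A B x w)
    have "A \<in> KO" "B \<in> KO" using hom_ob[OF K 5(1)] by auto
    then show ?case
      using t_hom[OF 5] eq_t[OF 5] eq_lo 5 functor_ob[OF functor_Q1(4)[OF 5(1)]] functor_ob[OF functor_R1(4)[OF 5(1)]] by simp
  next
    case (6 f A B p x x' k w w')
    have AB: "A \<in> KO" "B \<in> KO" using hom_ob[OF K 6(1)] by auto
    note o = hom_ob[OF QR(1)[OF AB(1)] 6(2)] hom_ob[OF QR(2)[OF AB(2)] 6(3)]
    show ?case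
      using t_nat[OF 6] eq_t[OF 6(1)] o la'[OF AB(1) 6(2) functor_hom[OF functor_R1(4)[OF 6(1)] 6(3)]]
        la'[OF AB(2) functor_hom[OF functor_Q1(4)[OF 6(1)] 6(2)] 6(3)] by simp
  next
    case (7 f A B x w) then show ?case using t_inv[OF 7] eq_t[OF 7] by simp
  next
    case (8 A x w) then show ?case using t_id[OF 8] eq_t[OF id_hom[OF K 8(1)] 8(2,3)] eq_lo by simp
  next
    case (9 f A B g C x w) then show ?case
      using t_cmp[OF 9] eq_t[OF cmp_hom[OF K 9(1,2)] 9(3,4)] eq_t[OF 9(1,3)] eq_t[OF 9(2) _ 9(4)]
        functor_ob[OF functor_Q1(4)[OF 9(1)]] functor_ob[OF functor_R1(4)[OF 9(2)]] by simp
  next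
    case (10 \<gamma> f g A B x w)
    have AB: "A \<in> KO" "B \<in> KO" using hom_ob[OF K 10(2)] by auto
    have g: "g \<in> hom (One K) A B" using cell_hom[OF 10(1)] 10(2) by simp
    have "NC (F2 Q \<gamma>) x \<in> hom (F0 Q B) (FO (F1 Q f) x) (FO (F1 Q g) x)"
      "NC (F2 R \<gamma>) w \<in> hom (F0 R A) (FO (F1 R f) w) (FO (F1 R g) w)"
      using hom_TwoD(1)[OF functor_Q(5)[OF 10(1)], of x] hom_TwoD(1)[OF functor_R(5)[OF 10(1)], of w]
        functor_Q1[OF 10(2)] functor_R1[OF 10(2)] 10(3,4) by auto
    note la1 = la'[OF AB(2) this(1) id_hom[OF QR(2)[OF AB(2)] 10(4)]]
      and la2 = la'[OF AB(1) id_hom[OF QR(1)[OF AB(1)] 10(3)] this(2)]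
    show ?case
      using t_cell[OF 10] la1 la2 eq_t[OF 10(2-4)] eq_t[OF g 10(3,4)] by simp
  qed
qed

context cat_pair
begin

abbreviation DJ where "DJ \<equiv> One (op2 K)"
abbreviation DD where "DD A \<equiv> prod_cat (F0 Q A) (F0 R A)"
abbreviation DT where "DT \<equiv> prod_fun2 Q R"
text \<open>Domain and codomain are exchanged in \<open>op2 K\<close>. For \<open>f : A -> B\<close>
  in \<open>K\<close> the source slot is therefore \<open>T(A, f)\<close>, sending
  \<open>(x, w)\<close> to \<open>(x, Rf w)\<close>, and the target slot is \<open>T(f, B)\<close>,
  sending it to \<open>(Qf x, w)\<close>.\<close>

abbreviation DS1 where "DS1 f \<equiv> slot2 (op2 K) DT (Dm (One K) f) f"
abbreviation DS2 where "DS2 f \<equiv> slot1 (op2 K) DT f (Cd (One K) f)"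

lemma slot:
  assumes "f \<in> hom (One K) A B" "C \<in> KO"
  shows "slot2 (op2 K) DT C f = prod_fnc (Idt (One Cat) (F0 Q C)) (F1 R f)"
    "slot1 (op2 K) DT f C = prod_fnc (F1 Q f) (Idt (One Cat) (F0 R C))"
    "small_functor (slot2 (op2 K) DT C f)" "small_functor (slot1 (op2 K) DT f C)"
    "FSrc (slot2 (op2 K) DT C f) = prod_cat (F0 Q C) (F0 R B)"
    "FTgt (slot2 (op2 K) DT C f) = prod_cat (F0 Q C) (F0 R A)"
    "FSrc (slot1 (op2 K) DT f C) = prod_cat (F0 Q A) (F0 R C)"
    "FTgt (slot1 (op2 K) DT f C) = prod_cat (F0 Q B) (F0 R C)"
    "x \<in> Ob (F0 Q C) \<Longrightarrow> w \<in> Ob (F0 R B) \<Longrightarrow> FO (slot2 (op2 K) DT C f) (pr (x, w)) = pr (x, FO (F1 R f) w)"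
    "x \<in> Ob (F0 Q A) \<Longrightarrow> w \<in> Ob (F0 R C) \<Longrightarrow> FO (slot1 (op2 K) DT f C) (pr (x, w)) = pr (FO (F1 Q f) x, w)"
    "p \<in> Ar (F0 Q C) \<Longrightarrow> k \<in> Ar (F0 R B) \<Longrightarrow> FA (slot2 (op2 K) DT C f) (pr (p, k)) = pr (p, FA (F1 R f) k)"
    "p \<in> Ar (F0 Q A) \<Longrightarrow> k \<in> Ar (F0 R C) \<Longrightarrow> FA (slot1 (op2 K) DT f C) (pr (p, k)) = pr (FA (F1 Q f) p, k)"
  using functor_Q1[OF assms(1)] functor_R1[OF assms(1)] functor_Q(1,2)[OF assms(2)] functor_R(1,2)[OF assms(2)]
  by (simp_all add: slot1_def slot2_def prod_fun2_def small_functor_prod_fnc)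

sublocale di: cone_shape DJ DD DS1 DS2 "Dm (One K)" "Cd (One K)"
proof (unfold_locales, goal_cases)
  case (1 A) then show ?case using functor_Q(1) functor_R(1) by (simp add: ext_category_prod_cat)
next
  case (2 f) then show ?case using slot[OF hom_self] hom_ob[OF K hom_self] by simp
next
  case (3 f) then show ?case using slot[OF hom_self] hom_ob[OF K hom_self] by simp
next
  case (4 f) then show ?case using slot[OF hom_self] hom_ob[OF K hom_self] by simp
next
  case (5 f) then show ?case using slot[OF hom_self] hom_ob[OF K hom_self] by simp
next
  case (6 f) then show ?case using slot[OF hom_self] hom_ob[OF K hom_self] by simp
next
  case (7 f) then show ?case using hom_ob[OF K hom_self] by simp
next
  case (8 f) then show ?case using hom_ob[OF K hom_self] by simp
qed

definition DX where
  "DX E l \<longleftrightarrow> dicone K Q R E (\<lambda>A x w. FO (leg l A) (pr (x, w))) (\<lambda>A p k. FA (leg l A) (pr (p, k)))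
     (\<lambda>f x w. NC (cel l f) (pr (x, w)))"

lemma ntr_eq_iff:
  "small_transformation \<alpha> \<Longrightarrow> small_transformation \<beta> \<Longrightarrow> NSrc \<alpha> = NSrc \<beta> \<Longrightarrow> NTgt \<alpha> = NTgt \<beta> \<Longrightarrow>
    \<alpha> = \<beta> \<longleftrightarrow> (\<forall>x \<in> Ob (FSrc (NSrc \<beta>)). NC \<alpha> x = NC \<beta> x)"
  by (auto intro: ntr_eqI)

context
  fixes E :: "'u small_cat" and l :: "('k, 'f, 'u fnc, 'u ntr) cone"
  assumes E: "ext_category E" and l: "di.precone E l"
begin

lemma leg_typed: 
  assumes "A \<in> KO"
  shows "small_functor (leg l A)" "FSrc (leg l A) = DD A" "FTgt (leg l A) = E"
  using di.precone_leg[OF l] assms by auto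

lemma cel_typed:
  assumes f: "f \<in> hom (One K) A B"
  shows "small_transformation (cel l f)"
    "NSrc (cel l f) = Cmp (One Cat) (leg l A) (slot2 (op2 K) DT A f)"
    "NTgt (cel l f) = Cmp (One Cat) (leg l B) (slot1 (op2 K) DT f B)"
    "FSrc (NSrc (cel l f)) = prod_cat (F0 Q A) (F0 R B)" "FTgt (NSrc (cel l f)) = E"
proof -
  have A: "A \<in> KO" using hom_ob[OF K f] by simp
  have f': "f \<in> Ar DJ" "Dm (One K) f = A" "Cd (One K) f = B" using f by (auto simp: hom_iff)
  show "small_transformation (cel l f)"
    "NSrc (cel l f) = Cmp (One Cat) (leg l A) (slot2 (op2 K) DT A f)"
    "NTgt (cel l f) = Cmp (One Cat) (leg l B) (slot1 (op2 K) DT f B)"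
    "FSrc (NSrc (cel l f)) = prod_cat (F0 Q A) (F0 R B)" "FTgt (NSrc (cel l f)) = E"
    using di.precone_cel(1-5)[OF l f'(1)] slot(5)[OF f A] f'(2,3) by auto
qed

lemma inv_iff:
  assumes f: "f \<in> hom (One K) A B"
  shows "invertible (Two Cat) (cel l f) \<longleftrightarrow>
    (\<forall>x \<in> Ob (F0 Q A). \<forall>w \<in> Ob (F0 R B). invertible E (NC (cel l f) (pr (x, w))))"
  using cel_typed[OF f] by (auto simp: invertible_Two_iff)

lemma id_iff:
  assumes A: "A \<in> KO"
  shows "cel l (kid A) = Idt (Two Cat) (leg l A) \<longleftrightarrow>
    (\<forall>x \<in> Ob (F0 Q A). \<forall>w \<in> Ob (F0 R A). NC (cel l (kid A)) (pr (x, w)) = Idt E (FO (leg l A) (pr (x, w))))"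
proof -
  note i = id_hom[OF K A]
  note L = leg_typed[OF A]
  \<comment> \<open>At an identity 1-cell both slots are identity functors, so the two cells to be
    compared are parallel.\<close>
  have s: "slot2 (op2 K) DT A (kid A) = Idt (One Cat) (DD A)" "slot1 (op2 K) DT (kid A) A = Idt (One Cat) (DD A)"
    using slot(1,2)[OF i A] A functor_Q functor_R by (simp_all add: prod_fnc_Idt)
  show ?thesis
    using cel_typed[OF i] L Cmp_Idt(1)[OF L(1)]
    by (subst ntr_eq_iff) (auto simp: s)
qed

text \<open>Once both sides are known to be parallel 2-cells, the equation is one between
  components. The effort goes into the types: \<open>T\<close> preserves composition in each
  variable and its two variables commute.\<close>

lemma cmp_iff:
  assumes f: "f \<in> hom (One K) A B" and g: "g \<in> hom (One K) B C"
  shows "cel l (kc g f) = Cmp (Two Cat) (rwhisk Cat (cel l g) (slot1 (op2 K) DT f C)) (rwhisk Cat (cel l f) (slot2 (op2 K) DT A g))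
    \<longleftrightarrow> (\<forall>x \<in> Ob (F0 Q A). \<forall>w \<in> Ob (F0 R C). NC (cel l (kc g f)) (pr (x, w)) =
       Cmp E (NC (cel l g) (pr (FO (F1 Q f) x, w))) (NC (cel l f) (pr (x, FO (F1 R g) w))))"
proof -
  have A: "A \<in> KO" "B \<in> KO" "C \<in> KO" using hom_ob[OF K f] hom_ob[OF K g] by auto
  note gf = cmp_hom[OF K f g]
  note L = leg_typed
  note cf = cel_typed[OF f] and cg = cel_typed[OF g] and cgf = cel_typed[OF gf]
  note Qf = functor_Q1[OF f] functor_R1[OF f] and Qg = functor_Q1[OF g] functor_R1[OF g]
  note I = functor_Q(1) functor_R(1)
  have idid: "Cmp (One Cat) (Idt (One Cat) X) (Idt (One Cat) X) = Idt (One Cat) X" if "ext_category X" for X :: "'u small_cat"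
    using Cmp_Idt(1)[of "Idt (One Cat) X"] that by simp
  have s1: "slot2 (op2 K) DT A (kc g f) = Cmp (One Cat) (slot2 (op2 K) DT A f) (slot2 (op2 K) DT A g)"
    using slot(1)[OF f A(1)] slot(1)[OF g A(1)] slot(1)[OF gf A(1)] functor_R(4)[OF f g] I A Qf Qg
      prod_fnc_Cmp[of "Idt (One Cat) (F0 Q A)" "F1 R g" "Idt (One Cat) (F0 Q A)" "F1 R f"] by (simp add: idid)
  have s2: "slot1 (op2 K) DT (kc g f) C = Cmp (One Cat) (slot1 (op2 K) DT g C) (slot1 (op2 K) DT f C)"
    using slot(2)[OF f A(3)] slot(2)[OF g A(3)] slot(2)[OF gf A(3)] functor_Q(4)[OF f g] I A Qf Qg
      prod_fnc_Cmp[of "F1 Q f" "Idt (One Cat) (F0 R C)" "F1 Q g" "Idt (One Cat) (F0 R C)"] by (simp add: idid)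
  \<comment> \<open>The actions of \<open>f\<close> on the first factor and of \<open>g\<close> on
    the second commute; this makes the two whiskered cells composable.\<close>
  have s3: "Cmp (One Cat) (slot1 (op2 K) DT f B) (slot2 (op2 K) DT A g) = Cmp (One Cat) (slot2 (op2 K) DT B g) (slot1 (op2 K) DT f C)"
    using slot(2)[OF f A(2)] slot(1)[OF g A(1)] slot(1)[OF g A(2)] slot(2)[OF f A(3)] I A Qf Qg
      prod_fnc_Cmp[of "Idt (One Cat) (F0 Q A)" "F1 R g" "F1 Q f" "Idt (One Cat) (F0 R B)"]
      prod_fnc_Cmp[of "F1 Q f" "Idt (One Cat) (F0 R C)" "Idt (One Cat) (F0 Q B)" "F1 R g"]
      Cmp_Idt[of "F1 Q f"] Cmp_Idt[of "F1 R g"] by simp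
  note sf = slot(3-)[OF f] and sg = slot(3-)[OF g]
  note wf = rwhisk_Cat[OF cf(1) sg(1)[OF A(1)]] and wg = rwhisk_Cat[OF cg(1) sf(2)[OF A(3)]]
  have tf: "FTgt (slot2 (op2 K) DT A g) = FSrc (NSrc (cel l f))" "FTgt (slot1 (op2 K) DT f C) = FSrc (NSrc (cel l g))"
    using cf cg sf sg A by auto
  note wf = wf[OF tf(1)] and wg = wg[OF tf(2)]
  have t: "NTgt (rwhisk Cat (cel l f) (slot2 (op2 K) DT A g)) = NSrc (rwhisk Cat (cel l g) (slot1 (op2 K) DT f C))"
    unfolding wf wg cf cg using sf sg A L s3 by (simp add: Cmp_One_assoc)
  have st: "small_transformation (Cmp (Two Cat) (rwhisk Cat (cel l g) (slot1 (op2 K) DT f C)) (rwhisk Cat (cel l f) (slot2 (op2 K) DT A g)))"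
    using wf wg t by (intro small_transformation_Cmp)
  have N1: "NSrc (cel l (kc g f)) = NSrc (rwhisk Cat (cel l f) (slot2 (op2 K) DT A g))"
    unfolding wf cf cgf s1 using sf sg A L by (simp add: Cmp_One_assoc)
  have N2: "NTgt (cel l (kc g f)) = NTgt (rwhisk Cat (cel l g) (slot1 (op2 K) DT f C))"
    unfolding wg cg cgf s2 using sf sg A L by (simp add: Cmp_One_assoc)
  have "cel l (kc g f) = Cmp (Two Cat) (rwhisk Cat (cel l g) (slot1 (op2 K) DT f C)) (rwhisk Cat (cel l f) (slot2 (op2 K) DT A g))
    \<longleftrightarrow> (\<forall>z \<in> Ob (prod_cat (F0 Q A) (F0 R C)). NC (cel l (kc g f)) z =
       Cmp E (NC (rwhisk Cat (cel l g) (slot1 (op2 K) DT f C)) z) (NC (rwhisk Cat (cel l f) (slot2 (op2 K) DT A g)) z))"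
    using cgf(4) cf(5) N1 N2 sf sg A L st cgf(1)
    by (subst ntr_eq_iff) (simp_all add: wf(2))
  also have "\<dots> \<longleftrightarrow> (\<forall>x \<in> Ob (F0 Q A). \<forall>w \<in> Ob (F0 R C). NC (cel l (kc g f)) (pr (x, w)) =
       Cmp E (NC (cel l g) (pr (FO (F1 Q f) x, w))) (NC (cel l f) (pr (x, FO (F1 R g) w))))"
    using wf(4) wg(4) sf sg A by simp
  finally show ?thesis .
qed

lemma cell_iff:
  assumes \<gamma>: "\<gamma> \<in> hom (Two K) f g" and f: "f \<in> hom (One K) A B"
  shows "Cmp (Two Cat) (lwhisk Cat (leg l B) (slot1_cell (op2 K) DT \<gamma> B)) (cel l f) =
      Cmp (Two Cat) (cel l g) (lwhisk Cat (leg l A) (slot2_cell (op2 K) DT A \<gamma>))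
    \<longleftrightarrow> (\<forall>x \<in> Ob (F0 Q A). \<forall>w \<in> Ob (F0 R B).
      Cmp E (FA (leg l B) (pr (NC (F2 Q \<gamma>) x, Idt (F0 R B) w))) (NC (cel l f) (pr (x, w))) =
      Cmp E (NC (cel l g) (pr (x, w))) (FA (leg l A) (pr (Idt (F0 Q A) x, NC (F2 R \<gamma>) w))))"
    (is "?L = ?R \<longleftrightarrow> _")
proof -
  have A: "A \<in> KO" "B \<in> KO" using hom_ob[OF K f] by auto
  have g: "g \<in> hom (One K) A B" using cell_hom[OF \<gamma>] f by simp
  note i = id_hom[OF K A(1)] id_hom[OF K A(2)]
  have iA: "kid A \<in> Ar (One K)" "kid B \<in> Ar (One K)" using i by (auto simp: hom_iff)
  note Qf = functor_Q1[OF f] functor_R1[OF f]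
  note L = leg_typed
  \<comment> \<open>The slot cells pair \<open>\<gamma>\<close> with the identity 2-cell of an
    identity 1-cell, whose image under \<open>Q\<close> or \<open>R\<close> is an identity
    transformation; the other coordinate thus contributes only identities.\<close>
  have iQ: "Idt (Two Cat) (F1 Q (kid A)) \<in> hom (Two Cat) (F1 Q (kid A)) (F1 Q (kid A))"
    "Idt (Two Cat) (F1 R (kid B)) \<in> hom (Two Cat) (F1 R (kid B)) (F1 R (kid B))"
    using functor_Q1[OF i(1)] functor_R1[OF i(2)] by (auto simp: hom_Two)
  have c1: "slot1_cell (op2 K) DT \<gamma> B \<in> hom (Two Cat) (slot1 (op2 K) DT f B) (slot1 (op2 K) DT g B)"
    using prod_ntr_hom(1)[OF functor_Q(5)[OF \<gamma>] iQ(2)]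
    by (simp add: slot1_cell_def slot1_def prod_fun2_def functor_R(6)[OF iA(2)])
  have c2: "slot2_cell (op2 K) DT A \<gamma> \<in> hom (Two Cat) (slot2 (op2 K) DT A f) (slot2 (op2 K) DT A g)"
    using prod_ntr_hom(1)[OF iQ(1) functor_R(5)[OF \<gamma>]]
    by (simp add: slot2_cell_def slot2_def prod_fun2_def functor_Q(6)[OF iA(1)])
  have n1: "NC (slot1_cell (op2 K) DT \<gamma> B) (pr (x, w)) = pr (NC (F2 Q \<gamma>) x, Idt (F0 R B) w)"
    if "x \<in> Ob (F0 Q A)" "w \<in> Ob (F0 R B)" for x w
    using prod_ntr_hom(2)[OF functor_Q(5)[OF \<gamma>] iQ(2), of x w] that Qf functor_R1[OF i(2)] A
    by (simp add: slot1_cell_def prod_fun2_def functor_R(6)[OF iA(2)] functor_R(2))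
  have n2: "NC (slot2_cell (op2 K) DT A \<gamma>) (pr (x, w)) = pr (Idt (F0 Q A) x, NC (F2 R \<gamma>) w)"
    if "x \<in> Ob (F0 Q A)" "w \<in> Ob (F0 R B)" for x w
    using prod_ntr_hom(2)[OF iQ(1) functor_R(5)[OF \<gamma>], of x w] that Qf functor_Q1[OF i(1)] A
    by (simp add: slot2_cell_def prod_fun2_def functor_Q(6)[OF iA(1)] functor_Q(2))
  note sf = slot(3-)[OF f] and sg = slot(3-)[OF g]
  have w1: "small_transformation (lwhisk Cat (leg l B) (slot1_cell (op2 K) DT \<gamma> B))"
    "NSrc (lwhisk Cat (leg l B) (slot1_cell (op2 K) DT \<gamma> B)) = Cmp (One Cat) (leg l B) (slot1 (op2 K) DT f B)"
    "NTgt (lwhisk Cat (leg l B) (slot1_cell (op2 K) DT \<gamma> B)) = Cmp (One Cat) (leg l B) (slot1 (op2 K) DT g B)"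
    "\<And>z. z \<in> Ob (prod_cat (F0 Q A) (F0 R B)) \<Longrightarrow>
      NC (lwhisk Cat (leg l B) (slot1_cell (op2 K) DT \<gamma> B)) z = FA (leg l B) (NC (slot1_cell (op2 K) DT \<gamma> B) z)"
    using lwhisk_Cat[of "slot1_cell (op2 K) DT \<gamma> B" "leg l B"] c1 L A sf by (auto simp: hom_Two)
  have w2: "small_transformation (lwhisk Cat (leg l A) (slot2_cell (op2 K) DT A \<gamma>))"
    "NSrc (lwhisk Cat (leg l A) (slot2_cell (op2 K) DT A \<gamma>)) = Cmp (One Cat) (leg l A) (slot2 (op2 K) DT A f)"
    "NTgt (lwhisk Cat (leg l A) (slot2_cell (op2 K) DT A \<gamma>)) = Cmp (One Cat) (leg l A) (slot2 (op2 K) DT A g)"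
    "\<And>z. z \<in> Ob (prod_cat (F0 Q A) (F0 R B)) \<Longrightarrow>
      NC (lwhisk Cat (leg l A) (slot2_cell (op2 K) DT A \<gamma>)) z = FA (leg l A) (NC (slot2_cell (op2 K) DT A \<gamma>) z)"
    using lwhisk_Cat[of "slot2_cell (op2 K) DT A \<gamma>" "leg l A"] c2 L A sf by (auto simp: hom_Two)
  note cf = cel_typed[OF f] and cg = cel_typed[OF g]
  have st: "small_transformation ?L" "small_transformation ?R"
    using w1 w2 cf cg by (auto intro!: small_transformation_Cmp)
  have "?L = ?R \<longleftrightarrow> (\<forall>z \<in> Ob (prod_cat (F0 Q A) (F0 R B)).
      Cmp E (NC (lwhisk Cat (leg l B) (slot1_cell (op2 K) DT \<gamma> B)) z) (NC (cel l f) z) =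
      Cmp E (NC (cel l g) z) (NC (lwhisk Cat (leg l A) (slot2_cell (op2 K) DT A \<gamma>)) z))"
    using st cf cg w1 w2 L A sf sg
    by (subst ntr_eq_iff) simp_all
  then show ?thesis
    using w1(4) w2(4) n1 n2 by simp
qed

end

end

section \<open>Inverses\<close>

definition inverse_of :: "('o, 'a) cat \<Rightarrow> 'a \<Rightarrow> 'a" where
  "inverse_of C f = (SOME g. g \<in> hom C (Cd C f) (Dm C f) \<and>
     Cmp C g f = Idt C (Dm C f) \<and> Cmp C f g = Idt C (Cd C f))"

lemma inverse_of:
  assumes "invertible C f" "f \<in> hom C x y"
  shows "inverse_of C f \<in> hom C y x" "Cmp C (inverse_of C f) f = Idt C x" "Cmp C f (inverse_of C f) = Idt C y"
proof -
  have "inverse_of C f \<in> hom C (Cd C f) (Dm C f) \<and> Cmp C (inverse_of C f) f = Idt C (Dm C f) \<and>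
      Cmp C f (inverse_of C f) = Idt C (Cd C f)"
    unfolding inverse_of_def by (rule someI_ex) (use assms in \<open>auto simp: invertible_def\<close>)
  then show "inverse_of C f \<in> hom C y x" "Cmp C (inverse_of C f) f = Idt C x" "Cmp C f (inverse_of C f) = Idt C y"
    using assms(2) by (auto simp: hom_iff)
qed

lemma invertibleI:
  "f \<in> hom C x y \<Longrightarrow> g \<in> hom C y x \<Longrightarrow> Cmp C g f = Idt C x \<Longrightarrow> Cmp C f g = Idt C y \<Longrightarrow> invertible C f"
  by (auto simp: invertible_def hom_iff)

lemma invertible_inverse_of: "invertible C f \<Longrightarrow> f \<in> hom C x y \<Longrightarrow> invertible C (inverse_of C f)"
  using inverse_of by (metis invertibleI)

context
  fixes C :: "('o, 'a) cat"
  assumes C: "category C"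
begin

text \<open>Uniqueness of inverses pins down the choice made by \<open>SOME\<close>, so that
  \<open>inverse_of\<close> commutes with composition, functors and itself.\<close>

lemma inverse_ofI:
  assumes f: "f \<in> hom C x y" and g: "g \<in> hom C y x" and e: "Cmp C g f = Idt C x" "Cmp C f g = Idt C y"
  shows "inverse_of C f = g"
proof -
  note i = inverse_of[OF invertibleI[OF f g e] f]
  have "inverse_of C f = Cmp C (inverse_of C f) (Cmp C f g)"
    using cmp_id[OF C i(1)] e by simp
  also have "\<dots> = g"
    using cmp_assoc[OF C g f i(1)] i(2) id_cmp[OF C g] by simp
  finally show ?thesis .
qed

lemma inverse_of_inverse_of:
  "invertible C f \<Longrightarrow> f \<in> hom C x y \<Longrightarrow> inverse_of C (inverse_of C f) = f"
  using inverse_ofI inverse_of by metis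

lemma inverse_of_Idt: "x \<in> Ob C \<Longrightarrow> inverse_of C (Idt C x) = Idt C x"
  using inverse_ofI id_hom[OF C] cmp_id[OF C] by metis

lemma invertible_Cmp:
  assumes f: "f \<in> hom C x y" "invertible C f" and g: "g \<in> hom C y z" "invertible C g"
  shows "invertible C (Cmp C g f)" "inverse_of C (Cmp C g f) = Cmp C (inverse_of C f) (inverse_of C g)"
proof -
  note i = inverse_of[OF f(2,1)] and j = inverse_of[OF g(2,1)]
  have "Cmp C (Cmp C (inverse_of C f) (inverse_of C g)) (Cmp C g f) = Idt C x"
    using cmp_assoc[OF C cmp_hom[OF C f(1) g(1)] j(1) i(1)] cmp_assoc[OF C f(1) g(1) j(1)] j(2) id_cmp[OF C f(1)] i(2)
    by simp
  moreover have "Cmp C (Cmp C g f) (Cmp C (inverse_of C f) (inverse_of C g)) = Idt C z"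
    using cmp_assoc[OF C cmp_hom[OF C j(1) i(1)] f(1) g(1)] cmp_assoc[OF C j(1) i(1) f(1)] i(3) id_cmp[OF C j(1)] j(3)
    by simp
  ultimately show "invertible C (Cmp C g f)" "inverse_of C (Cmp C g f) = Cmp C (inverse_of C f) (inverse_of C g)"
    using invertibleI[OF cmp_hom[OF C f(1) g(1)] cmp_hom[OF C j(1) i(1)]]
      inverse_ofI[OF cmp_hom[OF C f(1) g(1)] cmp_hom[OF C j(1) i(1)]] by auto
qed

text \<open>Composing with the inverses of the two parallel sides turns the square around.
  Naturality of cells, compatibility with 2-cells of \<open>K\<close> and compatibility with
  modifications all pass to the swapped dicone in this way.\<close>

lemma inverse_of_square:
  assumes f: "f \<in> hom C x y" "invertible C f" and g: "g \<in> hom C x' y'" "invertible C g"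
    and r: "r \<in> hom C x x'" and s: "s \<in> hom C y y'" and e: "Cmp C g r = Cmp C s f"
  shows "Cmp C (inverse_of C g) s = Cmp C r (inverse_of C f)"
proof -
  note i = inverse_of[OF f(2,1)] and j = inverse_of[OF g(2,1)]
  have "Cmp C (inverse_of C g) s = Cmp C (inverse_of C g) (Cmp C (Cmp C s f) (inverse_of C f))"
    using cmp_assoc[OF C i(1) f(1) s] i(3) cmp_id[OF C s] by simp
  also have "\<dots> = Cmp C (Cmp C (inverse_of C g) (Cmp C g r)) (inverse_of C f)"
    unfolding e[symmetric] using cmp_assoc[OF C i(1) cmp_hom[OF C r g(1)] j(1)] by simp
  also have "\<dots> = Cmp C r (inverse_of C f)"
    using cmp_assoc[OF C r g(1) j(1)] j(2) id_cmp[OF C r] by simp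
  finally show ?thesis .
qed

lemma invertible_Idt: "x \<in> Ob C \<Longrightarrow> invertible C (Idt C x)"
  using invertibleI id_hom[OF C] cmp_id[OF C] by metis

end

lemma functor_inverse:
  assumes F: "is_functor C D fo fa" and C: "category C" and D: "category D"
    and f: "f \<in> hom C x y" "invertible C f"
  shows "invertible D (fa f)" "inverse_of D (fa f) = fa (inverse_of C f)"
proof -
  note i = inverse_of[OF f(2,1)] and o = hom_ob[OF C f(1)]
  note h = functor_hom[OF F f(1)] functor_hom[OF F i(1)]
  have e: "Cmp D (fa (inverse_of C f)) (fa f) = Idt D (fo x)" "Cmp D (fa f) (fa (inverse_of C f)) = Idt D (fo y)"
    using functor_cmp[OF F f(1) i(1)] functor_cmp[OF F i(1) f(1)] i functor_id[OF F o(1)] functor_id[OF F o(2)]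
    by simp_all
  show "invertible D (fa f)" using h e by (rule invertibleI)
  show "inverse_of D (fa f) = fa (inverse_of C f)" using D h e by (rule inverse_ofI)
qed

section \<open>Pseudo-dicones as cones of a given shape\<close>

text \<open>Each axiom is a typing, an equation between composites and identities of
  \<open>E\<close>, or an invertibility, all of which functors preserve. Postcomposition of dicones
  rests on this.\<close>

lemma dicone_functor:
  assumes "dicone K Q R E lo la t" and F: "is_functor E E' fo fa" and E: "category E" "category E'"
  shows "dicone K Q R E' (\<lambda>A x w. fo (lo A x w)) (\<lambda>A p k. fa (la A p k)) (\<lambda>f x w. fa (t f x w))"
proof -
  interpret dicone K Q R E lo la t by fact
  show ?thesis
  proof (unfold_locales, goal_cases)
    case (1 A x w) then show ?case using lo[OF 1] functor_ob[OF F] by simp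
  next
    case (2 A x w) then show ?case using la_id[OF 2] functor_id[OF F lo[OF 2]] by simp
  next
    case (3 A p x x' k w w') then show ?case using functor_hom[OF F la_hom[OF 3]] by simp
  next
    case (4 A p x x' p' x'' k w w' k' w'') then show ?case
      using la_cmp[OF 4] functor_cmp[OF F la_hom[OF 4(1,2,4)] la_hom[OF 4(1,3,5)]] by simp
  next
    case (5 f A B x w) then show ?case using functor_hom[OF F t_hom[OF 5]] by simp
  next
    case (6 f A B p x x' k w w')
    have AB: "A \<in> KO" "B \<in> KO" using hom_ob[OF K 6(1)] by auto
    note o = hom_ob[OF category_QR(1)[OF AB(1)] 6(2)] hom_ob[OF category_QR(2)[OF AB(2)] 6(3)]
    show ?case
      using t_nat[OF 6] functor_cmp[OF F la_hom[OF AB(1) 6(2) functor_hom[OF functor_R1(4)[OF 6(1)] 6(3)]] t_hom[OF 6(1) o(2,4)]]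
        functor_cmp[OF F t_hom[OF 6(1) o(1,3)] la_hom[OF AB(2) functor_hom[OF functor_Q1(4)[OF 6(1)] 6(2)] 6(3)]] by simp
  next
    case (7 f A B x w) then show ?case using functor_inverse(1)[OF F E t_hom[OF 7] t_inv[OF 7]] by simp
  next
    case (8 A x w) then show ?case using t_id[OF 8] functor_id[OF F lo[OF 8]] by simp
  next
    case (9 f A B g C x w) then show ?case
      using t_cmp[OF 9] functor_cmp[OF F t_hom[OF 9(1,3) functor_ob[OF functor_R1(4)[OF 9(2)] 9(4)]]
          t_hom[OF 9(2) functor_ob[OF functor_Q1(4)[OF 9(1)] 9(3)] 9(4)]] by simp
  next
    case (10 \<gamma> f g A B x w)
    have AB: "A \<in> KO" "B \<in> KO" using hom_ob[OF K 10(2)] by auto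
    have g: "g \<in> hom (One K) A B" using cell_hom[OF 10(1)] 10(2) by simp
    have "NC (F2 Q \<gamma>) x \<in> hom (F0 Q B) (FO (F1 Q f) x) (FO (F1 Q g) x)"
      "NC (F2 R \<gamma>) w \<in> hom (F0 R A) (FO (F1 R f) w) (FO (F1 R g) w)"
      using hom_TwoD(1)[OF functor_Q(5)[OF 10(1)], of x] hom_TwoD(1)[OF functor_R(5)[OF 10(1)], of w]
        functor_Q1[OF 10(2)] functor_R1[OF 10(2)] 10(3,4) by auto
    note la1 = la_hom[OF AB(2) this(1) id_hom[OF category_QR(2)[OF AB(2)] 10(4)]]
      and la2 = la_hom[OF AB(1) id_hom[OF category_QR(1)[OF AB(1)] 10(3)] this(2)]
    show ?case
      using t_cell[OF 10] functor_cmp[OF F t_hom[OF 10(2-4)] la1] functor_cmp[OF F la2 t_hom[OF g 10(3,4)]] by simp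
  qed
qed

context cat_pair
begin

text \<open>A precone already has functors as legs and natural transformations as cells, which
  accounts for the first six axioms of \<open>dicone\<close>. The four that remain are the four
  conditions in \<open>pseudo_dicone\<close> beyond typing.\<close>

lemma DX_iff:
  assumes E: "ext_category E" and l: "di.precone E l"
  shows "DX E l \<longleftrightarrow>
    (\<forall>f A B. f \<in> hom (One K) A B \<longrightarrow> (\<forall>x \<in> Ob (F0 Q A). \<forall>w \<in> Ob (F0 R B). invertible E (NC (cel l f) (pr (x, w))))) \<and>
    (\<forall>A \<in> KO. \<forall>x \<in> Ob (F0 Q A). \<forall>w \<in> Ob (F0 R A). NC (cel l (kid A)) (pr (x, w)) = Idt E (FO (leg l A) (pr (x, w)))) \<and>
    (\<forall>f g A B C. f \<in> hom (One K) A B \<longrightarrow> g \<in> hom (One K) B C \<longrightarrow>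
      (\<forall>x \<in> Ob (F0 Q A). \<forall>w \<in> Ob (F0 R C). NC (cel l (kc g f)) (pr (x, w)) =
         Cmp E (NC (cel l g) (pr (FO (F1 Q f) x, w))) (NC (cel l f) (pr (x, FO (F1 R g) w))))) \<and>
    (\<forall>\<gamma> f g A B. \<gamma> \<in> hom (Two K) f g \<longrightarrow> f \<in> hom (One K) A B \<longrightarrow>
      (\<forall>x \<in> Ob (F0 Q A). \<forall>w \<in> Ob (F0 R B).
        Cmp E (FA (leg l B) (pr (NC (F2 Q \<gamma>) x, Idt (F0 R B) w))) (NC (cel l f) (pr (x, w))) =
        Cmp E (NC (cel l g) (pr (x, w))) (FA (leg l A) (pr (Idt (F0 Q A) x, NC (F2 R \<gamma>) w)))))"
    (is "_ \<longleftrightarrow> ?X")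
proof
  assume "DX E l"
  then interpret dicone K Q R E "\<lambda>A x w. FO (leg l A) (pr (x, w))" "\<lambda>A p k. FA (leg l A) (pr (p, k))"
     "\<lambda>f x w. NC (cel l f) (pr (x, w))"
    by (simp add: DX_def)
  show ?X
    using t_inv t_id t_cmp t_cell by (intro conjI allI impI ballI) auto
next
  assume X: ?X
  have fun_leg: "A \<in> KO \<Longrightarrow> is_functor (DD A) E (FO (leg l A)) (FA (leg l A))" for A
    using di.precone_leg(4)[OF l] by simp
  have lf: "A \<in> KO \<Longrightarrow> (\<forall>x \<in> Ob (F0 Q A). \<forall>y \<in> Ob (F0 R A). FO (leg l A) (pr (x, y)) \<in> Ob E \<and>
      FA (leg l A) (pr (Idt (F0 Q A) x, Idt (F0 R A) y)) = Idt E (FO (leg l A) (pr (x, y)))) \<and>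
    (\<forall>f g x x' y y'. f \<in> hom (F0 Q A) x x' \<longrightarrow> g \<in> hom (F0 R A) y y' \<longrightarrow>
       FA (leg l A) (pr (f, g)) \<in> hom E (FO (leg l A) (pr (x, y))) (FO (leg l A) (pr (x', y')))) \<and>
    (\<forall>f g f' g' x x' x'' y y' y''. f \<in> hom (F0 Q A) x x' \<longrightarrow> f' \<in> hom (F0 Q A) x' x'' \<longrightarrow> g \<in> hom (F0 R A) y y' \<longrightarrow> g' \<in> hom (F0 R A) y' y'' \<longrightarrow>
       FA (leg l A) (pr (Cmp (F0 Q A) f' f, Cmp (F0 R A) g' g)) = Cmp E (FA (leg l A) (pr (f', g'))) (FA (leg l A) (pr (f, g))))" for A
    using fun_leg[of A] is_functor_prod_cat_iff[OF category_QR(1) category_QR(2), of A A E] by blast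
  show "DX E l"
    unfolding DX_def
  proof (unfold_locales, goal_cases)
    case (1 A x w) then show ?case using lf[OF 1(1)] by blast
  next
    case (2 A x w) then show ?case using lf[OF 2(1)] by blast
  next
    case (3 A p x x' k w w') then show ?case using lf[OF 3(1)] by blast
  next
    case (4 A p x x' p' x'' k w w' k' w'') then show ?case using lf[OF 4(1)] by blast
  next
    case (5 f A B x w)
    have A: "A \<in> KO" "B \<in> KO" using hom_ob[OF K 5(1)] by auto
    have f: "f \<in> Ar DJ" "Dm (One K) f = A" "Cd (One K) f = B" using 5 by (auto simp: hom_iff)
    show ?case
      using di.precone_cel(6)[OF l f(1), of "pr (x, w)"] slot(3-)[OF 5(1) A(1)] slot(3-)[OF 5(1) A(2)] 5 f by simp
  next
    case (6 f A B p x x' k w w')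
    have A: "A \<in> KO" "B \<in> KO" using hom_ob[OF K 6(1)] by auto
    have f: "f \<in> Ar DJ" "Dm (One K) f = A" "Cd (One K) f = B" using 6 by (auto simp: hom_iff)
    show ?case
      using di.precone_cel(7)[OF l f(1), of "pr (p, k)" "pr (x, w)" "pr (x', w')"] slot(3-)[OF 6(1) A(1)] slot(3-)[OF 6(1) A(2)]
        f 6 6(2,3)[unfolded hom_iff] by simp
  next
    case 7 then show ?case using X[THEN conjunct1, rule_format] by blast
  next
    case 8 then show ?case using X[THEN conjunct2, THEN conjunct1, rule_format] by blast
  next
    case 9 then show ?case using X[THEN conjunct2, THEN conjunct2, THEN conjunct1, rule_format] by blast
  next
    case 10 then show ?case using X[THEN conjunct2, THEN conjunct2, THEN conjunct2, rule_format] by blast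
  qed
qed

text \<open>Reading the definition over \<open>op2 K\<close> and replacing quantifiers over arrows
  by typed \<open>hom\<close> statements leaves four conditions, matched one by one with those of
  \<open>DX_iff\<close>.\<close>

lemma pseudo_dicone_iff:
  assumes E: "ext_category E"
  shows "pseudo_dicone Cat (op2 K) DT E l \<longleftrightarrow> di.precone E l \<and> DX E l"
proof -
  have pre: "di.precone E l \<longleftrightarrow> leg l \<in> extensional KO \<and> cel l \<in> extensional (Ar (One K)) \<and>
      (\<forall>A \<in> KO. leg l A \<in> hom (One Cat) (F0 DT (A, A)) E) \<and>
      (\<forall>f \<in> Ar (One K). cel l f \<in> hom (Two Cat) (Cmp (One Cat) (leg l (Dm (One K) f)) (slot2 (op2 K) DT (Dm (One K) f) f))
         (Cmp (One Cat) (leg l (Cd (One K) f)) (slot1 (op2 K) DT f (Cd (One K) f))))"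
  proof -
    have "F0 DT (A, A) = DD A" for A by (simp add: prod_fun2_def)
    then show ?thesis by (simp add: di.precone_def)
  qed
  have "pseudo_dicone Cat (op2 K) DT E l \<longleftrightarrow> di.precone E l \<and>
     (\<forall>f \<in> Ar (One K). invertible (Two Cat) (cel l f)) \<and>
     (\<forall>A \<in> KO. cel l (kid A) = Idt (Two Cat) (leg l A)) \<and>
     (\<forall>f \<in> Ar (One K). \<forall>g \<in> Ar (One K). Cd (One K) g = Dm (One K) f \<longrightarrow>
        cel l (kc f g) = Cmp (Two Cat) (rwhisk Cat (cel l f) (slot1 (op2 K) DT g (Cd (One K) f)))
                    (rwhisk Cat (cel l g) (slot2 (op2 K) DT (Dm (One K) g) f))) \<and>
     (\<forall>\<gamma> \<in> Ar (Two K).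
        Cmp (Two Cat) (lwhisk Cat (leg l (cd0 K \<gamma>)) (slot1_cell (op2 K) DT \<gamma> (cd0 K \<gamma>))) (cel l (Dm (Two K) \<gamma>)) =
        Cmp (Two Cat) (cel l (Cd (Two K) \<gamma>)) (lwhisk Cat (leg l (dm0 K \<gamma>)) (slot2_cell (op2 K) DT (dm0 K \<gamma>) \<gamma>)))"
    unfolding pseudo_dicone_def pre op2_sel by blast
  also have "\<dots> \<longleftrightarrow> di.precone E l \<and>
     (\<forall>f A B. f \<in> hom (One K) A B \<longrightarrow> invertible (Two Cat) (cel l f)) \<and>
     (\<forall>A \<in> KO. cel l (kid A) = Idt (Two Cat) (leg l A)) \<and>
     (\<forall>f g A B C. f \<in> hom (One K) A B \<longrightarrow> g \<in> hom (One K) B C \<longrightarrow>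
        cel l (kc g f) = Cmp (Two Cat) (rwhisk Cat (cel l g) (slot1 (op2 K) DT f C)) (rwhisk Cat (cel l f) (slot2 (op2 K) DT A g))) \<and>
     (\<forall>\<gamma> f g A B. \<gamma> \<in> hom (Two K) f g \<longrightarrow> f \<in> hom (One K) A B \<longrightarrow>
        Cmp (Two Cat) (lwhisk Cat (leg l B) (slot1_cell (op2 K) DT \<gamma> B)) (cel l f) =
        Cmp (Two Cat) (cel l g) (lwhisk Cat (leg l A) (slot2_cell (op2 K) DT A \<gamma>)))"
    (is "_ \<longleftrightarrow> _ \<and> ?Y")
    using cell_typed(1) by (intro arg_cong2[of _ _ _ _ "(\<and>)"] refl) (auto simp: hom_iff)
  also have "\<dots> \<longleftrightarrow> di.precone E l \<and> DX E l"
  proof (rule conj_cong[OF refl])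
    assume l: "di.precone E l"
    show "?Y \<longleftrightarrow> DX E l"
      unfolding DX_iff[OF E l]
      by (intro arg_cong2[of _ _ _ _ "(\<and>)"] iff_allI imp_cong refl ball_cong
          inv_iff[OF E l] id_iff[OF E l] cmp_iff[OF E l] cell_iff[OF E l])
  qed
  finally show ?thesis .
qed

text \<open>The set of cones and the compatibility relation are spelled as in
  \<open>pseudo_dicones\<close>, so that \<open>di.U\<close> is that cone functor merely by
  unfolding.\<close>

sublocale di: cone_category DJ DD DS1 DS2 "Dm (One K)" "Cd (One K)" "\<lambda>E. {l. pseudo_dicone Cat (op2 K) DT E l}"
  "\<lambda>l l' \<rho>. \<forall>f \<in> Ar (One (op2 K)).
        Cmp (Two Cat) (cel l' f) (rwhisk Cat (\<rho> (Cd (One (op2 K)) f)) (slot2 (op2 K) DT (Cd (One (op2 K)) f) f)) =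
        Cmp (Two Cat) (rwhisk Cat (\<rho> (Dm (One (op2 K)) f)) (slot1 (op2 K) DT f (Dm (One (op2 K)) f))) (cel l f)"
  DX
proof (unfold_locales, goal_cases)
  case (1 E c) then show ?case by (simp add: pseudo_dicone_iff)
next
  case (2 E c d \<rho>) then show ?case using di.modification_compat_iff[OF 2(2-4)] by simp
qed

lemma di_U: "di.U = pseudo_dicones Cat (op2 K) DT"
  by (simp add: pseudo_dicones_def)

definition mk_di where
  "mk_di E lo la t = di.mk_cone E (\<lambda>A z. lo A (p1 z) (p2 z)) (\<lambda>A z. la A (p1 z) (p2 z)) (\<lambda>f z. t f (p1 z) (p2 z))"

lemma mk_di_sel:
  "A \<in> KO \<Longrightarrow> x \<in> Ob (F0 Q A) \<Longrightarrow> w \<in> Ob (F0 R A) \<Longrightarrow> FO (leg (mk_di E lo la t) A) (pr (x, w)) = lo A x w"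
  "A \<in> KO \<Longrightarrow> p \<in> Ar (F0 Q A) \<Longrightarrow> k \<in> Ar (F0 R A) \<Longrightarrow> FA (leg (mk_di E lo la t) A) (pr (p, k)) = la A p k"
  "f \<in> hom (One K) A B \<Longrightarrow> x \<in> Ob (F0 Q A) \<Longrightarrow> w \<in> Ob (F0 R B) \<Longrightarrow> NC (cel (mk_di E lo la t) f) (pr (x, w)) = t f x w"
proof -
  assume f: "f \<in> hom (One K) A B" and x: "x \<in> Ob (F0 Q A)" "w \<in> Ob (F0 R B)"
  have A: "A \<in> KO" "f \<in> Ar DJ" "Dm (One K) f = A" using hom_ob[OF K f] f by (auto simp: hom_iff)
  then show "NC (cel (mk_di E lo la t) f) (pr (x, w)) = t f x w"
    using x slot(3-)[OF f A(1)] by (simp add: mk_di_def di.mk_cone_sel)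
qed (simp_all add: mk_di_def di.mk_cone_sel)

lemma mk_di:
  assumes "dicone K Q R E lo la t" and E: "ext_category E"
  shows "pseudo_dicone Cat (op2 K) DT E (mk_di E lo la t)"
proof -
  interpret dicone K Q R E lo la t by fact
  have "di.precone E (mk_di E lo la t)"
    unfolding mk_di_def
  proof (rule di.precone_mk_cone[OF E])
    fix A assume "A \<in> Ob DJ"
    then have A: "A \<in> KO" by simp
    then show "is_functor (DD A) E (\<lambda>z. lo A (p1 z) (p2 z)) (\<lambda>z. la A (p1 z) (p2 z))"
      using lo[OF A] la_id[OF A] la_hom[OF A] la_cmp[OF A]
      by (subst is_functor_prod_cat_iff[OF category_QR(1)[OF A] category_QR(2)[OF A]]) simp
  next
    fix f z assume f0: "f \<in> Ar DJ" and z: "z \<in> Ob (FSrc (DS1 f))"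
    define A B where AB: "A = Dm (One K) f" "B = Cd (One K) f"
    have f: "f \<in> hom (One K) A B" using f0 AB by (simp add: hom_iff)
    have o: "A \<in> KO" "B \<in> KO" using hom_ob[OF K f] by auto
    obtain x w where x: "z = pr (x, w)" "x \<in> Ob (F0 Q A)" "w \<in> Ob (F0 R B)"
      using z slot(5)[OF f o(1)] AB by auto
    show "t f (p1 z) (p2 z) \<in> hom E (lo (Dm (One K) f) (p1 (FO (DS1 f) z)) (p2 (FO (DS1 f) z)))
        (lo (Cd (One K) f) (p1 (FO (DS2 f) z)) (p2 (FO (DS2 f) z)))"
      using t_hom[OF f x(2,3)] slot(3-)[OF f o(1)] slot(3-)[OF f o(2)] x AB by simp
  next
    fix f z z' g assume f0: "f \<in> Ar DJ" and g: "g \<in> hom (FSrc (DS1 f)) z z'"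
    define A B where AB: "A = Dm (One K) f" "B = Cd (One K) f"
    have f: "f \<in> hom (One K) A B" using f0 AB by (simp add: hom_iff)
    have o: "A \<in> KO" "B \<in> KO" using hom_ob[OF K f] by auto
    have "g \<in> hom (prod_cat (F0 Q A) (F0 R B)) z z'" using g slot(5)[OF f o(1)] AB by simp
    then obtain p k x x' w w' where x: "g = pr (p, k)" "z = pr (x, w)" "z' = pr (x', w')"
       "p \<in> hom (F0 Q A) x x'" "k \<in> hom (F0 R B) w w'" by (rule hom_prod_catE)
    then show "Cmp E (t f (p1 z') (p2 z')) (la (Dm (One K) f) (p1 (FA (DS1 f) g)) (p2 (FA (DS1 f) g))) =
       Cmp E (la (Cd (One K) f) (p1 (FA (DS2 f) g)) (p2 (FA (DS2 f) g))) (t f (p1 z) (p2 z))"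
      using t_nat[OF f x(4,5)] slot(11,12)[OF f o(1)] slot(11,12)[OF f o(2)] x AB x(4,5)[unfolded hom_iff] by simp
  qed
  moreover have "DX E (mk_di E lo la t)"
    unfolding DX_def by (rule dicone_cong[OF dicone_axioms]) (simp_all add: mk_di_sel)
  ultimately show ?thesis by (simp add: pseudo_dicone_iff[OF E])
qed

lemma di_act:
  assumes u: "small_functor u" and c: "di.precone (FSrc u) c" and X: "DX (FSrc u) c"
  shows "DX (FTgt u) (di.act u c)"
proof -
  have "dicone K Q R (FTgt u) (\<lambda>A x w. FO u (FO (leg c A) (pr (x, w)))) (\<lambda>A p k. FA u (FA (leg c A) (pr (p, k))))
     (\<lambda>f x w. FA u (NC (cel c f) (pr (x, w))))"
    by (rule dicone_functor[OF X[unfolded DX_def] small_functorD(7,3,4)[OF u]])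
  then show ?thesis
    unfolding DX_def
  proof (rule dicone_cong)
    fix f A B x w assume f: "f \<in> hom (One K) A B" and x: "x \<in> Ob (F0 Q A)" "w \<in> Ob (F0 R B)"
    have A: "A \<in> KO" "f \<in> Ar DJ" "Dm (One K) f = A" using hom_ob[OF K f] f by (auto simp: hom_iff)
    then show "NC (cel (di.act u c) f) (pr (x, w)) = FA u (NC (cel c f) (pr (x, w)))"
      using x slot(5)[OF f A(1)] by (simp add: di.act_sel[OF c u refl])
  qed (simp_all add: di.act_sel[OF c u refl])
qed

lemma di_eqI:
  assumes c: "di.precone E c" and d: "di.precone E d"
    and lo: "\<And>A x w. A \<in> KO \<Longrightarrow> x \<in> Ob (F0 Q A) \<Longrightarrow> w \<in> Ob (F0 R A) \<Longrightarrow>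
      FO (leg c A) (pr (x, w)) = FO (leg d A) (pr (x, w))"
    and la: "\<And>A p k. A \<in> KO \<Longrightarrow> p \<in> Ar (F0 Q A) \<Longrightarrow> k \<in> Ar (F0 R A) \<Longrightarrow>
      FA (leg c A) (pr (p, k)) = FA (leg d A) (pr (p, k))"
    and t: "\<And>f A B x w. f \<in> hom (One K) A B \<Longrightarrow> x \<in> Ob (F0 Q A) \<Longrightarrow> w \<in> Ob (F0 R B) \<Longrightarrow>
      NC (cel c f) (pr (x, w)) = NC (cel d f) (pr (x, w))"
  shows "c = d"
proof (rule di.precone_eqI[OF c d])
  fix f z assume f0: "f \<in> Ar DJ" and z: "z \<in> Ob (FSrc (DS1 f))"
  then have f: "f \<in> hom (One K) (Dm (One K) f) (Cd (One K) f)" by (simp add: hom_iff)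
  show "NC (cel c f) z = NC (cel d f) z"
    using z slot(5)[OF f hom_ob(1)[OF K f]] t[OF f] by auto
qed (use lo la in auto)

lemma di_modification_iff:
  "di.modification E c d r \<longleftrightarrow>
     (\<forall>A \<in> KO. \<forall>x \<in> Ob (F0 Q A). \<forall>w \<in> Ob (F0 R A).
        r A (pr (x, w)) \<in> hom E (FO (leg c A) (pr (x, w))) (FO (leg d A) (pr (x, w)))) \<and>
     (\<forall>A \<in> KO. \<forall>p k x x' w w'. p \<in> hom (F0 Q A) x x' \<longrightarrow> k \<in> hom (F0 R A) w w' \<longrightarrow>
        Cmp E (r A (pr (x', w'))) (FA (leg c A) (pr (p, k))) = Cmp E (FA (leg d A) (pr (p, k))) (r A (pr (x, w)))) \<and>
     (\<forall>f A B. f \<in> hom (One K) A B \<longrightarrow> (\<forall>x \<in> Ob (F0 Q A). \<forall>w \<in> Ob (F0 R B).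
        Cmp E (NC (cel d f) (pr (x, w))) (r A (pr (x, FO (F1 R f) w))) =
        Cmp E (r B (pr (FO (F1 Q f) x, w))) (NC (cel c f) (pr (x, w)))))"
proof -
  have 1: "(\<forall>g z z'. g \<in> hom (DD A) z z' \<longrightarrow>
        Cmp E (r A z') (FA (leg c A) g) = Cmp E (FA (leg d A) g) (r A z)) \<longleftrightarrow>
     (\<forall>p k x x' w w'. p \<in> hom (F0 Q A) x x' \<longrightarrow> k \<in> hom (F0 R A) w w' \<longrightarrow>
        Cmp E (r A (pr (x', w'))) (FA (leg c A) (pr (p, k))) = Cmp E (FA (leg d A) (pr (p, k))) (r A (pr (x, w))))"
    (is "?L \<longleftrightarrow> ?R") for A
  proof
    assume R: ?R
    show ?L
    proof (intro allI impI)
      fix g z z' assume "g \<in> hom (DD A) z z'"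
      then show "Cmp E (r A z') (FA (leg c A) g) = Cmp E (FA (leg d A) g) (r A z)"
      proof (rule hom_prod_catE)
        fix p k x x' w w' assume "g = pr (p, k)" "z = pr (x, w)" "z' = pr (x', w')"
          and "p \<in> hom (F0 Q A) x x'" "k \<in> hom (F0 R A) w w'"
        then show ?thesis using R by simp
      qed
    qed
  next
    assume L: ?L
    show ?R
    proof (intro allI impI)
      fix p k x x' w w' assume "p \<in> hom (F0 Q A) x x'" "k \<in> hom (F0 R A) w w'"
      then show "Cmp E (r A (pr (x', w'))) (FA (leg c A) (pr (p, k))) = Cmp E (FA (leg d A) (pr (p, k))) (r A (pr (x, w)))"
        by (intro L[rule_format]) simp
    qed
  qed
  have 2: "(\<forall>x \<in> Ob (FSrc (DS1 f)). Cmp E (NC (cel d f) x) (r (Dm (One K) f) (FO (DS1 f) x)) =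
       Cmp E (r (Cd (One K) f) (FO (DS2 f) x)) (NC (cel c f) x)) \<longleftrightarrow>
     (\<forall>x \<in> Ob (F0 Q A). \<forall>w \<in> Ob (F0 R B).
        Cmp E (NC (cel d f) (pr (x, w))) (r A (pr (x, FO (F1 R f) w))) =
        Cmp E (r B (pr (FO (F1 Q f) x, w))) (NC (cel c f) (pr (x, w))))"
    if f: "f \<in> hom (One K) A B" for f A B
  proof -
    have A: "A \<in> KO" "B \<in> KO" "Dm (One K) f = A" "Cd (One K) f = B" using hom_ob[OF K f] f by (auto simp: hom_iff)
    then show ?thesis using slot(3-)[OF f A(1)] slot(3-)[OF f A(2)] by simp
  qed
  have 3: "(\<forall>f \<in> Ar (One K). \<forall>x \<in> Ob (FSrc (DS1 f)). Cmp E (NC (cel d f) x) (r (Dm (One K) f) (FO (DS1 f) x)) =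
       Cmp E (r (Cd (One K) f) (FO (DS2 f) x)) (NC (cel c f) x)) \<longleftrightarrow>
     (\<forall>f A B. f \<in> hom (One K) A B \<longrightarrow> (\<forall>x \<in> Ob (F0 Q A). \<forall>w \<in> Ob (F0 R B).
        Cmp E (NC (cel d f) (pr (x, w))) (r A (pr (x, FO (F1 R f) w))) =
        Cmp E (r B (pr (FO (F1 Q f) x, w))) (NC (cel c f) (pr (x, w)))))"
    (is "?L \<longleftrightarrow> ?R")
  proof
    assume L: ?L
    show ?R
    proof (intro allI impI)
      fix f A B assume f: "f \<in> hom (One K) A B"
      then have "f \<in> Ar (One K)" by (simp add: hom_iff)
      then show "\<forall>x \<in> Ob (F0 Q A). \<forall>w \<in> Ob (F0 R B).
          Cmp E (NC (cel d f) (pr (x, w))) (r A (pr (x, FO (F1 R f) w))) =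
          Cmp E (r B (pr (FO (F1 Q f) x, w))) (NC (cel c f) (pr (x, w)))"
        using L 2[OF f] by blast
    qed
  next
    assume R: ?R
    show ?L
    proof (rule ballI)
      fix f assume f: "f \<in> Ar (One K)"
      note h = hom_self[OF f]
      show "\<forall>x \<in> Ob (FSrc (DS1 f)). Cmp E (NC (cel d f) x) (r (Dm (One K) f) (FO (DS1 f) x)) =
          Cmp E (r (Cd (One K) f) (FO (DS2 f) x)) (NC (cel c f) x)"
        using 2[OF h] R[rule_format, OF h] by blast
    qed
  qed
  show ?thesis
    unfolding di.modification_def 1 using 3 by simp
qed

end

section \<open>Sigma-cones in elementary terms\<close>

context cat_pair
begin

text \<open>The memberships of \<open>A\<close>, \<open>B\<close> and \<open>y\<close> follow from
  these three conditions, see \<open>arrD\<close>; a predicate in six arguments avoids destructuring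
  nested tuples.\<close>

definition arr where
  "arr x A f \<phi> y B \<longleftrightarrow> f \<in> hom (One K) A B \<and> x \<in> Ob (F0 Q A) \<and> \<phi> \<in> hom (F0 Q B) (FO (F1 Q f) x) y"

lemma arrD:
  assumes "arr x A f \<phi> y B"
  shows "f \<in> hom (One K) A B" "x \<in> Ob (F0 Q A)" "\<phi> \<in> hom (F0 Q B) (FO (F1 Q f) x) y"
    "A \<in> KO" "B \<in> KO" "y \<in> Ob (F0 Q B)"
proof -
  show f: "f \<in> hom (One K) A B" and "x \<in> Ob (F0 Q A)" and p: "\<phi> \<in> hom (F0 Q B) (FO (F1 Q f) x) y"
    using assms by (auto simp: arr_def)
  show "A \<in> KO" and B: "B \<in> KO" using hom_ob[OF K f] by auto
  show "y \<in> Ob (F0 Q B)" using hom_ob[OF category_QR(1)[OF B] p] by simp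
qed

lemma El_ar_iff: "((x, A), (f, \<phi>), (y, B)) \<in> El_ar K Q \<longleftrightarrow> arr x A f \<phi> y B"
proof -
  have "((x, A), (f, \<phi>), (y, B)) \<in> El_ar K Q \<longleftrightarrow>
      arr x A f \<phi> y B \<and> A \<in> KO \<and> B \<in> KO \<and> y \<in> Ob (F0 Q B)"
    unfolding El_ar_def El_ob_def arr_def mem_Collect_eq split by blast
  then show ?thesis using arrD[of x A f \<phi> y B] by blast
qed

lemma El_arE:
  assumes "u \<in> El_ar K Q"
  obtains x A f \<phi> y B where "u = ((x, A), (f, \<phi>), (y, B))" "arr x A f \<phi> y B"
proof -
  obtain a p b where u: "u = (a, p, b)" by (rule prod_cases3)
  obtain x A where a: "a = (x, A)" by (rule prod.exhaust)
  obtain f \<phi> where p: "p = (f, \<phi>)" by (rule prod.exhaust)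
  obtain y B where b: "b = (y, B)" by (rule prod.exhaust)
  show thesis
    using assms unfolding u a p b El_ar_iff by (rule that[unfolded u a p b, OF refl])
qed

text \<open>These are the arrows in the fibre over \<open>A\<close>, called vertical below.\<close>

lemma arr_id: "A \<in> KO \<Longrightarrow> p \<in> hom (F0 Q A) x y \<Longrightarrow> arr x A (kid A) p y A"
  using hom_ob[OF category_QR(1)] id_hom[OF K] by (simp add: arr_def functor_Q(2))

lemma arr_cart: "f \<in> hom (One K) A B \<Longrightarrow> x \<in> Ob (F0 Q A) \<Longrightarrow>
    arr x A f (Idt (F0 Q B) (FO (F1 Q f) x)) (FO (F1 Q f) x) B"
  unfolding arr_def using functor_ob[OF functor_Q1(4)] hom_ob(2)[OF K] id_hom[OF category_QR(1)] by simp

lemma arr_cmp: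
  assumes u: "arr x A f \<phi> y B" and v: "arr y B g \<psi> z C"
  shows "arr x A (kc g f) (Cmp (F0 Q C) \<psi> (FA (F1 Q g) \<phi>)) z C"
  using cmp_hom[OF K arrD(1)[OF u] arrD(1)[OF v]] arrD(2)[OF u] functor_Q1(2)[OF arrD(1)[OF u]]
    cmp_hom[OF category_QR(1)[OF arrD(5)[OF v]] functor_hom[OF functor_Q1(4)[OF arrD(1)[OF v]] arrD(3)[OF u]] arrD(3)[OF v]]
  by (simp add: arr_def functor_Q(4)[OF arrD(1)[OF u] arrD(1)[OF v]])

text \<open>The source of a 2-cell of elements is forced by its target and by
  \<open>\<gamma>\<close>. Hence the 2-cells can be parametrised by an arrow
  \<open>(g, \<psi>)\<close> and a 2-cell of \<open>K\<close> into \<open>g\<close>.\<close>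

lemma arr_cell:
  assumes v: "arr x A g \<psi> y B" and \<gamma>: "\<gamma> \<in> hom (Two K) f g"
  shows "arr x A f (Cmp (F0 Q B) \<psi> (NC (F2 Q \<gamma>) x)) y B"
proof -
  have f: "f \<in> hom (One K) A B" using cell_hom(1)[OF \<gamma>] arrD(1)[OF v] by simp
  have "NC (F2 Q \<gamma>) x \<in> hom (F0 Q B) (FO (F1 Q f) x) (FO (F1 Q g) x)"
    using hom_TwoD(1)[OF functor_Q(5)[OF \<gamma>], of x] arrD(2)[OF v] functor_Q1[OF f] by simp
  then show ?thesis
    using f arrD(2)[OF v] cmp_hom[OF category_QR(1)[OF arrD(5)[OF v]] _ arrD(3)[OF v]] by (simp add: arr_def)
qed

end

text \<open>\<open>so\<close> and \<open>sa\<close> are the object and arrow parts of the legs, \<open>st\<close> the components of the 2-cells.\<close>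

locale sigma = cat_pair K Q R
  for K :: "('k, 'f, 'c) cat2" and Q R :: "('k, 'f, 'c, 'u::infinite) cat_functor" +
  fixes E :: "'u small_cat" and so sa :: "('k, 'u) el0 \<Rightarrow> 'u \<Rightarrow> 'u" and st :: "('k, 'f, 'u) el1 \<Rightarrow> 'u \<Rightarrow> 'u"
  assumes sf: "A \<in> Ob (One K) \<Longrightarrow> x \<in> Ob (F0 Q A) \<Longrightarrow> is_functor (F0 R A) E (so (x, A)) (sa (x, A))"
    and st_hom: "arr x A f \<phi> y B \<Longrightarrow> w \<in> Ob (F0 R B) \<Longrightarrow>
      st ((x, A), (f, \<phi>), (y, B)) w \<in> hom E (so (x, A) (FO (F1 R f) w)) (so (y, B) w)"
    and st_nat: "arr x A f \<phi> y B \<Longrightarrow> k \<in> hom (F0 R B) w w' \<Longrightarrow>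
      Cmp E (st ((x, A), (f, \<phi>), (y, B)) w') (sa (x, A) (FA (F1 R f) k)) = Cmp E (sa (y, B) k) (st ((x, A), (f, \<phi>), (y, B)) w)"
    and st_inv: "arr x A f \<phi> y B \<Longrightarrow> invertible (F0 Q B) \<phi> \<Longrightarrow> w \<in> Ob (F0 R B) \<Longrightarrow>
      invertible E (st ((x, A), (f, \<phi>), (y, B)) w)"
    and st_id: "A \<in> Ob (One K) \<Longrightarrow> x \<in> Ob (F0 Q A) \<Longrightarrow> w \<in> Ob (F0 R A) \<Longrightarrow>
      st ((x, A), (Idt (One K) A, Idt (F0 Q A) x), (x, A)) w = Idt E (so (x, A) w)"
    and st_cmp: "arr x A f \<phi> y B \<Longrightarrow> arr y B g \<psi> z C \<Longrightarrow> w \<in> Ob (F0 R C) \<Longrightarrow>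
      st ((x, A), (Cmp (One K) g f, Cmp (F0 Q C) \<psi> (FA (F1 Q g) \<phi>)), (z, C)) w =
      Cmp E (st ((y, B), (g, \<psi>), (z, C)) w) (st ((x, A), (f, \<phi>), (y, B)) (FO (F1 R g) w))"
    and st_cell: "arr x A g \<psi> y B \<Longrightarrow> \<gamma> \<in> hom (Two K) f g \<Longrightarrow> w \<in> Ob (F0 R B) \<Longrightarrow>
      Cmp E (st ((x, A), (g, \<psi>), (y, B)) w) (sa (x, A) (NC (F2 R \<gamma>) w)) =
      st ((x, A), (f, Cmp (F0 Q B) \<psi> (NC (F2 Q \<gamma>) x)), (y, B)) w"

context cat_pair
begin

abbreviation SJ where "SJ \<equiv> One (op2 (El K Q))"
abbreviation SF where "SF \<equiv> comp_fun2 R El_proj"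
abbreviation SD where "SD \<equiv> F0 SF"
abbreviation SS where "SS \<equiv> F1 SF"
text \<open>\<open>sdm\<close> and \<open>scd\<close> are named after the direction in
  \<open>El K Q\<close>; the cones are indexed by the opposite, hence the exchange of
  \<open>Cd\<close> and \<open>Dm\<close>.\<close>

abbreviation sdm where "sdm \<equiv> Cd SJ"
abbreviation scd where "scd \<equiv> Dm SJ"
abbreviation SI where "SI u \<equiv> Idt (One Cat) (SD (scd u))"

lemma SJ_sel [simp]:
  "Ob SJ = El_ob K Q" "Ar SJ = El_ar K Q" "sdm (a, p, b) = a" "scd (a, p, b) = b" "Idt SJ = El_id K Q"
  "Cmp SJ v u = El_comp K Q u v" "SD (x, A) = F0 R A" "SS (a, (f, \<phi>), b) = F1 R f"
  by (simp_all add: op2_def op1_def El_def comp_fun2_def El_proj_def)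

lemma El_ob_iff: "(x, A) \<in> El_ob K Q \<longleftrightarrow> A \<in> KO \<and> x \<in> Ob (F0 Q A)"
  by (simp add: El_ob_def)

lemma El_ar_typed:
  assumes "u \<in> El_ar K Q"
  shows "small_functor (SS u)" "FTgt (SS u) = SD (sdm u)" "FSrc (SS u) = SD (scd u)"
    "ext_category (SD (scd u))" "sdm u \<in> El_ob K Q" "scd u \<in> El_ob K Q"
proof -
  obtain x A f \<phi> y B where u: "u = ((x, A), (f, \<phi>), (y, B))" and a: "arr x A f \<phi> y B"
    using assms by (rule El_arE)
  note a = arrD[OF a]
  show "small_functor (SS u)" "FTgt (SS u) = SD (sdm u)" "FSrc (SS u) = SD (scd u)"
    "ext_category (SD (scd u))" "sdm u \<in> El_ob K Q" "scd u \<in> El_ob K Q"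
    using functor_R1[OF a(1)] functor_R(1) a by (simp_all add: u El_ob_iff)
qed

sublocale si: cone_shape SJ SD SS SI sdm scd
proof (unfold_locales, goal_cases)
  case (1 i) then show ?case using functor_R(1) by (auto simp: El_ob_def)
qed (simp_all add: El_ar_typed)

definition SX where
  "SX E l \<longleftrightarrow> sigma K Q R E (\<lambda>i. FO (leg l i)) (\<lambda>i. FA (leg l i)) (\<lambda>u. NC (cel l u))"

context
  fixes E :: "'u small_cat" and l :: "(('k, 'u) el0, ('k, 'f, 'u) el1, 'u fnc, 'u ntr) cone"
  assumes E: "ext_category E" and l: "si.precone E l"
begin

lemma sleg: 
  assumes "A \<in> KO" "x \<in> Ob (F0 Q A)"
  shows "small_functor (leg l (x, A))" "FSrc (leg l (x, A)) = F0 R A" "FTgt (leg l (x, A)) = E"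
    "is_functor (F0 R A) E (FO (leg l (x, A))) (FA (leg l (x, A)))"
  using si.precone_leg[OF l, of "(x, A)"] assms by (auto simp: El_ob_iff)

lemma scel:
  assumes u: "arr x A f \<phi> y B"
  shows "small_transformation (cel l ((x, A), (f, \<phi>), (y, B)))"
    "NSrc (cel l ((x, A), (f, \<phi>), (y, B))) = Cmp (One Cat) (leg l (x, A)) (F1 R f)"
    "NTgt (cel l ((x, A), (f, \<phi>), (y, B))) = leg l (y, B)"
    "w \<in> Ob (F0 R B) \<Longrightarrow> NC (cel l ((x, A), (f, \<phi>), (y, B))) w \<in> hom E (FO (leg l (x, A)) (FO (F1 R f) w)) (FO (leg l (y, B)) w)"
    "k \<in> hom (F0 R B) w w' \<Longrightarrow>
      Cmp E (NC (cel l ((x, A), (f, \<phi>), (y, B))) w') (FA (leg l (x, A)) (FA (F1 R f) k)) =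
      Cmp E (FA (leg l (y, B)) k) (NC (cel l ((x, A), (f, \<phi>), (y, B))) w)"
proof -
  note a = arrD[OF u]
  have v: "((x, A), (f, \<phi>), (y, B)) \<in> Ar SJ" using u by (simp add: El_ar_iff)
  note p = si.precone_cel[OF l v]
  note L = sleg[OF a(5,6)]
  show "small_transformation (cel l ((x, A), (f, \<phi>), (y, B)))"
    "NSrc (cel l ((x, A), (f, \<phi>), (y, B))) = Cmp (One Cat) (leg l (x, A)) (F1 R f)"
    "NTgt (cel l ((x, A), (f, \<phi>), (y, B))) = leg l (y, B)"
    using p(1-3) L Cmp_Idt(1)[OF L(1)] by simp_all
  show "w \<in> Ob (F0 R B) \<Longrightarrow> NC (cel l ((x, A), (f, \<phi>), (y, B))) w \<in> hom E (FO (leg l (x, A)) (FO (F1 R f) w)) (FO (leg l (y, B)) w)"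
    using p(6)[of w] functor_R1[OF a(1)] by simp
  show "k \<in> hom (F0 R B) w w' \<Longrightarrow>
      Cmp E (NC (cel l ((x, A), (f, \<phi>), (y, B))) w') (FA (leg l (x, A)) (FA (F1 R f) k)) =
      Cmp E (FA (leg l (y, B)) k) (NC (cel l ((x, A), (f, \<phi>), (y, B))) w)"
    using p(7)[of k w w'] functor_R1[OF a(1)] by (simp add: hom_iff)
qed

lemma sinv_iff:
  assumes u: "arr x A f \<phi> y B"
  shows "invertible (Two Cat) (cel l ((x, A), (f, \<phi>), (y, B))) \<longleftrightarrow>
    (\<forall>w \<in> Ob (F0 R B). invertible E (NC (cel l ((x, A), (f, \<phi>), (y, B))) w))"
  using scel(1,2)[OF u] functor_R1[OF arrD(1)[OF u]] sleg[OF arrD(4,2)[OF u]] by (simp add: invertible_Two_iff)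

lemma sid_iff:
  assumes A: "A \<in> KO" "x \<in> Ob (F0 Q A)"
  shows "cel l (El_id K Q (x, A)) = Idt (Two Cat) (leg l (x, A)) \<longleftrightarrow>
    (\<forall>w \<in> Ob (F0 R A). NC (cel l ((x, A), (kid A, Idt (F0 Q A) x), (x, A))) w = Idt E (FO (leg l (x, A)) w))"
proof -
  note c = scel[OF arr_id[OF A(1) id_hom[OF category_QR(1)[OF A(1)] A(2)]]] and L = sleg[OF A]
  show ?thesis
    using c L Cmp_Idt(1)[OF L(1)] functor_R(2)[OF A(1)] unfolding El_id_def split
    by (subst ntr_eq_iff) auto
qed

lemma scmp_iff:
  assumes u: "arr x A f \<phi> y B" and v: "arr y B g \<psi> z C"
  shows "cel l (El_comp K Q ((y, B), (g, \<psi>), (z, C)) ((x, A), (f, \<phi>), (y, B))) =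
      Cmp (Two Cat) (cel l ((y, B), (g, \<psi>), (z, C))) (rwhisk Cat (cel l ((x, A), (f, \<phi>), (y, B))) (F1 R g)) \<longleftrightarrow>
    (\<forall>w \<in> Ob (F0 R C). NC (cel l ((x, A), (kc g f, Cmp (F0 Q C) \<psi> (FA (F1 Q g) \<phi>)), (z, C))) w =
      Cmp E (NC (cel l ((y, B), (g, \<psi>), (z, C))) w) (NC (cel l ((x, A), (f, \<phi>), (y, B))) (FO (F1 R g) w)))"
    (is "?L = ?R \<longleftrightarrow> _")
proof -
  note a = arrD[OF u] and b = arrD[OF v]
  note cu = scel[OF u] and cv = scel[OF v] and cvu = scel[OF arr_cmp[OF u v]]
  note L = sleg[OF a(4,2)] and L' = sleg[OF b(4,2)]
  note f = functor_R1[OF a(1)] and g = functor_R1[OF b(1)]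
  have e: "El_comp K Q ((y, B), (g, \<psi>), (z, C)) ((x, A), (f, \<phi>), (y, B)) =
      ((x, A), (kc g f, Cmp (F0 Q C) \<psi> (FA (F1 Q g) \<phi>)), (z, C))"
    by (simp add: El_comp_def)
  have t: "FTgt (F1 R g) = FSrc (NSrc (cel l ((x, A), (f, \<phi>), (y, B))))"
    using cu f g by simp
  note w = rwhisk_Cat[OF cu(1) g(1) t]
  have as: "Cmp (One Cat) (Cmp (One Cat) (leg l (x, A)) (F1 R f)) (F1 R g) = Cmp (One Cat) (leg l (x, A)) (Cmp (One Cat) (F1 R f) (F1 R g))"
    using L f g by (intro Cmp_One_assoc) simp_all
  have s: "small_transformation ?R"
    using w cv cu by (intro small_transformation_Cmp) simp_all
  have "?L = ?R \<longleftrightarrow> (\<forall>w \<in> Ob (F0 R C). NC (cel l ((x, A), (kc g f, Cmp (F0 Q C) \<psi> (FA (F1 Q g) \<phi>)), (z, C))) w =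
      Cmp E (NC (cel l ((y, B), (g, \<psi>), (z, C))) w) (NC (rwhisk Cat (cel l ((x, A), (f, \<phi>), (y, B))) (F1 R g)) w))"
    unfolding e using s cvu(1-3) w(2) cu cv f g L as functor_R(4)[OF a(1) b(1)]
    by (subst ntr_eq_iff) simp_all
  then show ?thesis using w(4) g by simp
qed

lemma scell_iff:
  assumes v: "arr x A g \<psi> y B" and \<gamma>: "\<gamma> \<in> hom (Two K) f g"
  shows "Cmp (Two Cat) (cel l ((x, A), (g, \<psi>), (y, B))) (lwhisk Cat (leg l (x, A)) (F2 R \<gamma>)) =
      cel l ((x, A), (f, Cmp (F0 Q B) \<psi> (NC (F2 Q \<gamma>) x)), (y, B)) \<longleftrightarrow>
    (\<forall>w \<in> Ob (F0 R B). Cmp E (NC (cel l ((x, A), (g, \<psi>), (y, B))) w) (FA (leg l (x, A)) (NC (F2 R \<gamma>) w)) =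
       NC (cel l ((x, A), (f, Cmp (F0 Q B) \<psi> (NC (F2 Q \<gamma>) x)), (y, B))) w)"
    (is "?L = ?R \<longleftrightarrow> _")
proof -
  note b = arrD[OF v] and u = arr_cell[OF v \<gamma>]
  note cu = scel[OF u] and cv = scel[OF v]
  note L = sleg[OF b(4,2)]
  note f = functor_R1[OF arrD(1)[OF u]] and g = functor_R1[OF b(1)]
  have c: "small_transformation (F2 R \<gamma>)" "NSrc (F2 R \<gamma>) = F1 R f" "NTgt (F2 R \<gamma>) = F1 R g"
    using functor_R(5)[OF \<gamma>] by (auto simp: hom_Two)
  have "FTgt (NSrc (F2 R \<gamma>)) = FSrc (leg l (x, A))" using c f L by simp
  note w = lwhisk_Cat[OF c(1) L(1) this]
  have s: "small_transformation ?L"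
    using w cv cu c by (intro small_transformation_Cmp) simp_all
  have "?L = ?R \<longleftrightarrow> (\<forall>w \<in> Ob (F0 R B). Cmp E (NC (cel l ((x, A), (g, \<psi>), (y, B))) w) (NC (lwhisk Cat (leg l (x, A)) (F2 R \<gamma>)) w) =
       NC (cel l ((x, A), (f, Cmp (F0 Q B) \<psi> (NC (F2 Q \<gamma>) x)), (y, B))) w)"
    using s cu(1-3) w(2,3) cv f g L c
    by (subst ntr_eq_iff) simp_all
  then show ?thesis using w(4) c f by simp
qed

text \<open>The typing of the precone gives the first three axioms of \<open>sigma\<close>; the
  other four correspond to the conditions in \<open>sigma_cone\<close> on the class of cartesian
  arrows, identities, composites and 2-cells.\<close>

lemma SX_iff:
  "SX E l \<longleftrightarrow>
    (\<forall>x A f \<phi> y B. arr x A f \<phi> y B \<longrightarrow> invertible (F0 Q B) \<phi> \<longrightarrow>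
       (\<forall>w \<in> Ob (F0 R B). invertible E (NC (cel l ((x, A), (f, \<phi>), (y, B))) w))) \<and>
    (\<forall>x A. A \<in> KO \<longrightarrow> x \<in> Ob (F0 Q A) \<longrightarrow>
       (\<forall>w \<in> Ob (F0 R A). NC (cel l ((x, A), (kid A, Idt (F0 Q A) x), (x, A))) w = Idt E (FO (leg l (x, A)) w))) \<and>
    (\<forall>x A f \<phi> y B g \<psi> z C. arr x A f \<phi> y B \<longrightarrow> arr y B g \<psi> z C \<longrightarrow>
       (\<forall>w \<in> Ob (F0 R C). NC (cel l ((x, A), (kc g f, Cmp (F0 Q C) \<psi> (FA (F1 Q g) \<phi>)), (z, C))) w =
          Cmp E (NC (cel l ((y, B), (g, \<psi>), (z, C))) w) (NC (cel l ((x, A), (f, \<phi>), (y, B))) (FO (F1 R g) w)))) \<and>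
    (\<forall>x A g \<psi> y B \<gamma> f. arr x A g \<psi> y B \<longrightarrow> \<gamma> \<in> hom (Two K) f g \<longrightarrow>
       (\<forall>w \<in> Ob (F0 R B). Cmp E (NC (cel l ((x, A), (g, \<psi>), (y, B))) w) (FA (leg l (x, A)) (NC (F2 R \<gamma>) w)) =
          NC (cel l ((x, A), (f, Cmp (F0 Q B) \<psi> (NC (F2 Q \<gamma>) x)), (y, B))) w))"
    (is "_ \<longleftrightarrow> ?X")
proof
  assume "SX E l"
  then interpret sigma K Q R E "\<lambda>i. FO (leg l i)" "\<lambda>i. FA (leg l i)" "\<lambda>u. NC (cel l u)"
    by (simp add: SX_def)
  show ?X
    using st_inv st_id st_cmp st_cell by (intro conjI allI impI ballI) auto
next
  assume X: ?X
  show "SX E l"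
    unfolding SX_def
  proof (unfold_locales, goal_cases)
    case (1 A x) then show ?case by (rule sleg(4))
  next
    case 2 then show ?case by (rule scel(4))
  next
    case 3 then show ?case by (rule scel(5))
  next
    case 4 then show ?case using X[THEN conjunct1, rule_format] by blast
  next
    case 5 then show ?case using X[THEN conjunct2, THEN conjunct1, rule_format] by blast
  next
    case 6 then show ?case using X[THEN conjunct2, THEN conjunct2, THEN conjunct1, rule_format] by blast
  next
    case 7 then show ?case using X[THEN conjunct2, THEN conjunct2, THEN conjunct2, rule_format] by blast
  qed
qed

end

abbreviation SC where "SC \<equiv> El_cart K Q"

lemma sigma_cone_iff:
  assumes E: "ext_category E"
  shows "sigma_cone Cat (op2 (El K Q)) SC SF E l \<longleftrightarrow> si.precone E l \<and> SX E l"
proof -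
  have Ar2: "Two (op2 (El K Q)) = Two (El K Q)" by (simp add: op2_def)
  have pre: "si.precone E l \<longleftrightarrow> leg l \<in> extensional (Ob SJ) \<and> cel l \<in> extensional (Ar SJ) \<and>
     (\<forall>i \<in> Ob SJ. leg l i \<in> hom (One Cat) (F0 SF i) E) \<and>
     (\<forall>u \<in> Ar SJ. cel l u \<in> hom (Two Cat) (Cmp (One Cat) (leg l (Cd SJ u)) (F1 SF u)) (leg l (Dm SJ u)))"
  proof -
    \<comment> \<open>In the common shape the target leg is composed with an identity functor, which
      \<open>sigma_cone\<close> does not write.\<close>
    have "Cmp (One Cat) (leg l (scd u)) (SI u) = leg l (scd u)"
      if "\<forall>i \<in> Ob SJ. leg l i \<in> hom (One Cat) (F0 SF i) E" "u \<in> Ar SJ" for u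
    proof -
      have "leg l (scd u) \<in> hom (One Cat) (SD (scd u)) E" using that si.ab(2) by blast
      then show ?thesis using Cmp_Idt(1)[of "leg l (scd u)"] by (simp add: hom_One)
    qed
    then show ?thesis unfolding si.precone_def by auto
  qed
  have "sigma_cone Cat (op2 (El K Q)) SC SF E l \<longleftrightarrow> si.precone E l \<and>
     (\<forall>u \<in> SC. invertible (Two Cat) (cel l u)) \<and>
     (\<forall>i \<in> El_ob K Q. cel l (El_id K Q i) = Idt (Two Cat) (leg l i)) \<and>
     (\<forall>u \<in> El_ar K Q. \<forall>v \<in> El_ar K Q. scd v = sdm u \<longrightarrow>
        cel l (El_comp K Q u v) = Cmp (Two Cat) (cel l u) (rwhisk Cat (cel l v) (SS u))) \<and>
     (\<forall>\<gamma> \<in> Ar (Two (El K Q)).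
        Cmp (Two Cat) (cel l (Cd (Two (El K Q)) \<gamma>)) (lwhisk Cat (leg l (sdm (Dm (Two (El K Q)) \<gamma>))) (F2 SF \<gamma>)) =
        cel l (Dm (Two (El K Q)) \<gamma>))"
    unfolding sigma_cone_def pre Ar2 SJ_sel by blast
  also have "\<dots> \<longleftrightarrow> si.precone E l \<and>
     (\<forall>x A f \<phi> y B. arr x A f \<phi> y B \<longrightarrow> invertible (F0 Q B) \<phi> \<longrightarrow> invertible (Two Cat) (cel l ((x, A), (f, \<phi>), (y, B)))) \<and>
     (\<forall>x A. A \<in> KO \<longrightarrow> x \<in> Ob (F0 Q A) \<longrightarrow> cel l (El_id K Q (x, A)) = Idt (Two Cat) (leg l (x, A))) \<and>
     (\<forall>x A f \<phi> y B g \<psi> z C. arr x A f \<phi> y B \<longrightarrow> arr y B g \<psi> z C \<longrightarrow>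
       cel l (El_comp K Q ((y, B), (g, \<psi>), (z, C)) ((x, A), (f, \<phi>), (y, B))) =
         Cmp (Two Cat) (cel l ((y, B), (g, \<psi>), (z, C))) (rwhisk Cat (cel l ((x, A), (f, \<phi>), (y, B))) (F1 R g))) \<and>
     (\<forall>x A g \<psi> y B \<gamma> f. arr x A g \<psi> y B \<longrightarrow> \<gamma> \<in> hom (Two K) f g \<longrightarrow>
       Cmp (Two Cat) (cel l ((x, A), (g, \<psi>), (y, B))) (lwhisk Cat (leg l (x, A)) (F2 R \<gamma>)) =
       cel l ((x, A), (f, Cmp (F0 Q B) \<psi> (NC (F2 Q \<gamma>) x)), (y, B)))"
    (is "_ \<longleftrightarrow> _ \<and> ?Y")
  proof (intro arg_cong2[of _ _ _ _ "(\<and>)"] refl, goal_cases)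
    case 1 show ?case by (auto simp: El_cart_def El_ar_iff)
  next
    case 2 show ?case by (auto simp: El_ob_def)
  next
    case 3 show ?case
      by (simp add: split_paired_all Ball_def El_ar_iff) (use arrD in blast)
  next
    case 4
    have e: "F2 SF (u, \<theta>, v) = F2 R \<theta>" "Dm (Two (El K Q)) (u, \<theta>, v) = u" "Cd (Two (El K Q)) (u, \<theta>, v) = v"
      for u v :: "('k, 'f, 'u) el1" and \<theta>
      by (simp_all add: comp_fun2_def El_proj_def El_def)
    \<comment> \<open>By \<open>arr_cell\<close> a 2-cell of elements amounts to its target together
      with the underlying 2-cell, so the quantifier over 2-cells becomes one over such
      pairs.\<close>
    have m: "\<gamma>' \<in> Ar (Two (El K Q)) \<longleftrightarrow> (\<exists>x A g \<psi> y B \<gamma> f. arr x A g \<psi> y B \<and> \<gamma> \<in> hom (Two K) f g \<and>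
        \<gamma>' = (((x, A), (f, Cmp (F0 Q B) \<psi> (NC (F2 Q \<gamma>) x)), (y, B)), \<gamma>, ((x, A), (g, \<psi>), (y, B))))" for \<gamma>'
      using arr_cell by (auto simp: El_def El_cell_def El_ar_iff)
    show ?case unfolding Ball_def m by (auto simp: e)
  qed
  also have "\<dots> \<longleftrightarrow> si.precone E l \<and> SX E l"
  proof (rule conj_cong[OF refl])
    assume l: "si.precone E l"
    show "?Y \<longleftrightarrow> SX E l"
      unfolding SX_iff[OF E l]
      by (intro arg_cong2[of _ _ _ _ "(\<and>)"] iff_allI imp_cong refl ball_cong
          sinv_iff[OF E l] sid_iff[OF E l] scmp_iff[OF E l] scell_iff[OF E l])
  qed
  finally show ?thesis .
qed

sublocale si: cone_category SJ SD SS SI sdm scd "\<lambda>E. {l. sigma_cone Cat (op2 (El K Q)) SC SF E l}"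
  "\<lambda>\<theta> \<theta>' \<rho>. \<forall>u \<in> Ar (One (op2 (El K Q))).
        Cmp (Two Cat) (cel \<theta>' u) (rwhisk Cat (\<rho> (Cd (One (op2 (El K Q))) u)) (F1 SF u)) =
        Cmp (Two Cat) (\<rho> (Dm (One (op2 (El K Q))) u)) (cel \<theta> u)"
  SX
proof (unfold_locales, goal_cases)
  case (1 E c) then show ?case by (simp add: sigma_cone_iff)
next
  case (2 E c d \<rho>)
  \<comment> \<open>Again the identity functor of the common shape has to be absorbed: whiskering
    with it changes nothing.\<close>
  have "rwhisk Cat (\<rho> (scd u)) (SI u) = \<rho> (scd u)" if u: "u \<in> Ar SJ" for u
  proof -
    note b = si.ab(2)[OF u]
    have r: "small_transformation (\<rho> (scd u))" "NSrc (\<rho> (scd u)) = leg c (scd u)" "NTgt (\<rho> (scd u)) = leg d (scd u)"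
      using 2(4)[OF b] by (auto simp: hom_Two)
    note c = si.precone_leg[OF 2(2) b] and d = si.precone_leg[OF 2(3) b]
    have I: "small_functor (SI u)" "FTgt (SI u) = FSrc (NSrc (\<rho> (scd u)))"
      using si.T[OF u] c r by simp_all
    note w = rwhisk_Cat[OF r(1) I]
    show ?thesis
      using w r c d Cmp_Idt(1)[OF c(1)] Cmp_Idt(1)[OF d(1)] by (intro ntr_eqI) simp_all
  qed
  then show ?case using si.modification_compat_iff[OF 2(2-4)] by simp
qed

lemma si_U: "si.U = sigma_cones Cat (op2 (El K Q)) SC SF"
  by (simp add: sigma_cones_def)

end

section \<open>Elementary correspondences\<close>

text \<open>The brackets are shifted to expose the middle pair, which the square then replaces. The
  composition laws in both directions of the correspondence need this move.\<close>

lemma cmp_interchange: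
  assumes E: "category E"
    and "d \<in> hom E v w" "c \<in> hom E w x" "b \<in> hom E x y" "a \<in> hom E y z" "b' \<in> hom E w x'" "c' \<in> hom E x' y"
    and eq: "Cmp E b c = Cmp E c' b'"
  shows "Cmp E (Cmp E a b) (Cmp E c d) = Cmp E (Cmp E a c') (Cmp E b' d)"
proof -
  have "Cmp E (Cmp E a b) (Cmp E c d) = Cmp E a (Cmp E (Cmp E b c) d)"
    using cmp_assoc[OF E cmp_hom[OF E assms(2,3)] assms(4,5)] cmp_assoc[OF E assms(2-4)] by simp
  also have "\<dots> = Cmp E (Cmp E a c') (Cmp E b' d)"
    unfolding eq using cmp_assoc[OF E cmp_hom[OF E assms(2,6)] assms(7,5)] cmp_assoc[OF E assms(2,6,7)] by simp
  finally show ?thesis .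
qed

context cat_pair
begin

lemma hom_op2: "hom (One (op2 K)) A B = hom (One K) B A"
  by (auto simp: hom_iff)

lemma cell_comp:
  assumes "\<gamma> \<in> hom (Two K) f g" "f \<in> hom (One K) A B"
  shows "x \<in> Ob (F0 Q A) \<Longrightarrow> NC (F2 Q \<gamma>) x \<in> hom (F0 Q B) (FO (F1 Q f) x) (FO (F1 Q g) x)"
    and "w \<in> Ob (F0 R B) \<Longrightarrow> NC (F2 R \<gamma>) w \<in> hom (F0 R A) (FO (F1 R f) w) (FO (F1 R g) w)"
  using hom_TwoD(1)[OF functor_Q(5)[OF assms(1)], of x] hom_TwoD(1)[OF functor_R(5)[OF assms(1)], of w]
    functor_Q1[OF assms(2)] functor_R1[OF assms(2)] by auto

end

section \<open>From a dicone to the swapped dicone and to a sigma-cone\<close>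

context dicone
begin

text \<open>Inverting the cells reverses their direction, as the exchange of the two factors over
  \<open>op2 K\<close> demands. The inverse of a composite has its factors in reverse order, which
  fits the reversed composition of 1-cells.\<close>

lemma dicone_op2:
  assumes E: "category E"
  shows "dicone (op2 K) R Q E (\<lambda>A w x. lo A x w) (\<lambda>A k p. la A p k) (\<lambda>f w x. inverse_of E (t f x w))"
proof -
  interpret sw: cat_pair "op2 K" R Q by (rule swap)
  show ?thesis
  proof (unfold_locales, goal_cases)
    case (1 A w x) then show ?case using lo by simp
  next
    case (2 A w x) then show ?case using la_id by simp
  next
    case (3 A k w w' p x x') then show ?case using la_hom by simp
  next
    case (4 A k w w' k' w'' p x x' p' x'') then show ?case using la_cmp by simp
  next
    case (5 f A B w x)
    then have f: "f \<in> hom (One K) B A" by (simp add: hom_op2)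
    show ?case using inverse_of(1)[OF t_inv[OF f 5(3,2)] t_hom[OF f 5(3,2)]] .
  next
    case (6 f A B k w w' p x x')
    then have f: "f \<in> hom (One K) B A" by (simp add: hom_op2)
    have B: "B \<in> KO" "A \<in> KO" using hom_ob[OF K f] by auto
    note o = hom_ob[OF category_QR(1)[OF B(1)] 6(3)] hom_ob[OF category_QR(2)[OF B(2)] 6(2)]
    show ?case
      using inverse_of_square[OF E t_hom[OF f o(1,3)] t_inv[OF f o(1,3)] t_hom[OF f o(2,4)] t_inv[OF f o(2,4)]
          la_hom[OF B(1) 6(3) functor_hom[OF functor_R1(4)[OF f] 6(2)]]
          la_hom[OF B(2) functor_hom[OF functor_Q1(4)[OF f] 6(3)] 6(2)] t_nat[OF f 6(3,2)]] .
  next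
    case (7 f A B w x)
    then have f: "f \<in> hom (One K) B A" by (simp add: hom_op2)
    show ?case using invertible_inverse_of[OF t_inv[OF f 7(3,2)] t_hom[OF f 7(3,2)]] .
  next
    case (8 A w x) then show ?case using t_id[of A x w] inverse_of_Idt[OF E lo] by simp
  next
    case (9 f A B g C w x)
    then have f: "f \<in> hom (One K) B A" and g: "g \<in> hom (One K) C B" by (simp_all add: hom_op2)
    note x = functor_ob[OF functor_Q1(4)[OF g] 9(4)] and w = functor_ob[OF functor_R1(4)[OF f] 9(3)]
    show ?case
      using invertible_Cmp(2)[OF E t_hom[OF g 9(4) w] t_inv[OF g 9(4) w] t_hom[OF f x 9(3)] t_inv[OF f x 9(3)]]
        t_cmp[OF g f 9(4,3)] by simp
  next
    case (10 \<gamma> f g A B w x)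
    then have f: "f \<in> hom (One K) B A" and \<gamma>: "\<gamma> \<in> hom (Two K) f g" by (simp_all add: hom_op2)
    then have g: "g \<in> hom (One K) B A" using cell_hom by simp
    have B: "B \<in> KO" "A \<in> KO" using hom_ob[OF K f] by auto
    show ?case
      using inverse_of_square[OF E t_hom[OF f 10(4,3)] t_inv[OF f 10(4,3)] t_hom[OF g 10(4,3)] t_inv[OF g 10(4,3)]
          la_hom[OF B(1) id_hom[OF category_QR(1)[OF B(1)] 10(4)] cell_comp(2)[OF \<gamma> f 10(3)]]
          la_hom[OF B(2) cell_comp(1)[OF \<gamma> f 10(4)] id_hom[OF category_QR(2)[OF B(2)] 10(3)]]
          t_cell[OF \<gamma> f 10(4,3), symmetric]] by simp
  qed
qed

text \<open>A pair of arrows factors through either corner of the square in the product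
  category.\<close>

lemma la_split:
  assumes A: "A \<in> KO" and p: "p \<in> hom (F0 Q A) x x'" and k: "k \<in> hom (F0 R A) w w'"
  shows "Cmp E (la A p (Idt (F0 R A) w')) (la A (Idt (F0 Q A) x) k) = la A p k"
    "Cmp E (la A (Idt (F0 Q A) x') k) (la A p (Idt (F0 R A) w)) = la A p k"
proof -
  note C = category_QR(1)[OF A] and D = category_QR(2)[OF A]
  note x = hom_ob[OF C p] and w = hom_ob[OF D k]
  show "Cmp E (la A p (Idt (F0 R A) w')) (la A (Idt (F0 Q A) x) k) = la A p k"
    using la_cmp[OF A id_hom[OF C x(1)] p k id_hom[OF D w(2)]] by (simp add: cmp_id[OF C p] id_cmp[OF D k])
  show "Cmp E (la A (Idt (F0 Q A) x') k) (la A p (Idt (F0 R A) w)) = la A p k"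
    using la_cmp[OF A p id_hom[OF C x(2)] id_hom[OF D w(1)] k] by (simp add: id_cmp[OF C p] cmp_id[OF D k])
qed

lemma t_nat_l:
  assumes f: "f \<in> hom (One K) A B" and x: "x \<in> Ob (F0 Q A)" and k: "k \<in> hom (F0 R B) w w'"
  shows "Cmp E (t f x w') (la A (Idt (F0 Q A) x) (FA (F1 R f) k)) = Cmp E (la B (Idt (F0 Q B) (FO (F1 Q f) x)) k) (t f x w)"
  using t_nat[OF f id_hom[OF category_QR(1)[OF hom_ob(1)[OF K f]] x] k] functor_id[OF functor_Q1(4)[OF f] x] by simp

lemma t_nat_r:
  assumes f: "f \<in> hom (One K) A B" and p: "p \<in> hom (F0 Q A) x x'" and w: "w \<in> Ob (F0 R B)"
  shows "Cmp E (t f x' w) (la A p (Idt (F0 R A) (FO (F1 R f) w))) = Cmp E (la B (FA (F1 Q f) p) (Idt (F0 R B) w)) (t f x w)"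
  using t_nat[OF f p id_hom[OF category_QR(2)[OF hom_ob(2)[OF K f]] w]] functor_id[OF functor_R1(4)[OF f] w] by simp

lemma la_inv:
  assumes A: "A \<in> KO" and p: "p \<in> hom (F0 Q A) x x'" "invertible (F0 Q A) p" and w: "w \<in> Ob (F0 R A)"
  shows "invertible E (la A p (Idt (F0 R A) w))"
proof -
  note C = category_QR(1)[OF A] and D = category_QR(2)[OF A]
  note x = hom_ob[OF C p(1)] and i = id_hom[OF D w] and q = inverse_of[OF p(2,1)]
  show ?thesis
  proof (rule invertibleI[OF la_hom[OF A p(1) i] la_hom[OF A q(1) i]])
    show "Cmp E (la A (inverse_of (F0 Q A) p) (Idt (F0 R A) w)) (la A p (Idt (F0 R A) w)) = Idt E (lo A x w)"
      using la_cmp[OF A p(1) q(1) i i] q la_id[OF A x(1) w] by (simp add: cmp_id[OF D i])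
    show "Cmp E (la A p (Idt (F0 R A) w)) (la A (inverse_of (F0 Q A) p) (Idt (F0 R A) w)) = Idt E (lo A x' w)"
      using la_cmp[OF A q(1) p(1) i i] q la_id[OF A x(2) w] by (simp add: cmp_id[OF D i])
  qed
qed

definition "so = (\<lambda>(x, A) w. lo A x w)"
definition "sa = (\<lambda>(x, A) k. la A (Idt (F0 Q A) x) k)"
definition "st = (\<lambda>((x, A), (f, \<phi>), (y, B)) w. Cmp E (la B \<phi> (Idt (F0 R B) w)) (t f x w))"

lemma s_sel [simp]:
  "so (x, A) w = lo A x w" "sa (x, A) k = la A (Idt (F0 Q A) x) k"
  "st ((x, A), (f, \<phi>), (y, B)) w = Cmp E (la B \<phi> (Idt (F0 R B) w)) (t f x w)"
  by (simp_all add: so_def sa_def st_def)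

text \<open>The cell at \<open>(f, \<phi>)\<close> consists of a part \<open>t f\<close> and a part
  given by the action of \<open>\<phi>\<close>. Its laws follow from those of both parts together
  with naturality of \<open>t\<close> in each variable separately.\<close>

lemma sigma_of_dicone:
  assumes E: "category E"
  shows "sigma K Q R E so sa st"
proof (unfold_locales, goal_cases)
  case (1 A x)
  note A = 1(1) note C = category_QR(1)[OF A] and D = category_QR(2)[OF A]
  note i = id_hom[OF C 1(2)]
  show ?case
  proof (rule is_functorI[OF D])
    fix k k' w w' w'' assume k: "k \<in> hom (F0 R A) w w'" "k' \<in> hom (F0 R A) w' w''"
    show "sa (x, A) (Cmp (F0 R A) k' k) = Cmp E (sa (x, A) k') (sa (x, A) k)"
      using la_cmp[OF A i i k] by (simp add: cmp_id[OF C i])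
  qed (use lo la_id la_hom[OF A i] 1 in auto)
next
  case (2 x A f \<phi> y B w)
  note a = arrD[OF 2(1)] note i = id_hom[OF category_QR(2)[OF a(5)] 2(2)]
  show ?case using cmp_hom[OF E t_hom[OF a(1,2) 2(2)] la_hom[OF a(5,3) i]] by simp
next
  case (3 x A f \<phi> y B k w w')
  note a = arrD[OF 3(1)] note D = category_QR(2)[OF a(5)] and C = category_QR(1)[OF a(5)]
  note w = hom_ob[OF D 3(2)] and q = hom_ob(1)[OF C a(3)]
  note x = id_hom[OF category_QR(1)[OF a(4)] a(2)]
  \<comment> \<open>Two squares are pasted: naturality of \<open>t f\<close> in the second variable,
    and the commutation of \<open>\<phi>\<close> with \<open>k\<close> in the leg at
    \<open>B\<close>.\<close>
  show ?case
    using paste_squares[OF E la_hom[OF a(4) x functor_hom[OF functor_R1(4)[OF a(1)] 3(2)]]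
      t_hom[OF a(1,2) w(1)] t_hom[OF a(1,2) w(2)] la_hom[OF a(5) id_hom[OF C q] 3(2)]
      la_hom[OF a(5,3) id_hom[OF D w(1)]] la_hom[OF a(5,3) id_hom[OF D w(2)]] la_hom[OF a(5) id_hom[OF C a(6)] 3(2)]
      t_nat_l[OF a(1,2) 3(2)]] la_split[OF a(5,3) 3(2)] by simp
next
  case (4 x A f \<phi> y B w)
  note a = arrD[OF 4(1)] note i = id_hom[OF category_QR(2)[OF a(5)] 4(3)]
  show ?case
    using invertible_Cmp(1)[OF E t_hom[OF a(1,2) 4(3)] t_inv[OF a(1,2) 4(3)] la_hom[OF a(5,3) i] la_inv[OF a(5,3) 4(2,3)]]
    by simp
next
  case (5 A x w)
  then show ?case using t_id[OF 5] la_id[OF 5] cmp_id[OF E id_hom[OF E lo[OF 5]]] by simp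
next
  case (6 x A f \<phi> y B g \<psi> z C w)
  note a = arrD[OF 6(1)] and b = arrD[OF 6(2)]
  note D = category_QR(2)[OF b(5)] note i = id_hom[OF D 6(3)]
  note q = hom_ob(1)[OF category_QR(1)[OF a(5)] a(3)]
  note w = functor_ob[OF functor_R1(4)[OF b(1)] 6(3)]
  note Qg = functor_hom[OF functor_Q1(4)[OF b(1)] a(3)]
  \<comment> \<open>Naturality of \<open>t g\<close> in the first variable moves it past the action
    of \<open>\<phi>\<close>, which becomes the action of \<open>Qg(\<phi>)\<close>. This then
    merges with the action of \<open>\<psi>\<close>, and the two cells merge to the cell of the
    composite.\<close>
  show ?case
    using cmp_interchange[OF E t_hom[OF a(1,2) w] la_hom[OF a(5,3) id_hom[OF category_QR(2)[OF a(5)] w]]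
      t_hom[OF b(1,2) 6(3)] la_hom[OF b(5,3) i] t_hom[OF b(1) q 6(3)] la_hom[OF b(5) Qg i] t_nat_r[OF b(1) a(3) 6(3)]]
      la_cmp[OF b(5) Qg b(3) i i] t_cmp[OF a(1) b(1) a(2) 6(3)] by (simp add: cmp_id[OF D i])
next
  case (7 x A g \<psi> y B \<gamma> f w)
  note a = arrD[OF 7(1)] note f = arrD(1)[OF arr_cell[OF 7(1,2)]]
  note D = category_QR(2)[OF a(5)] note i = id_hom[OF D 7(3)]
  note x = id_hom[OF category_QR(1)[OF a(4)] a(2)]
  note c = cell_comp[OF 7(2) f] note q = c(1)[OF a(2)] and r = c(2)[OF 7(3)]
  \<comment> \<open>The cell axiom trades the action of \<open>\<gamma>\<close> on \<open>w\<close>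
    for that on \<open>x\<close>, which is then absorbed into \<open>\<psi>\<close>.\<close>
  have "Cmp E (Cmp E (la B \<psi> (Idt (F0 R B) w)) (t g x w)) (la A (Idt (F0 Q A) x) (NC (F2 R \<gamma>) w)) =
      Cmp E (la B \<psi> (Idt (F0 R B) w)) (Cmp E (la B (NC (F2 Q \<gamma>) x) (Idt (F0 R B) w)) (t f x w))"
    using cmp_assoc[OF E la_hom[OF a(4) x r] t_hom[OF a(1,2) 7(3)] la_hom[OF a(5,3) i]] t_cell[OF 7(2) f a(2) 7(3)] by simp
  also have "\<dots> = Cmp E (Cmp E (la B \<psi> (Idt (F0 R B) w)) (la B (NC (F2 Q \<gamma>) x) (Idt (F0 R B) w))) (t f x w)"
    using cmp_assoc[OF E t_hom[OF f a(2) 7(3)] la_hom[OF a(5) q i] la_hom[OF a(5,3) i]] by simp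
  finally show ?case
    using la_cmp[OF a(5) q a(3) i i] by (simp add: cmp_id[OF D i])
qed

end

section \<open>From a sigma-cone to a dicone\<close>

context sigma
begin

text \<open>The component at the vertical arrow of \<open>p\<close>. The endpoints are recovered
  from \<open>p\<close> itself, so that \<open>ee\<close> can serve as the action on bare arrows;
  \<open>ee_eq\<close> is the form with explicit endpoints.\<close>

definition "ee = (\<lambda>A p w. st ((Dm (F0 Q A) p, A), (Idt (One K) A, p), (Cd (F0 Q A) p, A)) w)"

context
  fixes A p x x'
  assumes A: "A \<in> KO" and p: "p \<in> hom (F0 Q A) x x'"
begin

lemma ee_eq: "ee A p w = st ((x, A), (kid A, p), (x', A)) w"
  using p by (simp add: ee_def hom_iff)

lemma ee_hom: "w \<in> Ob (F0 R A) \<Longrightarrow> ee A p w \<in> hom E (so (x, A) w) (so (x', A) w)"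
  using st_hom[OF arr_id[OF A p], of w] by (simp add: ee_eq functor_R(2)[OF A])

lemma ee_nat: "k \<in> hom (F0 R A) w w' \<Longrightarrow> Cmp E (ee A p w') (sa (x, A) k) = Cmp E (sa (x', A) k) (ee A p w)"
  using st_nat[OF arr_id[OF A p], of k w w'] by (simp add: ee_eq functor_R(2)[OF A] hom_iff)

end

lemma ee_id: "A \<in> KO \<Longrightarrow> x \<in> Ob (F0 Q A) \<Longrightarrow> w \<in> Ob (F0 R A) \<Longrightarrow> ee A (Idt (F0 Q A) x) w = Idt E (so (x, A) w)"
  using ee_eq[OF _ id_hom[OF category_QR(1)]] st_id by simp

text \<open>The arrow is \<open>(f, \<phi>)\<close> followed by the vertical arrow of
  \<open>p\<close>; the images of identity 1-cells under \<open>Q\<close> and \<open>R\<close> drop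
  out.\<close>

lemma st_post:
  assumes u: "arr x A f \<phi> y B" and p: "p \<in> hom (F0 Q B) y z" and w: "w \<in> Ob (F0 R B)"
  shows "st ((x, A), (f, Cmp (F0 Q B) p \<phi>), (z, B)) w = Cmp E (ee B p w) (st ((x, A), (f, \<phi>), (y, B)) w)"
proof -
  note a = arrD[OF u]
  have "FA (F1 Q (kid B)) \<phi> = \<phi>" "FO (F1 R (kid B)) w = w"
    using a(3) w functor_Q(2)[OF a(5)] functor_R(2)[OF a(5)] by (auto simp: hom_iff)
  then show ?thesis
    using st_cmp[OF u arr_id[OF a(5) p] w] id_cmp[OF K a(1)] ee_eq[OF a(5) p] by simp
qed

text \<open>Preceding \<open>(f, \<phi>)\<close> by the vertical arrow of \<open>p\<close> changes
  \<open>\<phi>\<close> by \<open>Qf(p)\<close>. Together with \<open>st_post\<close> this yields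
  naturality of \<open>t\<close> in the first variable.\<close>

lemma st_pre:
  assumes u: "arr x A f \<phi> y B" and p: "p \<in> hom (F0 Q A) x' x" and w: "w \<in> Ob (F0 R B)"
  shows "st ((x', A), (f, Cmp (F0 Q B) \<phi> (FA (F1 Q f) p)), (y, B)) w =
    Cmp E (st ((x, A), (f, \<phi>), (y, B)) w) (ee A p (FO (F1 R f) w))"
  using st_cmp[OF arr_id[OF arrD(4)[OF u] p] u w] cmp_id[OF K arrD(1)[OF u]] ee_eq[OF arrD(4)[OF u] p] by simp

lemma ee_cmp:
  assumes A: "A \<in> KO" and p: "p \<in> hom (F0 Q A) x x'" "p' \<in> hom (F0 Q A) x' x''" and w: "w \<in> Ob (F0 R A)"
  shows "ee A (Cmp (F0 Q A) p' p) w = Cmp E (ee A p' w) (ee A p w)"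
  using st_post[OF arr_id[OF A p(1)] p(2) w] ee_eq[OF A p(1)] ee_eq[OF A cmp_hom[OF category_QR(1)[OF A] p]] by simp

definition "lo = (\<lambda>A x w. so (x, A) w)"
text \<open>The pair acts by \<open>k\<close> at the source of \<open>p\<close> first and by
  \<open>p\<close> at the target of \<open>k\<close> afterwards, so endpoints have to be extracted
  from both arrows.\<close>

definition "la = (\<lambda>A p k. Cmp E (ee A p (Cd (F0 R A) k)) (sa (Dm (F0 Q A) p, A) k))"
definition "t = (\<lambda>f x w.
  st ((x, Dm (One K) f), (f, Idt (F0 Q (Cd (One K) f)) (FO (F1 Q f) x)), (FO (F1 Q f) x, Cd (One K) f)) w)"

lemma la_eq: "p \<in> hom (F0 Q A) x x' \<Longrightarrow> k \<in> hom (F0 R A) w w' \<Longrightarrow> la A p k = Cmp E (ee A p w') (sa (x, A) k)"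
  by (simp add: la_def hom_iff)

lemma t_eq: "f \<in> hom (One K) A B \<Longrightarrow>
    t f x w = st ((x, A), (f, Idt (F0 Q B) (FO (F1 Q f) x)), (FO (F1 Q f) x, B)) w"
  by (simp add: t_def hom_iff)

lemma sa_hom: "A \<in> KO \<Longrightarrow> x \<in> Ob (F0 Q A) \<Longrightarrow> k \<in> hom (F0 R A) w w' \<Longrightarrow> sa (x, A) k \<in> hom E (so (x, A) w) (so (x, A) w')"
  by (rule functor_hom[OF sf])

context
  assumes E: "category E"
begin

lemma la_id_l:
  assumes A: "A \<in> KO" and x: "x \<in> Ob (F0 Q A)" and k: "k \<in> hom (F0 R A) w w'"
  shows "la A (Idt (F0 Q A) x) k = sa (x, A) k"
  using ee_id[OF A x hom_ob(2)[OF category_QR(2)[OF A] k]] la_eq[OF id_hom[OF category_QR(1)[OF A] x] k]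
    id_cmp[OF E sa_hom[OF A x k]] by simp

lemma la_id_r:
  assumes A: "A \<in> KO" and p: "p \<in> hom (F0 Q A) x x'" and w: "w \<in> Ob (F0 R A)"
  shows "la A p (Idt (F0 R A) w) = ee A p w"
  using la_eq[OF p id_hom[OF category_QR(2)[OF A] w]] functor_id[OF sf[OF A hom_ob(1)[OF category_QR(1)[OF A] p]] w]
    cmp_id[OF E ee_hom[OF A p w]] by simp

text \<open>This is \<open>st_post\<close> for the cartesian arrow over \<open>f\<close>. It is what
  makes the passage to a dicone and back return the given sigma-cone.\<close>

lemma st_t:
  assumes u: "arr x A f \<phi> y B" and w: "w \<in> Ob (F0 R B)"
  shows "st ((x, A), (f, \<phi>), (y, B)) w = Cmp E (ee B \<phi> w) (t f x w)"
  using st_post[OF arr_cart[OF arrD(1,2)[OF u]] arrD(3)[OF u] w] t_eq[OF arrD(1)[OF u]]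
    cmp_id[OF category_QR(1)[OF arrD(5)[OF u]] arrD(3)[OF u]] by simp

text \<open>Naturality of the vertical cells makes \<open>la\<close> functorial in both variables
  jointly, and the composition law of the cone, applied to vertical and cartesian arrows, gives the
  laws of \<open>t\<close>.\<close>

lemma dicone_of_sigma: "dicone K Q R E lo la t"
proof (unfold_locales, goal_cases)
  case (1 A x w) then show ?case using functor_ob[OF sf] by (simp add: lo_def)
next
  case (2 A x w)
  show ?case using la_id_r[OF 2(1) id_hom[OF category_QR(1)[OF 2(1)] 2(2)] 2(3)] ee_id[OF 2] by (simp add: lo_def)
next
  case (3 A p x x' k w w')
  show ?case
    using cmp_hom[OF E sa_hom[OF 3(1) hom_ob(1)[OF category_QR(1)[OF 3(1)] 3(2)] 3(3)]
        ee_hom[OF 3(1,2) hom_ob(2)[OF category_QR(2)[OF 3(1)] 3(3)]]]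
    by (simp add: la_eq[OF 3(2,3)] lo_def)
next
  case (4 A p x x' p' x'' k w w' k' w'')
  note A = 4(1) note C = category_QR(1)[OF A] and D = category_QR(2)[OF A]
  note x = hom_ob[OF C 4(2)] and w = hom_ob[OF D 4(5)]
  \<comment> \<open>Naturality of the cell at \<open>p\<close> moves it past the action of
    \<open>k'\<close>; the vertical cells and the actions on the second variable then collect
    separately.\<close>
  show ?case
    using cmp_interchange[OF E sa_hom[OF A x(1) 4(4)] sa_hom[OF A x(1) 4(5)] ee_hom[OF A 4(2) w(2)] ee_hom[OF A 4(3) w(2)]
        ee_hom[OF A 4(2) w(1)] sa_hom[OF A x(2) 4(5)] ee_nat[OF A 4(2,5)]]
      ee_cmp[OF A 4(2,3) w(2)] functor_cmp[OF sf[OF A x(1)] 4(4,5)]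
    by (simp add: la_eq[OF 4(2,4)] la_eq[OF 4(3,5)] la_eq[OF cmp_hom[OF C 4(2,3)] cmp_hom[OF D 4(4,5)]])
next
  case (5 f A B x w) then show ?case using st_hom[OF arr_cart] by (simp add: t_eq lo_def)
next
  case (6 f A B p x x' k w w')
  note f = 6(1) have A: "A \<in> KO" "B \<in> KO" using hom_ob[OF K f] by auto
  note x = hom_ob[OF category_QR(1)[OF A(1)] 6(2)] and w = hom_ob[OF category_QR(2)[OF A(2)] 6(3)]
  note Rk = functor_hom[OF functor_R1(4)[OF f] 6(3)] and Qp = functor_hom[OF functor_Q1(4)[OF f] 6(2)]
  note c = arr_cart[OF f x(1)] and c' = arr_cart[OF f x(2)]
  note Qx = arrD(6)[OF c]
  note th = st_hom[OF c w(2)] and th1 = st_hom[OF c w(1)] and th' = st_hom[OF c' w(2)]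
  \<comment> \<open>Both sides are the cell at the arrow \<open>(f, Qf(p))\<close>, factored with
    its vertical part before or after the cartesian arrow.\<close>
  have "Cmp E (t f x' w') (ee A p (FO (F1 R f) w')) = Cmp E (ee B (FA (F1 Q f) p) w') (t f x w')"
    using st_pre[OF c' 6(2) w(2)] st_post[OF c Qp w(2)]
    by (simp add: t_eq[OF f] id_cmp[OF category_QR(1)[OF A(2)] Qp] cmp_id[OF category_QR(1)[OF A(2)] Qp])
  then have "Cmp E (t f x' w') (la A p (FA (F1 R f) k)) = Cmp E (Cmp E (ee B (FA (F1 Q f) p) w') (t f x w')) (sa (x, A) (FA (F1 R f) k))"
    using cmp_assoc[OF E sa_hom[OF A(1) x(1) Rk] ee_hom[OF A(1) 6(2) hom_ob(2)[OF category_QR(2)[OF A(1)] Rk]] th']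
    by (simp add: la_eq[OF 6(2) Rk] t_eq[OF f])
  also have "\<dots> = Cmp E (ee B (FA (F1 Q f) p) w') (Cmp E (sa (FO (F1 Q f) x, B) k) (t f x w))"
    using cmp_assoc[OF E sa_hom[OF A(1) x(1) Rk] th ee_hom[OF A(2) Qp w(2)]] st_nat[OF c 6(3)] by (simp add: t_eq[OF f])
  also have "\<dots> = Cmp E (la B (FA (F1 Q f) p) k) (t f x w)"
    using cmp_assoc[OF E th1 sa_hom[OF A(2) Qx 6(3)] ee_hom[OF A(2) Qp w(2)]] by (simp add: la_eq[OF Qp 6(3)] t_eq[OF f])
  finally show ?case .
next
  case (7 f A B x w)
  note c = arr_cart[OF 7(1,2)]
  \<comment> \<open>The second entry of the arrow defining \<open>t f\<close> is an identity, hence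
    invertible, so the invertibility axiom of the sigma-cone applies.\<close>
  show ?case
    using st_inv[OF c invertible_Idt[OF category_QR(1)[OF arrD(5)[OF c]] arrD(6)[OF c]] 7(3)] by (simp add: t_eq[OF 7(1)])
next
  case (8 A x w)
  then show ?case using st_id[OF 8] t_eq[OF id_hom[OF K 8(1)], of x w] by (simp add: functor_Q(2) lo_def)
next
  case (9 f A B g C x w)
  note c = arr_cart[OF 9(1,3)] note d = arr_cart[OF 9(2) arrD(6)[OF c]]
  \<comment> \<open>Since \<open>Qg\<close> preserves identities, the chosen cartesian arrows
    compose strictly: \<open>(g, id)\<close> after \<open>(f, id)\<close> is
    \<open>(gf, id)\<close>.\<close>
  have "FA (F1 Q g) (Idt (F0 Q B) (FO (F1 Q f) x)) = Idt (F0 Q C) (FO (F1 Q g) (FO (F1 Q f) x))"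
    using functor_id[OF functor_Q1(4)[OF 9(2)] arrD(6)[OF c]] .
  moreover have "FO (F1 Q (kc g f)) x = FO (F1 Q g) (FO (F1 Q f) x)"
    using functor_Q(4)[OF 9(1,2)] functor_Q1[OF 9(1)] 9(3) by simp
  ultimately show ?case
    using st_cmp[OF c d 9(4)] cmp_id[OF category_QR(1)[OF arrD(5)[OF d]] arrD(3)[OF d]]
    by (simp add: t_eq[OF 9(1)] t_eq[OF 9(2)] t_eq[OF cmp_hom[OF K 9(1,2)]])
next
  case (10 \<gamma> f g A B x w)
  have g: "g \<in> hom (One K) A B" using cell_hom[OF 10(1)] 10(2) by simp
  have A: "A \<in> KO" "B \<in> KO" using hom_ob[OF K g] by auto
  note q = cell_comp(1)[OF 10(1-3)] and r = cell_comp(2)[OF 10(1,2,4)]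
  note c = arr_cart[OF 10(2,3)] and d = arr_cart[OF g 10(3)]
  \<comment> \<open>At the target \<open>(g, id)\<close> the 2-cell \<open>\<gamma>\<close> has
    source \<open>(f, q)\<close>, where \<open>q\<close> is the component of
    \<open>F2 Q \<gamma>\<close> at \<open>x\<close>; \<open>st_post\<close> splits its cell into
    the vertical cell of \<open>q\<close> after \<open>t f\<close>.\<close>
  show ?case
    using st_post[OF c q 10(4)] st_cell[OF d 10(1,4)] cmp_id[OF category_QR(1)[OF A(2)] q] id_cmp[OF category_QR(1)[OF A(2)] q]
    by (simp add: la_id_r[OF A(2) q 10(4)] la_id_l[OF A(1) 10(3) r] t_eq[OF 10(2)] t_eq[OF g])
qed

end

end

section \<open>The swap of the two factors\<close>

context cat_pair
begin

abbreviation llo where "llo l A x w \<equiv> FO (leg l A) (pr (x, w))"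
abbreviation lla where "lla l A p k \<equiv> FA (leg l A) (pr (p, k))"
abbreviation lt where "lt l f x w \<equiv> NC (cel l f) (pr (x, w))"

lemma dicone_pseudo_dicone:
  "ext_category E \<Longrightarrow> pseudo_dicone Cat (op2 K) DT E l \<Longrightarrow> dicone K Q R E (llo l) (lla l) (lt l)"
  by (simp add: pseudo_dicone_iff DX_def)

lemma op2_op2: "op2 (op2 K) = K"
  by (simp add: op2_def op1_def)

definition swap_dicone ::
  "'u small_cat \<Rightarrow> ('k, 'f, 'u fnc, 'u ntr) cone \<Rightarrow> ('k, 'f, 'u fnc, 'u ntr) cone" where
  "swap_dicone E l = cat_pair.mk_di (op2 K) R Q E (\<lambda>A w x. llo l A x w) (\<lambda>A k p. lla l A p k)
     (\<lambda>f w x. inverse_of E (lt l f x w))"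

lemma swap_dicone:
  assumes E: "ext_category E" and l: "pseudo_dicone Cat (op2 K) DT E l"
  shows "pseudo_dicone Cat (op2 (op2 K)) (prod_fun2 R Q) E (swap_dicone E l)"
proof -
  interpret sw: cat_pair "op2 K" R Q by (rule swap)
  interpret dicone K Q R E "llo l" "lla l" "lt l" using E l by (rule dicone_pseudo_dicone)
  show ?thesis
    unfolding swap_dicone_def using dicone_op2[OF ext_category_category[OF E]] E by (rule sw.mk_di)
qed

lemma swap_dicone_sel:
  "A \<in> KO \<Longrightarrow> x \<in> Ob (F0 Q A) \<Longrightarrow> w \<in> Ob (F0 R A) \<Longrightarrow>
    FO (leg (swap_dicone E l) A) (pr (w, x)) = FO (leg l A) (pr (x, w))"
  "A \<in> KO \<Longrightarrow> p \<in> Ar (F0 Q A) \<Longrightarrow> k \<in> Ar (F0 R A) \<Longrightarrow>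
    FA (leg (swap_dicone E l) A) (pr (k, p)) = FA (leg l A) (pr (p, k))"
  "f \<in> hom (One K) A B \<Longrightarrow> x \<in> Ob (F0 Q A) \<Longrightarrow> w \<in> Ob (F0 R B) \<Longrightarrow>
    NC (cel (swap_dicone E l) f) (pr (w, x)) = inverse_of E (NC (cel l f) (pr (x, w)))"
proof -
  interpret sw: cat_pair "op2 K" R Q by (rule swap)
  show "A \<in> KO \<Longrightarrow> x \<in> Ob (F0 Q A) \<Longrightarrow> w \<in> Ob (F0 R A) \<Longrightarrow>
    FO (leg (swap_dicone E l) A) (pr (w, x)) = FO (leg l A) (pr (x, w))"
    by (simp add: swap_dicone_def sw.mk_di_sel)
  show "A \<in> KO \<Longrightarrow> p \<in> Ar (F0 Q A) \<Longrightarrow> k \<in> Ar (F0 R A) \<Longrightarrow>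
    FA (leg (swap_dicone E l) A) (pr (k, p)) = FA (leg l A) (pr (p, k))"
    by (simp add: swap_dicone_def sw.mk_di_sel)
  show "f \<in> hom (One K) A B \<Longrightarrow> x \<in> Ob (F0 Q A) \<Longrightarrow> w \<in> Ob (F0 R B) \<Longrightarrow>
    NC (cel (swap_dicone E l) f) (pr (w, x)) = inverse_of E (NC (cel l f) (pr (x, w)))"
    using sw.mk_di_sel(3)[of f B A w x] by (simp add: swap_dicone_def hom_op2)
qed

end

context cat_pair
begin

interpretation sw: cat_pair "op2 K" R Q by (rule swap)

text \<open>\<open>op2\<close> is an involution, the two exchanges of coordinates cancel, and
  inverting an invertible cell twice gives it back.\<close>

lemma swap_swap_dicone:
  assumes E: "ext_category E" and l: "pseudo_dicone Cat (op2 K) DT E l"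
  shows "sw.swap_dicone E (swap_dicone E l) = l"
proof -
  interpret dicone K Q R E "llo l" "lla l" "lt l" using E l by (rule dicone_pseudo_dicone)
  have "pseudo_dicone Cat (op2 K) DT E (sw.swap_dicone E (swap_dicone E l))"
    using sw.swap_dicone[OF E swap_dicone[OF E l]] unfolding op2_op2 .
  then have p: "di.precone E (sw.swap_dicone E (swap_dicone E l))" "di.precone E l"
    using l by (simp_all add: pseudo_dicone_iff[OF E])
  show ?thesis
  proof (rule di_eqI[OF p])
    fix f A B x w assume f: "f \<in> hom (One K) A B" and x: "x \<in> Ob (F0 Q A)" and w: "w \<in> Ob (F0 R B)"
    have "NC (cel (sw.swap_dicone E (swap_dicone E l)) f) (pr (x, w)) = inverse_of E (NC (cel (swap_dicone E l) f) (pr (w, x)))"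
      using sw.swap_dicone_sel(3)[of f B A w x] f x w by (simp add: hom_op2)
    then show "NC (cel (sw.swap_dicone E (swap_dicone E l)) f) (pr (x, w)) = NC (cel l f) (pr (x, w))"
      using swap_dicone_sel(3)[OF f x w] inverse_of_inverse_of[OF ext_category_category[OF E] t_inv[OF f x w] t_hom[OF f x w]]
      by simp
  qed (simp_all add: sw.swap_dicone_sel swap_dicone_sel)
qed

text \<open>Compatibility with the cells is a square whose parallel sides are the invertible cells
  of \<open>c\<close> and \<open>d\<close>; turning it around gives compatibility with the inverse
  cells.\<close>

lemma swap_modification:
  assumes E: "ext_category E" and c: "pseudo_dicone Cat (op2 K) DT E c" and d: "pseudo_dicone Cat (op2 K) DT E d"
    and r: "di.modification E c d r"
  shows "sw.di.modification E (swap_dicone E c) (swap_dicone E d) (\<lambda>A z. r A (pr (p2 z, p1 z)))"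
proof -
  interpret c: dicone K Q R E "llo c" "lla c" "lt c" using E c by (rule dicone_pseudo_dicone)
  interpret d: dicone K Q R E "llo d" "lla d" "lt d" using E d by (rule dicone_pseudo_dicone)
  note E' = ext_category_category[OF E]
  note r = r[unfolded di_modification_iff]
  note r1 = r[THEN conjunct1, rule_format] and r2 = r[THEN conjunct2, THEN conjunct1, rule_format]
    and r3 = r[THEN conjunct2, THEN conjunct2, rule_format]
  show ?thesis
    unfolding sw.di_modification_iff
  proof (intro conjI ballI allI impI, goal_cases)
    case (1 A w x) then show ?case using r1 by (simp add: swap_dicone_sel)
  next
    case (2 A k p w w' x x')
    then have A: "A \<in> KO" by simp
    note o = hom_ob[OF category_QR(1)[OF A] 2(3)] hom_ob[OF category_QR(2)[OF A] 2(2)]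
    show ?case using r2[OF A 2(3,2)] A o 2(2,3)[unfolded hom_iff] by (simp add: swap_dicone_sel)
  next
    case (3 f A B w x)
    then have f: "f \<in> hom (One K) B A" by (simp add: hom_op2)
    have B: "B \<in> KO" "A \<in> KO" using hom_ob[OF K f] by auto
    note x = 3(3) and w = 3(2)
    note Rw = functor_ob[OF functor_R1(4)[OF f] w] and Qx = functor_ob[OF functor_Q1(4)[OF f] x]
    show ?case
      using inverse_of_square[OF E' c.t_hom[OF f x w] c.t_inv[OF f x w] d.t_hom[OF f x w] d.t_inv[OF f x w]
        r1[OF B(1) x Rw] r1[OF B(2) Qx w] r3[OF f x w]] by (simp add: swap_dicone_sel(3)[OF f x w])
  qed
qed

text \<open>Postcomposition with a functor preserves the chosen inverses because inverses are
  unique.\<close>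

lemma swap_act:
  assumes u: "small_functor u" and c: "pseudo_dicone Cat (op2 K) DT (FSrc u) c"
  shows "swap_dicone (FTgt u) (di.act u c) = sw.di.act u (swap_dicone (FSrc u) c)"
proof -
  note E = small_functorD(1,2)[OF u]
  interpret c: dicone K Q R "FSrc u" "llo c" "lla c" "lt c" using E(1) c by (rule dicone_pseudo_dicone)
  have pc: "di.precone (FSrc u) c" "DX (FSrc u) c" using c by (simp_all add: pseudo_dicone_iff[OF E(1)])
  note ps = swap_dicone[OF E(1) c, unfolded sw.pseudo_dicone_iff[OF E(1)], THEN conjunct1]
  have "pseudo_dicone Cat (op2 K) DT (FTgt u) (di.act u c)"
    using di.precone_act[OF pc(1) u refl] di_act[OF u pc] by (simp add: pseudo_dicone_iff[OF E(2)])
  note p1 = swap_dicone[OF E(2) this, unfolded sw.pseudo_dicone_iff[OF E(2)], THEN conjunct1]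
  note p2 = sw.di.precone_act[OF ps u refl]
  note s = di.act_sel[OF pc(1) u refl] and s' = sw.di.act_sel[OF ps u refl]
  show ?thesis
  proof (rule sw.di_eqI[OF p1 p2])
    fix f A B w x assume f': "f \<in> hom (One (op2 K)) A B" and w: "w \<in> Ob (F0 R A)" and x: "x \<in> Ob (F0 Q B)"
    have f: "f \<in> hom (One K) B A" using f' by (simp add: hom_op2)
    have A: "B \<in> KO" "f \<in> Ar DJ" "Dm (One K) f = B" "Cd (One K) f = A" using hom_ob[OF K f] f by (auto simp: hom_iff)
    have "NC (cel (di.act u c) f) (pr (x, w)) = FA u (NC (cel c f) (pr (x, w)))"
      using A x w slot(5)[OF f A(1)] by (simp add: s)
    moreover have "pr (w, x) \<in> Ob (FSrc (sw.DS1 f))"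
      using x w A sw.slot(5)[OF f'] hom_ob[OF K f] by simp
    then have "NC (cel (sw.di.act u (swap_dicone (FSrc u) c)) f) (pr (w, x)) =
        FA u (NC (cel (swap_dicone (FSrc u) c) f) (pr (w, x)))"
      using A by (intro s') simp_all
    ultimately show "NC (cel (swap_dicone (FTgt u) (di.act u c)) f) (pr (w, x)) =
        NC (cel (sw.di.act u (swap_dicone (FSrc u) c)) f) (pr (w, x))"
      using functor_inverse(2)[OF small_functorD(7,3,4)[OF u] c.t_hom[OF f x w] c.t_inv[OF f x w]]
      by (simp add: swap_dicone_sel(3)[OF f x w])
  qed (simp_all add: s s' swap_dicone_sel)
qed

end

context cat_pair
begin

interpretation sw: cat_pair "op2 K" R Q by (rule swap)

lemma equivalent_swap:
  "equivalent_universal_properties Cat (pseudo_dicones Cat (op2 K) (prod_fun2 Q R)) (pseudo_dicones Cat K (prod_fun2 R Q))"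
proof -
  \<comment> \<open>The reindexing keeps the index \<open>A\<close> and exchanges the coordinates of
    a pair, so it is its own inverse on object sets.\<close>
  have "equivalent_universal_properties Cat di.U sw.di.U"
  proof (rule cone_reindexing.intro[OF di.cone_category_axioms sw.di.cone_category_axioms,
        THEN cone_reindexing.equivalent_UV(1)],
      rule cone_reindexing_axioms.intro[where h = "\<lambda>A. A" and k = "\<lambda>A z. pr (p2 z, p1 z)"
        and hi = "\<lambda>A z. A" and ki = "\<lambda>A z. pr (p2 z, p1 z)" and \<Phi> = swap_dicone], goal_cases)
    case (9 E)
    show ?case
    proof (rule bij_betwI[where g = "sw.swap_dicone E"])
      show "swap_dicone E \<in> {l. pseudo_dicone Cat (op2 K) DT E l} \<rightarrow> {l. pseudo_dicone Cat (op2 (op2 K)) (prod_fun2 R Q) E l}"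
        using swap_dicone[OF 9] by auto
      show "sw.swap_dicone E \<in> {l. pseudo_dicone Cat (op2 (op2 K)) (prod_fun2 R Q) E l} \<rightarrow> {l. pseudo_dicone Cat (op2 K) DT E l}"
        using sw.swap_dicone[OF 9] unfolding op2_op2 by auto
    qed (use swap_swap_dicone[OF 9] sw.swap_swap_dicone[OF 9] in \<open>simp_all add: op2_op2\<close>)
  next
    case (10 E c A z) then show ?case by (auto simp: swap_dicone_sel)
  next
    case (11 E c d r)
    then have c: "pseudo_dicone Cat (op2 K) DT E c" and d: "pseudo_dicone Cat (op2 K) DT E d" by simp_all
    show ?case
    proof
      show "di.modification E c d r \<Longrightarrow>
          sw.di.modification E (swap_dicone E c) (swap_dicone E d) (\<lambda>A z. r A (pr (p2 z, p1 z)))"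
        by (rule swap_modification[OF 11(1) c d])
      \<comment> \<open>The converse is the forward implication for the swapped cones. The doubly
        exchanged argument \<open>pr (p1 z, p2 z)\<close> is \<open>z\<close> only when
        \<open>z\<close> codes a pair from the object sets, hence
        \<open>di.modification_cong\<close>.\<close>
      assume "sw.di.modification E (swap_dicone E c) (swap_dicone E d) (\<lambda>A z. r A (pr (p2 z, p1 z)))"
      then have "di.modification E c d (\<lambda>A z. r A (pr (p1 z, p2 z)))"
        using sw.swap_modification[OF 11(1) swap_dicone[OF 11(1) c] swap_dicone[OF 11(1) d],
            of "\<lambda>A z. r A (pr (p2 z, p1 z))"]
        by (simp add: op2_op2 swap_swap_dicone[OF 11(1)] c d)
      then show "di.modification E c d r"
        by (rule di.modification_cong[rotated]) auto
    qed
  next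
    case (12 u c) then show ?case using swap_act by simp
  next
    case (13 u c) then show ?case by (rule di_act)
  qed auto
  from this[unfolded di_U sw.di_U] show ?thesis
    unfolding op2_op2 .
qed

end

section \<open>Pseudo-dicones and sigma-cones\<close>

context cat_pair
begin

lemma mk_si:
  assumes "sigma K Q R E so sa st" and E: "ext_category E"
  shows "sigma_cone Cat (op2 (El K Q)) SC SF E (si.mk_cone E so sa st)"
proof -
  interpret sigma K Q R E so sa st by fact
  let ?l = "si.mk_cone E so sa st"
  have p: "si.precone E ?l"
  proof (rule si.precone_mk_cone[OF E])
    fix i assume "i \<in> Ob SJ"
    then show "is_functor (SD i) E (so i) (sa i)" using sf by (cases i) (simp add: El_ob_iff)
  next
    fix u w assume u: "u \<in> Ar SJ" and w: "w \<in> Ob (FSrc (SS u))"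
    obtain x A f \<phi> y B where u': "u = ((x, A), (f, \<phi>), (y, B))" and a: "arr x A f \<phi> y B"
      by (rule El_arE[OF u[unfolded SJ_sel]])
    show "st u w \<in> hom E (so (sdm u) (FO (SS u) w)) (so (scd u) (FO (SI u) w))"
      using st_hom[OF a] w functor_R1[OF arrD(1)[OF a]] by (simp add: u')
  next
    fix u w w' k assume u: "u \<in> Ar SJ" and k: "k \<in> hom (FSrc (SS u)) w w'"
    obtain x A f \<phi> y B where u': "u = ((x, A), (f, \<phi>), (y, B))" and a: "arr x A f \<phi> y B"
      by (rule El_arE[OF u[unfolded SJ_sel]])
    have k': "k \<in> hom (F0 R B) w w'" using k functor_R1[OF arrD(1)[OF a]] by (simp add: u')
    then have "k \<in> Ar (F0 R B)" by (simp add: hom_iff)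
    then show "Cmp E (st u w') (sa (sdm u) (FA (SS u) k)) = Cmp E (sa (scd u) (FA (SI u) k)) (st u w)"
      using st_nat[OF a k'] by (simp add: u')
  qed
  have n: "NC (cel ?l ((x, A), (f, \<phi>), (y, B))) w = st ((x, A), (f, \<phi>), (y, B)) w"
    if "arr x A f \<phi> y B" "w \<in> Ob (F0 R B)" for x A f \<phi> y B w
    using that functor_R1[OF arrD(1)[OF that(1)]] by (intro si.mk_cone_sel(3)) (simp_all add: El_ar_iff)
  have lo: "FO (leg ?l (x, A)) w = so (x, A) w" if "A \<in> KO" "x \<in> Ob (F0 Q A)" "w \<in> Ob (F0 R A)" for x A w
    using that by (intro si.mk_cone_sel(1)) (simp_all add: El_ob_iff)
  have la: "FA (leg ?l (x, A)) k = sa (x, A) k" if "A \<in> KO" "x \<in> Ob (F0 Q A)" "k \<in> Ar (F0 R A)" for x A k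
    using that by (intro si.mk_cone_sel(2)) (simp_all add: El_ob_iff)
  have "SX E ?l"
    unfolding SX_iff[OF E p]
  proof (intro conjI allI impI ballI, goal_cases)
    case (1 x A f \<phi> y B w) then show ?case using st_inv[OF 1] n[OF 1(1,3)] by simp
  next
    case (2 x A w)
    show ?case using st_id[OF 2] n[OF arr_id[OF 2(1) id_hom[OF category_QR(1)[OF 2(1)] 2(2)]] 2(3)] lo[OF 2] by simp
  next
    case (3 x A f \<phi> y B g \<psi> z C w)
    show ?case using st_cmp[OF 3] n[OF arr_cmp[OF 3(1,2)] 3(3)] n[OF 3(2,3)]
      n[OF 3(1) functor_ob[OF functor_R1(4)[OF arrD(1)[OF 3(2)]] 3(3)]] by simp
  next
    case (4 x A g \<psi> y B \<gamma> f w)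
    note u = arr_cell[OF 4(1,2)]
    have "NC (F2 R \<gamma>) w \<in> Ar (F0 R A)"
      using cell_comp(2)[OF 4(2) arrD(1)[OF u] 4(3)] by (simp add: hom_iff)
    then show ?case using st_cell[OF 4] n[OF u 4(3)] n[OF 4(1,3)] la[OF arrD(4,2)[OF u]] by simp
  qed
  then show ?thesis using p by (simp add: sigma_cone_iff[OF E])
qed

abbreviation slo where "slo \<theta> i \<equiv> FO (leg \<theta> i)"
abbreviation sla where "sla \<theta> i \<equiv> FA (leg \<theta> i)"
abbreviation slt where "slt \<theta> u \<equiv> NC (cel \<theta> u)"

lemma sigma_sigma_cone:
  "ext_category E \<Longrightarrow> sigma_cone Cat (op2 (El K Q)) SC SF E \<theta> \<Longrightarrow> sigma K Q R E (slo \<theta>) (sla \<theta>) (slt \<theta>)"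
  by (simp add: sigma_cone_iff SX_def)

text \<open>The formulas are those of \<open>so\<close>, \<open>sa\<close> and \<open>st\<close>,
  spelled out because a total function of \<open>l\<close> is wanted, whereas the locale
  \<open>dicone\<close> can be entered only for an actual dicone. The same applies to
  \<open>to_dicone\<close>.\<close>

definition to_sigma ::
  "'u small_cat \<Rightarrow> ('k, 'f, 'u fnc, 'u ntr) cone \<Rightarrow> (('k, 'u) el0, ('k, 'f, 'u) el1, 'u fnc, 'u ntr) cone" where
  "to_sigma E l = si.mk_cone E (\<lambda>(x, A). llo l A x) (\<lambda>(x, A). lla l A (Idt (F0 Q A) x))
     (\<lambda>((x, A), (f, \<phi>), (y, B)) w. Cmp E (lla l B \<phi> (Idt (F0 R B) w)) (lt l f x w))"

definition to_dicone ::
  "'u small_cat \<Rightarrow> (('k, 'u) el0, ('k, 'f, 'u) el1, 'u fnc, 'u ntr) cone \<Rightarrow> ('k, 'f, 'u fnc, 'u ntr) cone" where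
  "to_dicone E \<theta> = mk_di E (\<lambda>A x w. slo \<theta> (x, A) w)
     (\<lambda>A p k. Cmp E (slt \<theta> ((Dm (F0 Q A) p, A), (kid A, p), (Cd (F0 Q A) p, A)) (Cd (F0 R A) k)) (sla \<theta> (Dm (F0 Q A) p, A) k))
     (\<lambda>f x w. slt \<theta> ((x, Dm (One K) f), (f, Idt (F0 Q (Cd (One K) f)) (FO (F1 Q f) x)), (FO (F1 Q f) x, Cd (One K) f)) w)"

lemma to_sigma_sel:
  "A \<in> KO \<Longrightarrow> x \<in> Ob (F0 Q A) \<Longrightarrow> w \<in> Ob (F0 R A) \<Longrightarrow> FO (leg (to_sigma E l) (x, A)) w = FO (leg l A) (pr (x, w))"
  "A \<in> KO \<Longrightarrow> x \<in> Ob (F0 Q A) \<Longrightarrow> k \<in> Ar (F0 R A) \<Longrightarrow>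
    FA (leg (to_sigma E l) (x, A)) k = FA (leg l A) (pr (Idt (F0 Q A) x, k))"
  "arr x A f \<phi> y B \<Longrightarrow> w \<in> Ob (F0 R B) \<Longrightarrow> NC (cel (to_sigma E l) ((x, A), (f, \<phi>), (y, B))) w =
    Cmp E (FA (leg l B) (pr (\<phi>, Idt (F0 R B) w))) (NC (cel l f) (pr (x, w)))"
  unfolding to_sigma_def using functor_R1[OF arrD(1)]
  by (simp_all add: si.mk_cone_sel El_ob_iff El_ar_iff)

lemma to_sigma:
  assumes E: "ext_category E" and l: "pseudo_dicone Cat (op2 K) DT E l"
  shows "sigma_cone Cat (op2 (El K Q)) SC SF E (to_sigma E l)"
proof -
  interpret dicone K Q R E "llo l" "lla l" "lt l" using E l by (rule dicone_pseudo_dicone)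
  show ?thesis
    unfolding to_sigma_def
    using sigma_of_dicone[OF ext_category_category[OF E], unfolded so_def sa_def st_def] E by (rule mk_si)
qed

lemma to_dicone:
  assumes E: "ext_category E" and \<theta>: "sigma_cone Cat (op2 (El K Q)) SC SF E \<theta>"
  shows "pseudo_dicone Cat (op2 K) DT E (to_dicone E \<theta>)"
proof -
  interpret sigma K Q R E "slo \<theta>" "sla \<theta>" "slt \<theta>" using E \<theta> by (rule sigma_sigma_cone)
  show ?thesis
    unfolding to_dicone_def
    using dicone_of_sigma[OF ext_category_category[OF E], unfolded lo_def la_def t_def ee_def] E by (rule mk_di)
qed

lemma to_dicone_to_sigma:
  assumes E: "ext_category E" and l: "pseudo_dicone Cat (op2 K) DT E l"
  shows "to_dicone E (to_sigma E l) = l"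
proof -
  interpret dicone K Q R E "llo l" "lla l" "lt l" using E l by (rule dicone_pseudo_dicone)
  note E' = ext_category_category[OF E]
  have p: "di.precone E (to_dicone E (to_sigma E l))" "di.precone E l"
    using l to_dicone[OF E to_sigma[OF E l]] by (simp_all add: pseudo_dicone_iff[OF E])
  show ?thesis
  proof (rule di_eqI[OF p])
    fix A x w assume "A \<in> KO" "x \<in> Ob (F0 Q A)" "w \<in> Ob (F0 R A)"
    then show "llo (to_dicone E (to_sigma E l)) A x w = llo l A x w"
      by (simp add: to_dicone_def mk_di_sel to_sigma_sel)
  next
    fix A p k assume A: "A \<in> KO" and p0: "p \<in> Ar (F0 Q A)" and k0: "k \<in> Ar (F0 R A)"
    define x x' w w' where d: "x = Dm (F0 Q A) p" "x' = Cd (F0 Q A) p" "w = Dm (F0 R A) k" "w' = Cd (F0 R A) k"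
    have p: "p \<in> hom (F0 Q A) x x'" and k: "k \<in> hom (F0 R A) w w'" using p0 k0 d by (simp_all add: hom_iff)
    note o = hom_ob[OF category_QR(1)[OF A] p] hom_ob[OF category_QR(2)[OF A] k]
    have "lla (to_dicone E (to_sigma E l)) A p k =
        Cmp E (slt (to_sigma E l) ((x, A), (kid A, p), (x', A)) w') (sla (to_sigma E l) (x, A) k)"
      using A p0 k0 by (simp add: to_dicone_def mk_di_sel d)
    also have "\<dots> = Cmp E (Cmp E (lla l A p (Idt (F0 R A) w')) (lt l (kid A) x w')) (lla l A (Idt (F0 Q A) x) k)"
      using A o k0 by (simp add: to_sigma_sel arr_id[OF A p])
    \<comment> \<open>At a vertical arrow the cell \<open>t\<close> belongs to an identity 1-cell
      and disappears; the two remaining actions recombine to that of the pair.\<close>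
    also have "\<dots> = lla l A p k"
      using t_id[OF A o(1,4)] cmp_id[OF E' la_hom[OF A p id_hom[OF category_QR(2)[OF A] o(4)]]] la_split(1)[OF A p k]
      by simp
    finally show "lla (to_dicone E (to_sigma E l)) A p k = lla l A p k" .
  next
    fix f A B x w assume f: "f \<in> hom (One K) A B" and x: "x \<in> Ob (F0 Q A)" and w: "w \<in> Ob (F0 R B)"
    note c = arr_cart[OF f x]
    have f': "Dm (One K) f = A" "Cd (One K) f = B" using f by (auto simp: hom_iff)
    have "lt (to_dicone E (to_sigma E l)) f x w =
        Cmp E (lla l B (Idt (F0 Q B) (FO (F1 Q f) x)) (Idt (F0 R B) w)) (lt l f x w)"
      using mk_di_sel(3)[OF f x w] to_sigma_sel(3)[OF c w] by (simp add: to_dicone_def f')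
    \<comment> \<open>At a cartesian arrow it is the action part that is an identity.\<close>
    then show "lt (to_dicone E (to_sigma E l)) f x w = lt l f x w"
      using la_id[OF arrD(5,6)[OF c] w] id_cmp[OF E' t_hom[OF f x w]] by simp
  qed
qed

lemma to_sigma_to_dicone:
  assumes E: "ext_category E" and \<theta>: "sigma_cone Cat (op2 (El K Q)) SC SF E \<theta>"
  shows "to_sigma E (to_dicone E \<theta>) = \<theta>"
proof -
  interpret sigma K Q R E "slo \<theta>" "sla \<theta>" "slt \<theta>" using E \<theta> by (rule sigma_sigma_cone)
  note E' = ext_category_category[OF E]
  have p: "si.precone E (to_sigma E (to_dicone E \<theta>))" "si.precone E \<theta>"
    using \<theta> to_sigma[OF E to_dicone[OF E \<theta>]] by (simp_all add: sigma_cone_iff[OF E])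
  have di: "to_dicone E \<theta> = mk_di E lo la t"
    by (simp add: to_dicone_def lo_def la_def t_def ee_def)
  show ?thesis
  proof (rule si.precone_eqI[OF p])
    fix i w assume "i \<in> Ob SJ" "w \<in> Ob (SD i)"
    then show "slo (to_sigma E (to_dicone E \<theta>)) i w = slo \<theta> i w"
      by (cases i) (simp add: El_ob_iff to_sigma_sel di mk_di_sel lo_def)
  next
    fix i k assume i: "i \<in> Ob SJ" and k: "k \<in> Ar (SD i)"
    obtain x A where i': "i = (x, A)" by (cases i)
    then have A: "A \<in> KO" "x \<in> Ob (F0 Q A)" and k': "k \<in> Ar (F0 R A)" using i k by (simp_all add: El_ob_iff)
    have "Idt (F0 Q A) x \<in> Ar (F0 Q A)" using id_hom[OF category_QR(1)[OF A(1)] A(2)] by (simp add: hom_iff)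
    then show "sla (to_sigma E (to_dicone E \<theta>)) i k = sla \<theta> i k"
      using A k' la_id_l[OF E' A hom_self[OF k']] by (simp add: i' to_sigma_sel di mk_di_sel)
  next
    fix u w assume u: "u \<in> Ar SJ" and w: "w \<in> Ob (FSrc (SS u))"
    obtain x A f \<phi> y B where u': "u = ((x, A), (f, \<phi>), (y, B))" and a: "arr x A f \<phi> y B"
      by (rule El_arE[OF u[unfolded SJ_sel]])
    note b = arrD[OF a]
    have w': "w \<in> Ob (F0 R B)" using w functor_R1[OF b(1)] by (simp add: u')
    have "\<phi> \<in> Ar (F0 Q B)" "Idt (F0 R B) w \<in> Ar (F0 R B)"
      using b(3) id_hom[OF category_QR(2)[OF b(5)] w'] by (simp_all add: hom_iff)
    then have "slt (to_sigma E (to_dicone E \<theta>)) u w = Cmp E (la B \<phi> (Idt (F0 R B) w)) (t f x w)"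
      using to_sigma_sel(3)[OF a w'] mk_di_sel(3)[OF b(1,2) w'] b(5) by (simp add: u' di mk_di_sel)
    then show "slt (to_sigma E (to_dicone E \<theta>)) u w = slt \<theta> u w"
      using st_t[OF E' a w'] la_id_r[OF E' b(5,3) w'] by (simp add: u')
  qed
qed

section \<open>Modifications and postcomposition under the passage to sigma-cones\<close>

lemma si_modification_iff:
  "si.modification E c d r \<longleftrightarrow>
     (\<forall>x A. A \<in> KO \<longrightarrow> x \<in> Ob (F0 Q A) \<longrightarrow> (\<forall>w \<in> Ob (F0 R A). r (x, A) w \<in> hom E (slo c (x, A) w) (slo d (x, A) w))) \<and>
     (\<forall>x A. A \<in> KO \<longrightarrow> x \<in> Ob (F0 Q A) \<longrightarrow> (\<forall>k w w'. k \<in> hom (F0 R A) w w' \<longrightarrow>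
        Cmp E (r (x, A) w') (sla c (x, A) k) = Cmp E (sla d (x, A) k) (r (x, A) w))) \<and>
     (\<forall>x A f \<phi> y B. arr x A f \<phi> y B \<longrightarrow> (\<forall>w \<in> Ob (F0 R B).
        Cmp E (slt d ((x, A), (f, \<phi>), (y, B)) w) (r (x, A) (FO (F1 R f) w)) =
        Cmp E (r (y, B) w) (slt c ((x, A), (f, \<phi>), (y, B)) w)))"
proof -
  have ar: "(\<forall>u \<in> Ar SJ. P u) \<longleftrightarrow> (\<forall>x A f \<phi> y B. arr x A f \<phi> y B \<longrightarrow> P ((x, A), (f, \<phi>), (y, B)))" for P
  proof (intro iffI allI impI ballI)
    fix x A f \<phi> y B assume "\<forall>u \<in> Ar SJ. P u" "arr x A f \<phi> y B"
    then show "P ((x, A), (f, \<phi>), (y, B))" by (simp add: El_ar_iff)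
  next
    fix u assume P: "\<forall>x A f \<phi> y B. arr x A f \<phi> y B \<longrightarrow> P ((x, A), (f, \<phi>), (y, B))" and u: "u \<in> Ar SJ"
    show "P u" by (rule El_arE[OF u[unfolded SJ_sel]]) (use P in simp)
  qed
  have ob: "(\<forall>i \<in> Ob SJ. P i) \<longleftrightarrow> (\<forall>x A. A \<in> KO \<longrightarrow> x \<in> Ob (F0 Q A) \<longrightarrow> P (x, A))" for P
    by (auto simp: El_ob_def)
  have src: "FSrc (F1 R f) = F0 R B" if "arr x A f \<phi> y B" for x A f \<phi> y B
    using functor_R1(2)[OF arrD(1)[OF that]] .
  show ?thesis
    unfolding si.modification_def ar ob
    by (intro arg_cong2[of _ _ _ _ "(\<and>)"] iff_allI imp_cong refl) (simp_all add: src)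
qed

text \<open>For sigma-cones naturality concerns the second variable alone. Naturality in the first
  is encoded in compatibility with the cells at vertical arrows, and compatibility with
  \<open>t\<close> in that at cartesian arrows.\<close>

lemma to_sigma_modification_iff:
  assumes E: "ext_category E" and c: "pseudo_dicone Cat (op2 K) DT E c" and d: "pseudo_dicone Cat (op2 K) DT E d"
  shows "di.modification E c d r \<longleftrightarrow>
    si.modification E (to_sigma E c) (to_sigma E d) (\<lambda>j z. r (snd j) (pr (fst j, z)))"
proof -
  interpret c: dicone K Q R E "llo c" "lla c" "lt c" using E c by (rule dicone_pseudo_dicone)
  interpret d: dicone K Q R E "llo d" "lla d" "lt d" using E d by (rule dicone_pseudo_dicone)
  note E' = ext_category_category[OF E]
  show ?thesis
  proof
    assume "di.modification E c d r"
    note r = this[unfolded di_modification_iff]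
    note r1 = r[THEN conjunct1, rule_format] and r2 = r[THEN conjunct2, THEN conjunct1, rule_format]
      and r3 = r[THEN conjunct2, THEN conjunct2, rule_format]
    show "si.modification E (to_sigma E c) (to_sigma E d) (\<lambda>j z. r (snd j) (pr (fst j, z)))"
      unfolding si_modification_iff
    proof (intro conjI allI impI ballI, goal_cases)
      case (1 x A w) then show ?case using r1 by (simp add: to_sigma_sel)
    next
      case (2 x A k w w')
      then show ?case
        using r2[OF 2(1) id_hom[OF category_QR(1)[OF 2(1)] 2(2)] 2(3)] 2(3)[unfolded hom_iff] by (simp add: to_sigma_sel)
    next
      case (3 x A f \<phi> y B w)
      note a = arrD[OF 3(1)] and i = id_hom[OF category_QR(2)[OF arrD(5)[OF 3(1)]] 3(2)]
      note Rw = functor_ob[OF functor_R1(4)[OF a(1)] 3(2)] and Qx = functor_ob[OF functor_Q1(4)[OF a(1)] a(2)]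
      \<comment> \<open>Compatibility with \<open>t f\<close> is pasted with naturality of
        \<open>r\<close> at the pair of \<open>\<phi>\<close> and an identity.\<close>
      show ?case
        using paste_squares[OF E' r1[OF a(4,2) Rw] c.t_hom[OF a(1,2) 3(2)] d.t_hom[OF a(1,2) 3(2)] r1[OF a(5) Qx 3(2)]
          c.la_hom[OF a(5,3) i] d.la_hom[OF a(5,3) i] r1[OF a(5,6) 3(2)] r3[OF a(1,2) 3(2)] r2[OF a(5,3) i, symmetric]]
        by (simp add: to_sigma_sel(3)[OF 3])
    qed
  next
    assume "si.modification E (to_sigma E c) (to_sigma E d) (\<lambda>j z. r (snd j) (pr (fst j, z)))"
    note s = this[unfolded si_modification_iff]
    have r1: "r A (pr (x, w)) \<in> hom E (llo c A x w) (llo d A x w)" if "A \<in> KO" "x \<in> Ob (F0 Q A)" "w \<in> Ob (F0 R A)" for A x w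
      using s[THEN conjunct1, rule_format, OF that] that by (simp add: to_sigma_sel)
    have r2: "Cmp E (r A (pr (x, w'))) (lla c A (Idt (F0 Q A) x) k) = Cmp E (lla d A (Idt (F0 Q A) x) k) (r A (pr (x, w)))"
      if "A \<in> KO" "x \<in> Ob (F0 Q A)" "k \<in> hom (F0 R A) w w'" for A x k w w'
      using s[THEN conjunct2, THEN conjunct1, rule_format, OF that] that(1,2) that(3)[unfolded hom_iff] by (simp add: to_sigma_sel)
    have r3: "Cmp E (Cmp E (lla d B \<phi> (Idt (F0 R B) w)) (lt d f x w)) (r A (pr (x, FO (F1 R f) w))) =
        Cmp E (r B (pr (y, w))) (Cmp E (lla c B \<phi> (Idt (F0 R B) w)) (lt c f x w))"
      if "arr x A f \<phi> y B" "w \<in> Ob (F0 R B)" for x A f \<phi> y B w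
      using s[THEN conjunct2, THEN conjunct2, rule_format, OF that] by (simp add: to_sigma_sel(3)[OF that])
    show "di.modification E c d r"
      unfolding di_modification_iff
    proof (intro conjI allI impI ballI, goal_cases)
      case (1 A x w) then show ?case by (rule r1)
    next
      case (2 A p k x x' w w')
      note A = 2(1) note D = category_QR(2)[OF A]
      note x = hom_ob[OF category_QR(1)[OF A] 2(2)] and w = hom_ob[OF D 2(3)]
      note i = id_hom[OF D w(2)] and j = id_hom[OF category_QR(1)[OF A] x(1)]
      have "FO (F1 R (kid A)) w' = w'" using functor_R(2)[OF A] w by simp
      \<comment> \<open>Compatibility at the vertical arrow of \<open>p\<close>, where
        \<open>t\<close> is an identity, is naturality in the first variable.\<close>
      then have "Cmp E (lla d A p (Idt (F0 R A) w')) (r A (pr (x, w'))) = Cmp E (r A (pr (x', w'))) (lla c A p (Idt (F0 R A) w'))"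
        using r3[OF arr_id[OF A 2(2)] w(2)] c.t_id[OF A x(1) w(2)] d.t_id[OF A x(1) w(2)]
          cmp_id[OF E' c.la_hom[OF A 2(2) i]] cmp_id[OF E' d.la_hom[OF A 2(2) i]] by simp
      from paste_squares[OF E' r1[OF A x(1) w(1)] c.la_hom[OF A j 2(3)] d.la_hom[OF A j 2(3)] r1[OF A x(1) w(2)]
        c.la_hom[OF A 2(2) i] d.la_hom[OF A 2(2) i] r1[OF A x(2) w(2)] r2[OF A x(1) 2(3), symmetric] this]
      show ?case using c.la_split(1)[OF A 2(2,3)] d.la_split(1)[OF A 2(2,3)] by simp
    next
      case (3 f A B x w)
      note a = arr_cart[OF 3(1,2)] note b = arrD[OF a]
      show ?case
        using r3[OF a 3(3)] c.la_id[OF b(5,6) 3(3)] d.la_id[OF b(5,6) 3(3)]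
          id_cmp[OF E' c.t_hom[OF 3]] id_cmp[OF E' d.t_hom[OF 3]] by simp
    qed
  qed
qed

text \<open>The cell of the sigma-cone is a composite in the vertex category, and the functor
  \<open>u\<close> preserves it.\<close>

lemma to_sigma_act:
  assumes u: "small_functor u" and c: "pseudo_dicone Cat (op2 K) DT (FSrc u) c"
  shows "to_sigma (FTgt u) (di.act u c) = si.act u (to_sigma (FSrc u) c)"
proof -
  note E = small_functorD(1,2)[OF u] and U = small_functorD(7)[OF u]
  interpret c: dicone K Q R "FSrc u" "llo c" "lla c" "lt c" using E(1) c by (rule dicone_pseudo_dicone)
  have pc: "di.precone (FSrc u) c" "DX (FSrc u) c" using c by (simp_all add: pseudo_dicone_iff[OF E(1)])
  note ps = to_sigma[OF E(1) c, unfolded sigma_cone_iff[OF E(1)], THEN conjunct1]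
  have "pseudo_dicone Cat (op2 K) DT (FTgt u) (di.act u c)"
    using di.precone_act[OF pc(1) u refl] di_act[OF u pc] by (simp add: pseudo_dicone_iff[OF E(2)])
  note p1 = to_sigma[OF E(2) this, unfolded sigma_cone_iff[OF E(2)], THEN conjunct1]
  note p2 = si.precone_act[OF ps u refl]
  note s = di.act_sel[OF pc(1) u refl] and s' = si.act_sel[OF ps u refl]
  show ?thesis
  proof (rule si.precone_eqI[OF p1 p2])
    fix i w assume "i \<in> Ob SJ" "w \<in> Ob (SD i)"
    then show "slo (to_sigma (FTgt u) (di.act u c)) i w = slo (si.act u (to_sigma (FSrc u) c)) i w"
      by (cases i) (simp add: s' s El_ob_iff to_sigma_sel)
  next
    fix i k assume i: "i \<in> Ob SJ" and k: "k \<in> Ar (SD i)"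
    obtain x A where i': "i = (x, A)" by (cases i)
    then have A: "A \<in> KO" "x \<in> Ob (F0 Q A)" and k': "k \<in> Ar (F0 R A)" using i k by (simp_all add: El_ob_iff)
    have "Idt (F0 Q A) x \<in> Ar (F0 Q A)" using id_hom[OF category_QR(1)[OF A(1)] A(2)] by (simp add: hom_iff)
    then show "sla (to_sigma (FTgt u) (di.act u c)) i k = sla (si.act u (to_sigma (FSrc u) c)) i k"
      using A k' by (simp add: i' s' s El_ob_iff to_sigma_sel)
  next
    fix v w assume v: "v \<in> Ar SJ" and w: "w \<in> Ob (FSrc (SS v))"
    obtain x A f \<phi> y B where v': "v = ((x, A), (f, \<phi>), (y, B))" and a: "arr x A f \<phi> y B"
      by (rule El_arE[OF v[unfolded SJ_sel]])
    note b = arrD[OF a]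
    have w': "w \<in> Ob (F0 R B)" using w functor_R1[OF b(1)] by (simp add: v')
    note i = id_hom[OF category_QR(2)[OF b(5)] w']
    have "\<phi> \<in> Ar (F0 Q B)" "Idt (F0 R B) w \<in> Ar (F0 R B)"
      using b(3) i by (simp_all add: hom_iff)
    then have 1: "FA (leg (di.act u c) B) (pr (\<phi>, Idt (F0 R B) w)) = FA u (lla c B \<phi> (Idt (F0 R B) w))"
      using b(5) by (simp add: s)
    have "pr (x, w) \<in> Ob (FSrc (DS1 f))" "f \<in> Ar DJ"
      using slot(5)[OF b(1,4)] b(1,2) w' by (simp_all add: hom_iff)
    then have 2: "NC (cel (di.act u c) f) (pr (x, w)) = FA u (lt c f x w)"
      by (intro s)
    have "slt (si.act u (to_sigma (FSrc u) c)) v w = FA u (slt (to_sigma (FSrc u) c) v w)"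
      using v w by (rule s')
    also have "\<dots> = slt (to_sigma (FTgt u) (di.act u c)) v w"
      using functor_cmp[OF U c.t_hom[OF b(1,2) w'] c.la_hom[OF b(5,3) i]]
      by (simp add: v' to_sigma_sel(3)[OF a w'] 1 2)
    finally show "slt (to_sigma (FTgt u) (di.act u c)) v w = slt (si.act u (to_sigma (FSrc u) c)) v w" ..
  qed
qed

lemma equivalent_sigma:
  "equivalent_universal_properties Cat (pseudo_dicones Cat (op2 K) (prod_fun2 Q R))
     (sigma_cones Cat (op2 (El K Q)) (El_cart K Q) (comp_fun2 R El_proj))"
  "equivalent_universal_properties Cat (sigma_cones Cat (op2 (El K Q)) (El_cart K Q) (comp_fun2 R El_proj))
     (pseudo_dicones Cat (op2 K) (prod_fun2 Q R))"
proof -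
  \<comment> \<open>The object sets correspond by currying: an object \<open>w\<close> at the index
    \<open>(x, A)\<close> of a sigma-cone is the object \<open>pr (x, w)\<close> at the index
    \<open>A\<close> of a dicone.\<close>
  have "cone_reindexing DJ DD DS1 DS2 (Dm (One K)) (Cd (One K)) (\<lambda>E. {l. pseudo_dicone Cat (op2 K) DT E l})
     (\<lambda>l l' \<rho>. \<forall>f \<in> Ar DJ.
        Cmp (Two Cat) (cel l' f) (rwhisk Cat (\<rho> (Cd DJ f)) (slot2 (op2 K) DT (Cd DJ f) f)) =
        Cmp (Two Cat) (rwhisk Cat (\<rho> (Dm DJ f)) (slot1 (op2 K) DT f (Dm DJ f))) (cel l f)) DX
     SJ SD SS SI sdm scd (\<lambda>E. {l. sigma_cone Cat (op2 (El K Q)) SC SF E l})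
     (\<lambda>\<theta> \<theta>' \<rho>. \<forall>u \<in> Ar SJ.
        Cmp (Two Cat) (cel \<theta>' u) (rwhisk Cat (\<rho> (sdm u)) (SS u)) = Cmp (Two Cat) (\<rho> (scd u)) (cel \<theta> u)) SX
     snd (\<lambda>j z. pr (fst j, z)) (\<lambda>A z. (p1 z, A)) (\<lambda>A z. p2 z) to_sigma"
  proof (rule cone_reindexing.intro[OF di.cone_category_axioms si.cone_category_axioms],
      rule cone_reindexing_axioms.intro, goal_cases)
    case (9 E)
    show ?case
      by (rule bij_betwI[where g = "to_dicone E"])
        (use to_sigma[OF 9] to_dicone[OF 9] to_dicone_to_sigma[OF 9] to_sigma_to_dicone[OF 9] in auto)
  next
    case (10 E c j z) then show ?case by (cases j) (simp add: El_ob_iff to_sigma_sel)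
  next
    case (11 E c d r) then show ?case using to_sigma_modification_iff by simp
  next
    case (12 u c) then show ?case using to_sigma_act by simp
  next
    case (13 u c) then show ?case by (rule di_act)
  qed (auto simp: El_ob_def)
  note cone_reindexing.equivalent_UV[OF this, unfolded di_U si_U]
  then show "equivalent_universal_properties Cat (pseudo_dicones Cat (op2 K) (prod_fun2 Q R))
     (sigma_cones Cat (op2 (El K Q)) (El_cart K Q) (comp_fun2 R El_proj))"
    "equivalent_universal_properties Cat (sigma_cones Cat (op2 (El K Q)) (El_cart K Q) (comp_fun2 R El_proj))
     (pseudo_dicones Cat (op2 K) (prod_fun2 Q R))" .
qed

end

lemma cat_pairI:
  assumes "two_category K" "two_functor K Cat Q" "two_functor (op2 K) Cat R"
  shows "cat_pair K Q R"
proof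
  have K: "category (One K)" "category (Two K)" "Ob (Two K) = Ar (One K)"
    "\<And>\<gamma>. \<gamma> \<in> Ar (Two K) \<Longrightarrow> Dm (One K) (Cd (Two K) \<gamma>) = dm0 K \<gamma> \<and> Cd (One K) (Cd (Two K) \<gamma>) = cd0 K \<gamma>"
    using assms(1) by (simp_all add: two_category_def)
  then show "category (One K)" "Ob (Two K) = Ar (One K)" by simp_all
  fix \<gamma> assume \<gamma>: "\<gamma> \<in> Ar (Two K)"
  show "Dm (Two K) \<gamma> \<in> Ar (One K)" "Cd (Two K) \<gamma> \<in> Ar (One K)"
    using hom_ob[OF K(2) hom_self[OF \<gamma>]] K(3) by simp_all
  show "Dm (One K) (Cd (Two K) \<gamma>) = dm0 K \<gamma>" "Cd (One K) (Cd (Two K) \<gamma>) = cd0 K \<gamma>"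
    using K(4)[OF \<gamma>] by simp_all
qed (use assms in simp_all)

theorem proposition2p4p11:
  fixes A :: "('a, 'f, 'c) cat2"
    and P W :: "('a, 'f, 'c, 'u::infinite) cat_functor"
  assumes "two_category A"
    and "two_functor A Cat P"
    and "two_functor (op2 A) Cat W"
  shows
    "equivalent_universal_properties Cat
       (sigma_cones Cat (op2 (El A P)) (El_cart A P) (comp_fun2 W El_proj))
       (pseudo_dicones Cat (op2 A) (prod_fun2 P W)) \<and>
     equivalent_universal_properties Cat
       (pseudo_dicones Cat (op2 A) (prod_fun2 P W))
       (pseudo_dicones Cat A (prod_fun2 W P)) \<and>
     equivalent_universal_properties Cat
       (pseudo_dicones Cat A (prod_fun2 W P))
       (sigma_cones Cat (op2 (El (op2 A) W)) (El_cart (op2 A) W) (comp_fun2 P El_proj))"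
proof -
  interpret A: cat_pair A P W using assms by (rule cat_pairI)
  \<comment> \<open>In this instance the dicones are indexed by \<open>op2 (op2 A)\<close>, that is
    by \<open>A\<close>, and are thus the target of the swap in the first instance.\<close>
  interpret O: cat_pair "op2 A" W P by (rule A.swap)
  show ?thesis
    using A.equivalent_sigma(2) A.equivalent_swap O.equivalent_sigma(1) unfolding A.op2_op2 by blast
qed

end
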